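(* Consider the Gaussian white noise model and the wavelet truncation estimator $\widehat f=\widehat f_n$ defined in the context (which does not depend on $\beta$ or $Q$). For any $\beta,Q\in(0,\infty)$ there exists a constant $C$ such that $$\limsup_{n\to\infty}\ \sup_{1\le p\le\infty}\ \sup_{f\in\Theta(\beta,Q)}\Big[\frac{n^{\beta/(2\beta+1)}}{\sqrt p}+\Big(\frac n{\log n}\Big)^{\beta/(2\beta+1)}\Big]\,\mathbb{E}_f\big[\|\widehat f-f\|_p\big]\le C<\infty,$$ where $1/\sqrt{p}:=0$ for $p=\infty$. In particular, $\widehat f$ is simultaneously adaptive with respect to any $L^p$-loss with $1\le p\le\infty$: for all $\beta,Q\in(0,\infty)$, $\sup_{f\in\Theta(\beta,Q)}\mathbb{E}_f[\|\widehat f-f\|_p]$ is $O(n^{-\beta/(2\beta+1)})$ for every $1\le p<\infty$ and $O((n/\log n)^{-\beta/(2\beta+1)})$ for $p=\infty$.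
   Context: Model: one observes $(Y_t)_{t\in[0,1]}$ with $dY_t=f(t)\,dt+n^{-1/2}dW_t$, $W$ a Brownian motion; $\mathbb{E}_f$ denotes expectation under regression function $f$. $\|\cdot\|_p$ is the $L^p$-norm on $[0,1]$. Wavelets: $(\phi,\psi)$ is a scaling and wavelet function generating an orthonormal wavelet basis $\{\psi_{j,k}: j\ge -1,\ k\in I_j\}$ of $L^2[0,1]$, where $\psi_{-1,k}=\phi(\cdot-k)$ and $\psi_{j,k}=2^{j/2}\psi(2^j\cdot-k)$ for $j\ge 0$ (near the endpoints of $[0,1]$ one uses the boundary-adapted functions of the Cohen–Daubechies–Vial construction). The basis is $s$-regular: $\phi,\psi$ have compact support and are $s$-times continuously differentiable. $I_j$ is the finite set of indices on resolution level $j$, and $|I_j|\asymp 2^j$. There is a constant $C_0$ independent of $p$ with $\|\sum_{j\ge-1}\sum_{k\in I_j}d_{j,k}\psi_{j,k}\|_p\le C_0\sum_{j\ge-1}2^{j(\frac12-\frac1p)}\|(d_{j,k})_{k\in I_j}\|_{\ell^p}$ for all $1\le p\le\infty$. For $f\in L^2[0,1]$, $d_{j,k}=\int f\psi_{j,k}$. The empirical wavelet coefficients are $Y_{j,k}=\int\psi_{j,k}(u)\,dY_u=d_{j,k}+n^{-1/2}\epsilon_{j,k}$, with $(\epsilon_{j,k})$ i.i.d. standard normal. Parameter space: $\Theta(\beta,Q)=\{f=\sum_{j=-1}^\infty\sum_{k\in I_j}d_{j,k}\psi_{j,k}:\ |d_{j,k}|\le Q2^{-\frac j2(2\beta+1)}\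 \text{for all } j\ge-1,\ k\in I_j\}$. Estimator: let $\mathcal{P}=\mathcal{P}_n=\{p: p=2^r,\ r=0,1,2,\ldots,\ p+1\le \log n/(\log\log n)^2\}$ ($n$ large enough that $\mathcal P\neq\emptyset$) and $K_p=(6\sqrt2 e+1)p^{p/2}$. For a level $j$ and $p\in\mathcal{P}$ put $D_{j,p}=\{S\subset I_j:\ \sum_{k\in S}|Y_{j,k}|^p\ge 2^pK_pn^{-p/2}|I_j|\}$, $L_{j,p}=\min_{S\in D_{j,p}}|S|$ (with $L_{j,p}=\infty$ if $D_{j,p}=\emptyset$), and $t_{j,p}=\frac2{\sqrt n}\big(\frac{K_p|I_j|}{L_{j,p}-1}\big)^{1/p}$, with the conventions $1/0=+\infty$ and $1/\infty=0$. Let $u_n=1/\log\log n$, let $J_0$ be the smallest $j$ with $|I_j|>n^{u_n}$, and let $J$ be an integer (depending on $n$) with $2^J\asymp n$. For $J_0<j\le J$ set $t_j=\infty$ if $\max_{k\in I_j}|Y_{j,k}|>3\sqrt{\log n/n}$, and $t_j=\max_{p\in\mathcal{P}}t_{j,p}$ otherwise; and $\widehat d_{j,k}=\operatorname{sign}(Y_{j,k})(|Y_{j,k}|\wedge t_j)$. Finally $$\widehat f=\sum_{j=-1}^{J_0}\sum_{k\in I_j}Y_{j,k}\psi_{j,k}+\sum_{j=J_0+1}^{J}\sum_{k\in I_j}\widehat d_{j,k}\psi_{j,k}.$$ $a_n\asymp b_n$ means $a_n/b_n$ is bounded above and below by positive constants; $a\wedge b=\min(a,b)$. *)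

theory Defs
  imports "HOL-Probability.Probability"
begin

section \<open>Norms and bases of \<open>L\<^sup>2\<close>\<close>

text \<open>Power of an extended nonnegative real, for exponents \<open>a > 0\<close> only.\<close>

definition epowr :: "ennreal \<Rightarrow> real \<Rightarrow> ennreal" where
  "epowr x a = (if x = \<top> then \<top> else ennreal (enn2real x powr a))"

text \<open>The norm takes the value \<open>\<top>\<close> when \<open>g\<close> is not in \<open>L\<^sup>p\<close>. Taking \<^term>\<open>M\<close> to be a counting
  measure gives the \<open>\<ell>\<^sup>p\<close>-norm.\<close>

definition Lp_norm :: "ennreal \<Rightarrow> 'a measure \<Rightarrow> ('a \<Rightarrow> real) \<Rightarrow> ennreal" where
  "Lp_norm p M g =
     (if p = \<top> then esssup M (\<lambda>x. ennreal \<bar>g x\<bar>)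
      else epowr (\<integral>\<^sup>+x. ennreal (\<bar>g x\<bar> powr enn2real p) \<partial>M) (1 / enn2real p))"

definition unit_measure :: "real measure" where
  "unit_measure = restrict_space lborel {0..1}"

definition square_integrable :: "'a measure \<Rightarrow> ('a \<Rightarrow> real) \<Rightarrow> bool" where
  "square_integrable M g \<longleftrightarrow> g \<in> borel_measurable M \<and> integrable M (\<lambda>x. (g x)\<^sup>2)"

definition L2_dist_sq :: "'a measure \<Rightarrow> ('a \<Rightarrow> real) \<Rightarrow> ('a \<Rightarrow> real) \<Rightarrow> ennreal" where
  "L2_dist_sq M g h = (\<integral>\<^sup>+x. ennreal ((g x - h x)\<^sup>2) \<partial>M)"

definition orthonormal_basis :: "'a measure \<Rightarrow> 'i set \<Rightarrow> ('i \<Rightarrow> 'a \<Rightarrow> real) \<Rightarrow> bool" where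
  "orthonormal_basis M A e \<longleftrightarrow>
     (\<forall>i\<in>A. square_integrable M (e i)) \<and>
     (\<forall>i\<in>A. \<forall>i'\<in>A. (\<integral>x. e i x * e i' x \<partial>M) = (if i = i' then 1 else 0)) \<and>
     (\<forall>g. square_integrable M g \<longrightarrow> (\<forall>i\<in>A. (\<integral>x. g x * e i x \<partial>M) = 0) \<longrightarrow> (AE x in M. g x = 0))"

definition comparable_on :: "'a set \<Rightarrow> ('a \<Rightarrow> real) \<Rightarrow> ('a \<Rightarrow> real) \<Rightarrow> bool" where
  "comparable_on A a b \<longleftrightarrow> (\<exists>c>0. \<exists>c'>0. \<forall>x\<in>A. c * b x \<le> a x \<and> a x \<le> c' * b x)"


section \<open>Wavelet bases of the unit interval\<close>

definition regular :: "nat \<Rightarrow> (real \<Rightarrow> real) \<Rightarrow> bool" where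
  "regular s g \<longleftrightarrow>
     compact (closure {x. g x \<noteq> 0}) \<and>
     (\<forall>i<s. \<forall>x. (deriv ^^ i) g differentiable (at x)) \<and>
     continuous_on UNIV ((deriv ^^ s) g)"

definition wavelet :: "(real \<Rightarrow> real) \<Rightarrow> (real \<Rightarrow> real) \<Rightarrow> int \<Rightarrow> int \<Rightarrow> real \<Rightarrow> real" where
  "wavelet \<phi> \<psi> j k x =
     (if j = -1 then \<phi> (x - of_int k)
      else 2 powr (of_int j / 2) * \<psi> (2 powr of_int j * x - of_int k))"

definition scaling_comb :: "(real \<Rightarrow> real) \<Rightarrow> nat \<Rightarrow> (real \<Rightarrow> real) \<Rightarrow> bool" where
  "scaling_comb \<phi> m g \<longleftrightarrow>
     (\<exists>(F :: int set) (c :: int \<Rightarrow> real). finite F \<and>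
        (\<forall>x. g x = (\<Sum>k\<in>F. c k * \<phi> (2 ^ m * x - of_int k))))"

text \<open>The expansion of \<open>f\<close> with coefficients \<open>d\<close> converges in \<open>L\<^sup>2\<close>, level by level;
  only the coefficients with \<open>j \<ge> -1\<close> and \<open>k \<in> I j\<close> matter.\<close>

definition has_expansion ::
  "(int \<Rightarrow> int set) \<Rightarrow> (int \<Rightarrow> int \<Rightarrow> real \<Rightarrow> real) \<Rightarrow> (int \<Rightarrow> int \<Rightarrow> real) \<Rightarrow> (real \<Rightarrow> real) \<Rightarrow> bool"
where
  "has_expansion I b d f \<longleftrightarrow>
     f \<in> borel_measurable unit_measure \<and>
     (\<lambda>m::nat. L2_dist_sq unit_measure f (\<lambda>x. \<Sum>j\<in>{-1..int m}. \<Sum>k\<in>I j. d j k * b j k x))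
       \<longlonglongrightarrow> 0"

text \<open>The pair \<open>(\<phi>, \<psi>)\<close> generates a compactly supported orthonormal wavelet basis of the line, and
  \<open>b j k\<close> (for \<open>k \<in> I j\<close>) is the resulting basis of the unit interval. As in the construction of Cohen,
  Daubechies and Vial, each \<open>b j k\<close> is either an ordinary wavelet or the dilate, anchored at \<open>0\<close> or
  at \<open>1\<close>, of one of finitely many edge functions, which are finite combinations of dyadic dilates
  and translates of \<open>\<phi>\<close>. Allowing arbitrary dyadic scales \<open>m\<close> accommodates the coarse
  levels, where the two edges interact. Edge functions on level \<open>-1\<close> are used at scale \<open>0\<close>, as is \<open>\<phi>\<close>.\<close>

locale interval_wavelet_basis =
  fixes \<phi> \<psi> :: "real \<Rightarrow> real" and s :: nat
    and I :: "int \<Rightarrow> int set" and b :: "int \<Rightarrow> int \<Rightarrow> real \<Rightarrow> real"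
  assumes regular_scaling: "regular s \<phi>" and regular_wavelet: "regular s \<psi>"
    and refinement: "scaling_comb \<phi> 1 \<phi>" "scaling_comb \<phi> 1 \<psi>"
    and line_basis: "orthonormal_basis lborel ({-1..} \<times> UNIV) (\<lambda>(j, k). wavelet \<phi> \<psi> j k)"
    and finite_index: "\<And>j. -1 \<le> j \<Longrightarrow> finite (I j)"
    and card_index: "comparable_on {-1..} (\<lambda>j. real (card (I j))) (\<lambda>j. 2 powr of_int j)"
    and unit_basis: "orthonormal_basis unit_measure (Sigma {-1..} I) (\<lambda>(j, k). b j k)"
    and shape: "\<exists>E. finite E \<and> (\<forall>g\<in>E. \<exists>m. scaling_comb \<phi> m g) \<and>
      (\<forall>j\<ge>-1. \<forall>k\<in>I j.
        (\<forall>x\<in>{0..1}. b j k x = wavelet \<phi> \<psi> j k x) \<or>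
        (\<exists>g\<in>E. \<exists>a\<in>{0, 1}. \<forall>x\<in>{0..1}.
           b j k x = 2 powr (of_int (max j 0) / 2) * g (2 powr of_int (max j 0) * (x - a))))"
    and norm_bound: "\<exists>C0 :: real. \<forall>p\<ge>1. \<forall>d f. has_expansion I b d f \<longrightarrow>
      Lp_norm p unit_measure f \<le>
        ennreal C0 *
          (\<Sum>i::nat. let j = int i - 1 in
             ennreal (2 powr (of_int j * (1/2 - (if p = \<top> then 0 else 1 / enn2real p)))) *
             Lp_norm p (count_space (I j)) (d j))"

definition param_space ::
  "(int \<Rightarrow> int set) \<Rightarrow> (int \<Rightarrow> int \<Rightarrow> real \<Rightarrow> real) \<Rightarrow> real \<Rightarrow> real \<Rightarrow> (real \<Rightarrow> real) set"
where
  "param_space I b \<beta> Q =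
     {f. \<exists>d. has_expansion I b d f \<and>
           (\<forall>j\<ge>-1. \<forall>k\<in>I j. \<bar>d j k\<bar> \<le> Q * 2 powr (- (of_int j / 2) * (2 * \<beta> + 1)))}"


section \<open>The Gaussian white noise model\<close>

locale brownian_motion = prob_space M for M :: "'w measure" +
  fixes W :: "real \<Rightarrow> 'w \<Rightarrow> real"
  assumes random_variable: "\<And>t. t \<in> {0..1} \<Longrightarrow> W t \<in> borel_measurable M"
    and start: "AE \<omega> in M. W 0 \<omega> = 0"
    and continuous_paths: "AE \<omega> in M. continuous_on {0..1} (\<lambda>t. W t \<omega>)"
    and gaussian_increments: "\<And>r t. 0 \<le> r \<Longrightarrow> r < t \<Longrightarrow> t \<le> 1 \<Longrightarrow>
      distributed M lborel (\<lambda>\<omega>. W t \<omega> - W r \<omega>) (normal_density 0 (sqrt (t - r)))"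
    and independent_increments: "\<And>(m::nat) \<tau>. (\<And>i. i \<le> m \<Longrightarrow> \<tau> i \<in> {0..1}) \<Longrightarrow>
      (\<And>i. i < m \<Longrightarrow> \<tau> i < \<tau> (Suc i)) \<Longrightarrow>
      indep_vars (\<lambda>_. borel) (\<lambda>i \<omega>. W (\<tau> (Suc i)) \<omega> - W (\<tau> i) \<omega>) {..<m}"

definition white_noise :: "(real \<Rightarrow> 'w \<Rightarrow> real) \<Rightarrow> nat \<Rightarrow> (real \<Rightarrow> real) \<Rightarrow> real \<Rightarrow> 'w \<Rightarrow> real" where
  "white_noise W n f t \<omega> = (LINT u:{0..t}|lborel. f u) + W t \<omega> / sqrt (real n)"

text \<open>A list of triples \<open>(c, u, v)\<close> stands for the step function \<open>\<Sum> c \<cdot> 1\<^bsub>(u, v]\<^esub>\<close>. The integral of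
  a square-integrable function is the limit in mean square of integrals of step functions
  and hence only determined almost surely; \<open>stoch_integral\<close> picks a version.\<close>

type_synonym step = "(real \<times> real \<times> real) list"

definition step_fun :: "step \<Rightarrow> real \<Rightarrow> real" where
  "step_fun S x = (\<Sum>(c, u, v)\<leftarrow>S. c * indicator {u<..v} x)"

definition step_integral :: "(real \<Rightarrow> 'w \<Rightarrow> real) \<Rightarrow> step \<Rightarrow> 'w \<Rightarrow> real" where
  "step_integral Y S \<omega> = (\<Sum>(c, u, v)\<leftarrow>S. c * (Y v \<omega> - Y u \<omega>))"

definition has_stoch_integral ::
  "'w measure \<Rightarrow> (real \<Rightarrow> 'w \<Rightarrow> real) \<Rightarrow> (real \<Rightarrow> real) \<Rightarrow> ('w \<Rightarrow> real) \<Rightarrow> bool"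
where
  "has_stoch_integral M Y g X \<longleftrightarrow>
     X \<in> borel_measurable M \<and>
     (\<exists>S :: nat \<Rightarrow> step.
        (\<forall>m. \<forall>(c, u, v)\<in>set (S m). 0 \<le> u \<and> u \<le> v \<and> v \<le> 1) \<and>
        (\<lambda>m. L2_dist_sq unit_measure g (step_fun (S m))) \<longlonglongrightarrow> 0 \<and>
        (\<lambda>m. L2_dist_sq M X (step_integral Y (S m))) \<longlonglongrightarrow> 0)"

definition stoch_integral ::
  "'w measure \<Rightarrow> (real \<Rightarrow> 'w \<Rightarrow> real) \<Rightarrow> (real \<Rightarrow> real) \<Rightarrow> 'w \<Rightarrow> real"
where
  "stoch_integral M Y g = (SOME X. has_stoch_integral M Y g X)"


section \<open>The truncation estimator\<close>

text \<open>Throughout, \<open>y j k\<close> are the observed coefficients. Everything depends on the data only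
  through \<open>n\<close> and \<open>y\<close>.\<close>

definition exponents :: "nat \<Rightarrow> nat set" where
  "exponents n = {p. (\<exists>r. p = 2 ^ r) \<and> real p + 1 \<le> ln (real n) / (ln (ln (real n)))\<^sup>2}"

definition K_const :: "nat \<Rightarrow> real" where
  "K_const p = (6 * sqrt 2 * exp 1 + 1) * real p powr (real p / 2)"

definition D_sets :: "(int \<Rightarrow> int set) \<Rightarrow> nat \<Rightarrow> (int \<Rightarrow> int \<Rightarrow> real) \<Rightarrow> int \<Rightarrow> nat \<Rightarrow> int set set" where
  "D_sets I n y j p =
     {S. S \<subseteq> I j \<and>
         (\<Sum>k\<in>S. \<bar>y j k\<bar> ^ p) \<ge> 2 ^ p * K_const p * real n powr (- (real p / 2)) * real (card (I j))}"

text \<open>The infimum over the empty family is \<open>\<top>\<close>.\<close>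

definition L_min :: "(int \<Rightarrow> int set) \<Rightarrow> nat \<Rightarrow> (int \<Rightarrow> int \<Rightarrow> real) \<Rightarrow> int \<Rightarrow> nat \<Rightarrow> ennreal" where
  "L_min I n y j p = (INF S\<in>D_sets I n y j p. of_nat (card S))"

text \<open>Division on \<^typ>\<open>ennreal\<close> obeys \<open>x / 0 = \<top>\<close> for \<open>x > 0\<close> and \<open>x / \<top> = 0\<close>.\<close>

definition threshold_p :: "(int \<Rightarrow> int set) \<Rightarrow> nat \<Rightarrow> (int \<Rightarrow> int \<Rightarrow> real) \<Rightarrow> int \<Rightarrow> nat \<Rightarrow> ennreal" where
  "threshold_p I n y j p =
     ennreal (2 / sqrt (real n)) *
     epowr (ennreal (K_const p * real (card (I j))) / (L_min I n y j p - 1)) (1 / real p)"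

definition threshold :: "(int \<Rightarrow> int set) \<Rightarrow> nat \<Rightarrow> (int \<Rightarrow> int \<Rightarrow> real) \<Rightarrow> int \<Rightarrow> ennreal" where
  "threshold I n y j =
     (if (MAX k\<in>I j. \<bar>y j k\<bar>) > 3 * sqrt (ln (real n) / real n) then \<top>
      else SUP p\<in>exponents n. threshold_p I n y j p)"

definition truncated_coeff ::
  "(int \<Rightarrow> int set) \<Rightarrow> nat \<Rightarrow> (int \<Rightarrow> int \<Rightarrow> real) \<Rightarrow> int \<Rightarrow> int \<Rightarrow> real"
where
  "truncated_coeff I n y j k =
     sgn (y j k) * enn2real (min (ennreal \<bar>y j k\<bar>) (threshold I n y j))"

definition J0_level :: "(int \<Rightarrow> int set) \<Rightarrow> nat \<Rightarrow> int" where
  "J0_level I n = (LEAST j. -1 \<le> j \<and> real (card (I j)) > real n powr (1 / ln (ln (real n))))"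

definition estimator ::
  "(int \<Rightarrow> int set) \<Rightarrow> (int \<Rightarrow> int \<Rightarrow> real \<Rightarrow> real) \<Rightarrow> (nat \<Rightarrow> int) \<Rightarrow> nat \<Rightarrow> (int \<Rightarrow> int \<Rightarrow> real) \<Rightarrow> real \<Rightarrow> real"
where
  "estimator I b J n y x =
     (\<Sum>j\<in>{-1..J0_level I n}. \<Sum>k\<in>I j. y j k * b j k x) +
     (\<Sum>j\<in>{J0_level I n + 1..J n}. \<Sum>k\<in>I j. truncated_coeff I n y j k * b j k x)"

text \<open>The expected \<open>L\<^sup>p\<close>-loss when the regression function is \<open>f\<close>.\<close>

definition risk ::
  "'w measure \<Rightarrow> (real \<Rightarrow> 'w \<Rightarrow> real) \<Rightarrow> (int \<Rightarrow> int set) \<Rightarrow> (int \<Rightarrow> int \<Rightarrow> real \<Rightarrow> real) \<Rightarrow>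
   (nat \<Rightarrow> int) \<Rightarrow> nat \<Rightarrow> ennreal \<Rightarrow> (real \<Rightarrow> real) \<Rightarrow> ennreal"
where
  "risk M W I b J n p f =
     (\<integral>\<^sup>+\<omega>. Lp_norm p unit_measure
        (\<lambda>x. estimator I b J n (\<lambda>j k. stoch_integral M (white_noise W n f) (b j k) \<omega>) x - f x) \<partial>M)"

end

theory Submission
  imports Defs "HOL-Real_Asymp.Real_Asymp"
begin

text \<open>
  The empirical coefficients are \<open>d\<^sub>j\<^sub>k + n\<^bsup>-1/2\<^esup> \<epsilon>\<^sub>j\<^sub>k\<close> with independent standard normal \<open>\<epsilon>\<^sub>j\<^sub>k\<close> on each
  level: stochastic integrals of continuous functions are mean-square limits of Gaussian sums, so
  their joint characteristic function is that of independent normals, and joint characteristic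
  functions determine independence. By the norm bound for the basis it remains to control the
  normalised \<open>\<ell>\<^sup>p\<close>-means of the coefficient errors level by level. Outside an event of probability
  \<open>O(n\<^bsup>-3\<^esup>)\<close>, given by Gaussian tails and Hoeffding's inequality for clipped moments, one has on every
  level \<open>J\<^sub>0 < j \<le> J\<close>, with \<open>B\<^sub>j\<close> the bound on the coefficients of \<open>f\<close>: minimality of \<open>L\<^sub>j\<^sub>,\<^sub>p\<close> limits the
  truncated coefficients to a set whose \<open>\<ell>\<^sup>p\<close>-mass is of the order of the noise, so the \<open>p\<close>-mean of the
  error is \<open>O((p/n)\<^bsup>1/2\<^esup>)\<close> and the maximal error \<open>O((log n/n)\<^bsup>1/2\<^esup>)\<close>; and as soon as
  \<open>B\<^sub>j\<close> is below a small multiple of \<open>(log n/n)\<^bsup>1/2\<^esup>\<close>, every threshold is at most \<open>4B\<^sub>j\<close>, so the error is at most \<open>5B\<^sub>j\<close>.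
  Summing these bounds over dyadic levels gives both rates. For \<open>p \<ge> (log n)\<^bsup>2\<beta>/(2\<beta>+1)\<^esup>\<close> the
  sup-norm rate already implies the one for \<open>L\<^sup>p\<close>; a smaller \<open>p\<close> is rounded up to a power of two.
\<close>

subsection \<open>Square-integrable functions\<close>

text \<open>The power sums of the noise must concentrate for all \<open>p\<close> in
  \<open>exponents n\<close> at once, but |\<epsilon>|^p is unbounded and its variance explodes with
  \<open>p\<close>. Clipping at (3 sqrt(log n))^p makes Hoeffding applicable and changes nothing
  unless some noise exceeds 2.9 sqrt(log n). The price is the range (9 log n)^(p/2), which the
  number of coefficients has to outweigh: hence only levels with at least of the order of n^(1/log
  log n) coefficients are truncated, and \<open>p\<close> stays below log n / (log log n)^2. The 2.9
  is a compromise: 2.9^2/2 > 4.2 survives a union over O(n) coefficients, and 3 - 2.9 = 1/10 is the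
  room left for the signal before the test against 3 sqrt(log n / n) can fire; this is the small
  multiple of the overview. The exceptional event does not involve the loss exponent, so the bounds
  are uniform in it. On that event only bounds growing polynomially in \<open>n\<close> are
  available, whence the probability n^(-3). Independence is used only within one level.\<close>

lemma square_integrable_measurable: "square_integrable M f \<Longrightarrow> f \<in> borel_measurable M"
  and square_integrable_integrable: "square_integrable M f \<Longrightarrow> integrable M (\<lambda>x. (f x)\<^sup>2)"
  by (simp_all add: square_integrable_def)

lemma square_integrable_mult:
  assumes "square_integrable M f" "square_integrable M g"
  shows "integrable M (\<lambda>x. f x * g x)"
proof (rule Bochner_Integration.integrable_bound)
  show "integrable M (\<lambda>x. (f x)\<^sup>2 + (g x)\<^sup>2)"
    using assms by (auto simp: square_integrable_def)
  show "(\<lambda>x. f x * g x) \<in> borel_measurable M"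
    using assms by (auto simp: square_integrable_def)
  have "\<bar>a * b\<bar> \<le> a\<^sup>2 + b\<^sup>2" for a b :: real
    using sum_squares_bound[of a b] sum_squares_bound[of a "-b"] zero_le_power2[of a] zero_le_power2[of b]
    by (simp add: abs_if)
  then show "AE x in M. norm (f x * g x) \<le> norm ((f x)\<^sup>2 + (g x)\<^sup>2)"
    by simp
qed

lemma square_integrable_scale:
  "square_integrable M f \<Longrightarrow> square_integrable M (\<lambda>x. c * f x)"
  by (auto simp: square_integrable_def power_mult_distrib)

lemma square_integrable_add:
  assumes "square_integrable M f" "square_integrable M g"
  shows "square_integrable M (\<lambda>x. f x + g x)"
proof -
  have "integrable M (\<lambda>x. (f x)\<^sup>2 + (g x)\<^sup>2 + 2 * (f x * g x))"
    using assms square_integrable_mult[OF assms] by (auto simp: square_integrable_def)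
  then show ?thesis
    using assms by (auto simp: square_integrable_def power2_sum mult.assoc)
qed

lemma square_integrable_diff:
  assumes "square_integrable M f" "square_integrable M g"
  shows "square_integrable M (\<lambda>x. f x - g x)"
  using square_integrable_add[OF assms(1) square_integrable_scale[OF assms(2), of "-1"]] by simp

lemma square_integrable_zero: "square_integrable M (\<lambda>x. 0)"
  by (simp add: square_integrable_def)

lemma square_integrable_sum:
  assumes "\<And>i. i \<in> F \<Longrightarrow> square_integrable M (f i)"
  shows "square_integrable M (\<lambda>x. \<Sum>i\<in>F. f i x)"
  using assms
  by (induction F rule: infinite_finite_induct) (auto simp: square_integrable_zero square_integrable_add)

lemma (in finite_measure) square_integrable_bounded:
  assumes "f \<in> borel_measurable M" "\<And>x. x \<in> space M \<Longrightarrow> \<bar>f x\<bar> \<le> B"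
  shows "square_integrable M f"
  unfolding square_integrable_def
proof
  show "integrable M (\<lambda>x. (f x)\<^sup>2)"
  proof (rule integrable_const_bound)
    show "AE x in M. norm ((f x)\<^sup>2) \<le> B\<^sup>2"
    proof (rule AE_I2)
      fix x assume "x \<in> space M"
      from power_mono[OF assms(2)[OF this] abs_ge_zero, of 2] show "norm ((f x)\<^sup>2) \<le> B\<^sup>2"
        by simp
    qed
  qed (use assms in auto)
qed fact

lemma Cauchy_Schwarz_integral:
  assumes f: "square_integrable M f" and g: "square_integrable M g"
  shows "(\<integral>x. f x * g x \<partial>M)\<^sup>2 \<le> (\<integral>x. (f x)\<^sup>2 \<partial>M) * (\<integral>x. (g x)\<^sup>2 \<partial>M)"
proof (cases "(\<integral>x. (g x)\<^sup>2 \<partial>M) = 0")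
  case True
  then have "AE x in M. (g x)\<^sup>2 = 0"
    using integral_nonneg_eq_0_iff_AE[OF square_integrable_integrable[OF g]] by simp
  then have "AE x in M. f x * g x = 0" by eventually_elim auto
  then have "(\<integral>x. f x * g x \<partial>M) = (\<integral>x. 0 \<partial>M)"
    using f g by (intro integral_cong_AE) (auto simp: square_integrable_def)
  then show ?thesis using True by simp
next
  case False
  let ?G = "\<integral>x. (g x)\<^sup>2 \<partial>M" and ?P = "\<integral>x. f x * g x \<partial>M"
  have G: "?G > 0" using False by (simp add: less_le)
  \<comment> \<open>\<open>?P / ?G\<close> is the coefficient of the projection of \<open>f\<close>
    on \<open>g\<close>, which makes this nonnegative integral smallest.\<close>
  have "0 \<le> (\<integral>x. (f x - ?P / ?G * g x)\<^sup>2 \<partial>M)" by simp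
  also have "(\<lambda>x. (f x - ?P / ?G * g x)\<^sup>2) = (\<lambda>x. (f x)\<^sup>2 - 2 * (?P / ?G) * (f x * g x) + (?P / ?G)\<^sup>2 * (g x)\<^sup>2)"
    by (auto simp: power2_eq_square algebra_simps)
  also have "(\<integral>x. \<dots> x \<partial>M) = (\<integral>x. (f x)\<^sup>2 \<partial>M) - 2 * (?P / ?G) * ?P + (?P / ?G)\<^sup>2 * ?G"
    using f g square_integrable_mult[OF f g] by (simp add: square_integrable_def)
  also have "\<dots> = (\<integral>x. (f x)\<^sup>2 \<partial>M) - ?P\<^sup>2 / ?G"
    using G by (simp add: power2_eq_square field_simps)
  finally show ?thesis using G by (simp add: field_simps)
qed

lemma L2_dist_sq_eq:
  assumes "square_integrable M f" "square_integrable M g"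
  shows "L2_dist_sq M f g = ennreal (\<integral>x. (f x - g x)\<^sup>2 \<partial>M)"
  unfolding L2_dist_sq_def
  using square_integrable_diff[OF assms] by (intro nn_integral_eq_integral) (auto simp: square_integrable_def)

lemma L2_dist_sq_commute: "L2_dist_sq M f g = L2_dist_sq M g f"
  unfolding L2_dist_sq_def by (simp add: power2_commute)

text \<open>A squared distance obeys the triangle inequality only up to a factor 2. Almost all uses
  are limits to 0, where the factor is harmless.\<close>

lemma L2_dist_sq_triangle:
  assumes "f \<in> borel_measurable M" "g \<in> borel_measurable M" "h \<in> borel_measurable M"
  shows "L2_dist_sq M f h \<le> 2 * L2_dist_sq M f g + 2 * L2_dist_sq M g h"
proof -
  \<comment> \<open>The two sides differ by the square of a - 2b + c.\<close>
  have *: "(a - c)\<^sup>2 \<le> 2 * (a - b)\<^sup>2 + 2 * (b - c)\<^sup>2" for a b c :: real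
    using zero_le_power2[of "a - 2 * b + c"] by (simp add: power2_eq_square algebra_simps)
  have "L2_dist_sq M f h \<le> (\<integral>\<^sup>+x. 2 * ennreal ((f x - g x)\<^sup>2) + 2 * ennreal ((g x - h x)\<^sup>2) \<partial>M)"
    unfolding L2_dist_sq_def
  proof (rule nn_integral_mono)
    fix x
    have "ennreal ((f x - h x)\<^sup>2) \<le> ennreal (2 * (f x - g x)\<^sup>2 + 2 * (g x - h x)\<^sup>2)"
      by (rule ennreal_leI) (rule *)
    then show "ennreal ((f x - h x)\<^sup>2) \<le> 2 * ennreal ((f x - g x)\<^sup>2) + 2 * ennreal ((g x - h x)\<^sup>2)"
      by (simp add: ennreal_mult'')
  qed
  also have "\<dots> = 2 * L2_dist_sq M f g + 2 * L2_dist_sq M g h"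
    using assms unfolding L2_dist_sq_def by (simp add: nn_integral_add nn_integral_cmult)
  finally show ?thesis .
qed

lemma L2_dist_sq_add_le:
  assumes "f \<in> borel_measurable M" "g \<in> borel_measurable M" "f' \<in> borel_measurable M" "g' \<in> borel_measurable M"
  shows "L2_dist_sq M (\<lambda>x. f x + f' x) (\<lambda>x. g x + g' x) \<le> 2 * L2_dist_sq M f g + 2 * L2_dist_sq M f' g'"
proof -
  have "L2_dist_sq M (\<lambda>x. f x + f' x) (\<lambda>x. g x + g' x) \<le>
      2 * L2_dist_sq M (\<lambda>x. f x + f' x) (\<lambda>x. g x + f' x) + 2 * L2_dist_sq M (\<lambda>x. g x + f' x) (\<lambda>x. g x + g' x)"
    using assms by (intro L2_dist_sq_triangle) auto
  then show ?thesis by (simp add: L2_dist_sq_def)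
qed

lemma L2_dist_sq_scale:
  assumes "f \<in> borel_measurable M" "g \<in> borel_measurable M"
  shows "L2_dist_sq M (\<lambda>x. c * f x) (\<lambda>x. c * g x) = ennreal (c\<^sup>2) * L2_dist_sq M f g"
proof -
  have "(\<lambda>x. ennreal ((c * f x - c * g x)\<^sup>2)) = (\<lambda>x. ennreal (c\<^sup>2) * ennreal ((f x - g x)\<^sup>2))"
    by (simp flip: ennreal_mult add: right_diff_distrib[symmetric] power_mult_distrib)
  then show ?thesis
    unfolding L2_dist_sq_def using assms by (simp add: nn_integral_cmult)
qed

text \<open>Expansions and stochastic integrals are defined by \<open>L2_dist_sq\<close> tending to
  0, with only measurability demanded of the limit. Finiteness of the distance at a single index
  recovers its square integrability.\<close>

lemma square_integrable_of_L2_dist: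
  assumes "f \<in> borel_measurable M" "square_integrable M g" "L2_dist_sq M f g < \<top>"
  shows "square_integrable M f"
proof -
  have "square_integrable M (\<lambda>x. f x - g x)"
    unfolding square_integrable_def
  proof
    show "(\<lambda>x. f x - g x) \<in> borel_measurable M"
      using assms by (auto simp: square_integrable_def)
    then show "integrable M (\<lambda>x. (f x - g x)\<^sup>2)"
      using assms(3) by (intro integrableI_bounded) (auto simp: L2_dist_sq_def)
  qed
  from square_integrable_add[OF this assms(2)] show ?thesis by simp
qed

lemma ennreal_tendsto_0_squeeze:
  fixes f g :: "'a \<Rightarrow> ennreal"
  assumes "\<And>m. f m \<le> g m" "(g \<longlongrightarrow> 0) F"
  shows "(f \<longlongrightarrow> 0) F"
  by (rule tendsto_sandwich[OF _ _ tendsto_const assms(2)]) (auto simp: assms(1))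

lemma ennreal_tendsto_cmult_0:
  fixes f :: "'a \<Rightarrow> ennreal"
  assumes "(f \<longlongrightarrow> 0) F" "c < \<top>"
  shows "((\<lambda>m. c * f m) \<longlongrightarrow> 0) F"
  using tendsto_mult_ennreal[OF tendsto_const[of c] assms(1)] assms(2) by auto

text \<open>Cauchy-Schwarz applied to \<open>g - f m\<close> and \<open>h\<close>. It later
  identifies the coefficients of an expansion and the drift of a stochastic integral against white
  noise.\<close>

lemma L2_tendsto_integral_mult:
  assumes f: "\<And>m. square_integrable M (f m)" and g: "square_integrable M g" and h: "square_integrable M h"
    and lim: "(\<lambda>m. L2_dist_sq M g (f m)) \<longlonglongrightarrow> 0"
  shows "(\<lambda>m. \<integral>x. f m x * h x \<partial>M) \<longlonglongrightarrow> (\<integral>x. g x * h x \<partial>M)"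
proof -
  let ?d = "\<lambda>m. \<integral>x. (g x - f m x)\<^sup>2 \<partial>M" and ?H = "\<integral>x. (h x)\<^sup>2 \<partial>M"
  have "(\<lambda>m. ennreal (?d m)) \<longlonglongrightarrow> ennreal 0"
    using lim L2_dist_sq_eq[OF g f] by simp
  then have "?d \<longlonglongrightarrow> 0" by (subst (asm) tendsto_ennreal_iff) auto
  then have "(\<lambda>m. sqrt (?d m * ?H)) \<longlonglongrightarrow> sqrt (0 * ?H)"
    by (intro tendsto_intros)
  then have lim0: "(\<lambda>m. sqrt (?d m * ?H)) \<longlonglongrightarrow> 0" by simp
  have bound: "norm ((\<integral>x. f m x * h x \<partial>M) - (\<integral>x. g x * h x \<partial>M)) \<le> sqrt (?d m * ?H)" for m
  proof -
    have "(\<integral>x. g x * h x \<partial>M) - (\<integral>x. f m x * h x \<partial>M) = (\<integral>x. (g x - f m x) * h x \<partial>M)"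
      using square_integrable_mult[OF f h, of m] square_integrable_mult[OF g h]
      by (simp add: left_diff_distrib)
    then have "((\<integral>x. f m x * h x \<partial>M) - (\<integral>x. g x * h x \<partial>M))\<^sup>2 \<le> ?d m * ?H"
      using Cauchy_Schwarz_integral[OF square_integrable_diff[OF g f[of m]] h]
      by (simp add: power2_commute)
    then show ?thesis using real_sqrt_le_mono by fastforce
  qed
  have "(\<lambda>m. (\<integral>x. f m x * h x \<partial>M) - (\<integral>x. g x * h x \<partial>M)) \<longlonglongrightarrow> 0"
    by (rule Lim_null_comparison[OF always_eventually[OF allI[OF bound]] lim0])
  then show ?thesis by (rule LIM_zero_cancel)
qed

lemma L2_tendsto_integral_square:
  assumes f: "\<And>m. square_integrable M (f m)" and g: "square_integrable M g"
    and lim: "(\<lambda>m. L2_dist_sq M g (f m)) \<longlonglongrightarrow> 0"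
  shows "(\<lambda>m. \<integral>x. (f m x)\<^sup>2 \<partial>M) \<longlonglongrightarrow> (\<integral>x. (g x)\<^sup>2 \<partial>M)"
proof -
  have "(\<lambda>m. ennreal (\<integral>x. (g x - f m x)\<^sup>2 \<partial>M)) \<longlonglongrightarrow> ennreal 0"
    using lim L2_dist_sq_eq[OF g f] by simp
  then have 1: "(\<lambda>m. \<integral>x. (g x - f m x)\<^sup>2 \<partial>M) \<longlonglongrightarrow> 0" by (subst (asm) tendsto_ennreal_iff) auto
  have "(\<lambda>m. (\<integral>x. (g x - f m x)\<^sup>2 \<partial>M) + 2 * (\<integral>x. f m x * g x \<partial>M) - (\<integral>x. (g x)\<^sup>2 \<partial>M))
     \<longlonglongrightarrow> 0 + 2 * (\<integral>x. g x * g x \<partial>M) - (\<integral>x. (g x)\<^sup>2 \<partial>M)"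
    by (intro tendsto_intros 1 L2_tendsto_integral_mult[OF f g g lim])
  moreover have "(\<integral>x. (g x - f m x)\<^sup>2 \<partial>M) + 2 * (\<integral>x. f m x * g x \<partial>M) - (\<integral>x. (g x)\<^sup>2 \<partial>M)
    = (\<integral>x. (f m x)\<^sup>2 \<partial>M)" for m
  proof -
    have "(\<integral>x. (g x - f m x)\<^sup>2 \<partial>M) = (\<integral>x. (g x)\<^sup>2 + (f m x)\<^sup>2 - 2 * (f m x * g x) \<partial>M)"
      by (intro Bochner_Integration.integral_cong) (auto simp: power2_eq_square algebra_simps)
    also have "\<dots> = (\<integral>x. (g x)\<^sup>2 \<partial>M) + (\<integral>x. (f m x)\<^sup>2 \<partial>M) - 2 * (\<integral>x. f m x * g x \<partial>M)"
      using f[of m] g square_integrable_mult[OF f g, of m] by (simp add: square_integrable_def)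
    finally show ?thesis by simp
  qed
  ultimately show ?thesis by (simp add: power2_eq_square)
qed

subsection \<open>Step functions on the unit interval\<close>

lemma space_unit_measure [simp]: "space unit_measure = {0..1}"
  by (simp add: unit_measure_def space_restrict_space)

lemma prob_space_unit_measure: "prob_space unit_measure"
  unfolding unit_measure_def
  by (intro prob_spaceI) (simp add: space_restrict_space emeasure_restrict_space)

interpretation unit_measure: prob_space unit_measure
  by (rule prob_space_unit_measure)

lemma borel_measurable_unit_measure: "f \<in> borel_measurable borel \<Longrightarrow> f \<in> borel_measurable unit_measure"
  unfolding unit_measure_def by (intro measurable_restrict_space1) simp

lemma borel_measurable_unit_measure_continuous:
  "continuous_on {0..1} f \<Longrightarrow> f \<in> borel_measurable unit_measure"
  unfolding unit_measure_def
  by (subst measurable_cong_sets[OF sets_restrict_space_cong[OF sets_lborel] refl])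
    (rule borel_measurable_continuous_on_restrict)

lemma integral_unit_measure: "(\<integral>x. f x \<partial>unit_measure) = (\<integral>x. indicator {0..1} x * f x \<partial>lborel)" for f :: "real \<Rightarrow> real"
  unfolding unit_measure_def by (subst integral_restrict_space) auto

definition valid_step :: "step \<Rightarrow> bool" where
  "valid_step S \<longleftrightarrow> (\<forall>(c, u, v)\<in>set S. 0 \<le> u \<and> u \<le> v \<and> v \<le> 1)"

lemma valid_step_simps [simp]:
  "valid_step []" "valid_step ((c, u, v) # S) \<longleftrightarrow> 0 \<le> u \<and> u \<le> v \<and> v \<le> 1 \<and> valid_step S"
  "valid_step (S @ S') \<longleftrightarrow> valid_step S \<and> valid_step S'"
  unfolding valid_step_def by (simp_all add: ball_Un)

lemma step_fun_simps [simp]: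
  "step_fun [] x = 0" "step_fun ((c, u, v) # S) x = c * indicator {u<..v} x + step_fun S x"
  "step_fun (S @ S') x = step_fun S x + step_fun S' x"
  by (auto simp: step_fun_def)

lemma step_integral_simps [simp]:
  "step_integral Y [] \<omega> = 0"
  "step_integral Y ((c, u, v) # S) \<omega> = c * (Y v \<omega> - Y u \<omega>) + step_integral Y S \<omega>"
  "step_integral Y (S @ S') \<omega> = step_integral Y S \<omega> + step_integral Y S' \<omega>"
  by (auto simp: step_integral_def)

definition scale_step :: "real \<Rightarrow> step \<Rightarrow> step" where
  "scale_step a S = map (\<lambda>(c, u, v). (a * c, u, v)) S"

lemma scale_step_simps [simp]:
  "valid_step (scale_step a S) \<longleftrightarrow> valid_step S"
  "step_fun (scale_step a S) x = a * step_fun S x"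
  "step_integral Y (scale_step a S) \<omega> = a * step_integral Y S \<omega>"
  by (induction S) (auto simp: scale_step_def algebra_simps)

lemma square_integrable_step_fun: "square_integrable unit_measure (step_fun S)"
proof (induction S)
  case (Cons a S)
  obtain c u v where a: "a = (c, u, v)" by (cases a)
  have "square_integrable unit_measure (\<lambda>x. c * indicator {u<..v} x)"
    by (rule unit_measure.square_integrable_bounded[where B = "\<bar>c\<bar>"])
      (auto intro!: borel_measurable_unit_measure simp: indicator_def)
  from square_integrable_add[OF this Cons] show ?case by (simp add: a fun_eq_iff)
qed (simp add: square_integrable_zero fun_eq_iff)

lemmas step_fun_measurable = square_integrable_measurable[OF square_integrable_step_fun]

lemma continuous_on_unit_bounded:
  assumes "continuous_on {0..1} (g :: real \<Rightarrow> real)"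
  shows "square_integrable unit_measure g"
proof -
  have "compact (g ` {0..1})" using assms by (intro compact_continuous_image) auto
  then obtain B where "\<forall>y\<in>g ` {0..1}. norm y \<le> B"
    using compact_imp_bounded bounded_iff by blast
  then show ?thesis
    by (intro unit_measure.square_integrable_bounded[where B = B] borel_measurable_unit_measure_continuous assms) auto
qed

text \<open>Sampling at the left endpoints of a uniform grid. The cells are disjoint, so the
  increments in the step integral are independent and its characteristic function can be computed
  exactly.\<close>

definition grid_step :: "(real \<Rightarrow> real) \<Rightarrow> nat \<Rightarrow> step" where
  "grid_step g m = map (\<lambda>i. (g (real i / real (Suc m)), real i / real (Suc m), real (Suc i) / real (Suc m))) [0..<Suc m]"

lemma valid_grid_step: "valid_step (grid_step g m)"
  by (auto simp: valid_step_def grid_step_def divide_simps)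

lemma step_fun_grid_step:
  "step_fun (grid_step g m) x =
     (\<Sum>i<Suc m. g (real i / real (Suc m)) * indicator {real i / real (Suc m)<..real (Suc i) / real (Suc m)} x)"
  by (simp add: step_fun_def grid_step_def comp_def interv_sum_list_conv_sum_set_nat atLeast0LessThan
    del: upt_Suc sum.lessThan_Suc)

lemma step_integral_grid_step:
  "step_integral Y (grid_step g m) \<omega> =
     (\<Sum>i<Suc m. g (real i / real (Suc m)) * (Y (real (Suc i) / real (Suc m)) \<omega> - Y (real i / real (Suc m)) \<omega>))"
  by (simp add: step_integral_def grid_step_def comp_def interv_sum_list_conv_sum_set_nat atLeast0LessThan
    del: upt_Suc sum.lessThan_Suc)

lemma grid_step_eq:
  assumes "0 < x" "x \<le> 1"
  obtains i where "i < Suc m" "\<And>g. step_fun (grid_step g m) x = g (real i / real (Suc m))"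
    "\<bar>x - real i / real (Suc m)\<bar> \<le> 1 / real (Suc m)" "real i / real (Suc m) \<in> {0..1}"
proof -
  define R where "R = real (Suc m)"
  \<comment> \<open>Cells are open on the left, hence the ceiling minus one; the point 0 lies in no
    cell.\<close>
  define i where "i = nat (\<lceil>x * R\<rceil> - 1)"
  have R: "R > 0" by (simp add: R_def)
  have pos: "0 < x * R" "x * R \<le> R"
    using assms R mult_right_mono[of x 1 R] by auto
  have "real i = of_int \<lceil>x * R\<rceil> - 1"
    using pos(1) unfolding i_def by (simp add: of_nat_nat)
  then have c: "real i < x * R" "x * R \<le> real i + 1"
    by linarith+
  have i: "i < Suc m" using c(1) pos(2) unfolding R_def by linarith
  have "step_fun (grid_step g m) x = g (real i / R)" for g
  proof -
    have "step_fun (grid_step g m) x = (\<Sum>k<Suc m. if k = i then g (real k / R) else 0)"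
      unfolding step_fun_grid_step R_def[symmetric]
    proof (intro sum.cong refl)
      fix k
      have "x \<in> {real k / R<..real (Suc k) / R} \<longleftrightarrow> real k < x * R \<and> x * R \<le> real k + 1"
        using R by (auto simp: divide_less_eq le_divide_eq)
      also have "\<dots> \<longleftrightarrow> k = i" using c by linarith
      finally show "g (real k / R) * indicator {real k / R<..real (Suc k) / R} x =
         (if k = i then g (real k / R) else 0)" by (simp only: indicator_def) simp
    qed
    also have "\<dots> = g (real i / R)" using i by (subst sum.delta) auto
    finally show ?thesis .
  qed
  moreover have "real i / R < x" "x \<le> real i / R + 1 / R"
    using c R by (simp_all add: divide_less_eq add_divide_distrib[symmetric] le_divide_eq)
  then have "\<bar>x - real i / R\<bar> \<le> 1 / R" by linarith
  moreover have "real i / R \<in> {0..1}" using i R by (simp add: R_def divide_le_eq)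
  ultimately show ?thesis using i that unfolding R_def by blast
qed

lemma grid_step_tendsto:
  assumes g: "continuous_on {0..1} g"
  shows "(\<lambda>m. L2_dist_sq unit_measure g (step_fun (grid_step g m))) \<longlonglongrightarrow> 0"
proof (rule tendsto_zero_ennreal)
  fix r :: real assume "r > 0"
  \<comment> \<open>Halving \<open>r\<close> makes the final inequality strict.\<close>
  define e where "e = sqrt (r / 2)"
  have e: "e > 0" using \<open>r > 0\<close> by (simp add: e_def)
  have "uniformly_continuous_on {0..1} g"
    by (intro compact_uniformly_continuous g) auto
  then obtain \<delta> where \<delta>: "\<delta> > 0" "\<And>x y. x \<in> {0..1} \<Longrightarrow> y \<in> {0..1} \<Longrightarrow> dist x y < \<delta> \<Longrightarrow> dist (g x) (g y) < e"
    using e unfolding uniformly_continuous_on_def by metis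
  have "(\<lambda>m. 1 / real (Suc m)) \<longlonglongrightarrow> 0" using LIMSEQ_inverse_real_of_nat by (simp only: inverse_eq_divide)
  then have "\<forall>\<^sub>F m in sequentially. 1 / real (Suc m) < \<delta>" using \<delta>(1) by (rule order_tendstoD)
  then show "\<forall>\<^sub>F m in sequentially. L2_dist_sq unit_measure g (step_fun (grid_step g m)) < ennreal r"
  proof eventually_elim
    case (elim m)
    have AE0: "AE x in unit_measure. x \<noteq> 0"
      unfolding unit_measure_def by (subst AE_restrict_space_iff) (auto intro: AE_I[of _ _ "{0}"])
    have "L2_dist_sq unit_measure g (step_fun (grid_step g m)) \<le> (\<integral>\<^sup>+x. ennreal (r / 2) \<partial>unit_measure)"
      unfolding L2_dist_sq_def
    proof (rule nn_integral_mono_AE)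
      have "AE x in unit_measure. x \<in> {0..1}" by (rule AE_I2) simp
      with AE0 show "AE x in unit_measure. ennreal ((g x - step_fun (grid_step g m) x)\<^sup>2) \<le> ennreal (r / 2)"
      proof eventually_elim
        case (elim x)
        then have "0 < x" "x \<le> 1" by auto
        then obtain i where i: "step_fun (grid_step g m) x = g (real i / real (Suc m))"
          "\<bar>x - real i / real (Suc m)\<bar> \<le> 1 / real (Suc m)" "real i / real (Suc m) \<in> {0..1}"
          using grid_step_eq[of x m] by metis
        have "dist (g x) (g (real i / real (Suc m))) < e"
          using i(2,3) elim \<open>1 / real (Suc m) < \<delta>\<close> by (intro \<delta>(2)) (auto simp: dist_real_def)
        then have "\<bar>g x - step_fun (grid_step g m) x\<bar> \<le> e" using i(1) by (simp add: dist_real_def)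
        then have "(g x - step_fun (grid_step g m) x)\<^sup>2 \<le> e\<^sup>2"
          using power_mono[of "\<bar>g x - step_fun (grid_step g m) x\<bar>" e 2] by simp
        then show ?case using \<open>r > 0\<close> by (simp add: e_def)
      qed
    qed
    also have "\<dots> = ennreal (r / 2)" by (simp add: unit_measure.emeasure_space_1[simplified])
    also have "\<dots> < ennreal r" using \<open>r > 0\<close> by (simp add: ennreal_less_iff)
    finally show ?case .
  qed
qed

text \<open>Each point lies in at most one cell, so squaring commutes with sampling; at 0 both sides
  vanish.\<close>

lemma step_fun_grid_step_square:
  assumes "x \<in> {0..1}"
  shows "(step_fun (grid_step g m) x)\<^sup>2 = step_fun (grid_step (\<lambda>t. (g t)\<^sup>2) m) x"
proof (cases "x = 0")
  case True
  have "step_fun (grid_step h m) 0 = 0" for h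
    unfolding step_fun_grid_step
    by (intro sum.neutral ballI) (simp add: indicator_def not_less)
  then show ?thesis using True by simp
next
  case False
  then obtain i where "\<And>g. step_fun (grid_step g m) x = g (real i / real (Suc m))"
    using grid_step_eq[of x m] assms by (metis atLeastAtMost_iff order_le_less)
  then show ?thesis by simp
qed

lemma integral_indicator_unit_measure:
  assumes "0 \<le> u" "u \<le> v" "v \<le> 1"
  shows "(\<integral>x. indicator {u<..v} x \<partial>unit_measure) = v - u"
proof -
  have "(\<integral>x. indicator {u<..v} x \<partial>unit_measure) = (\<integral>x. indicator {u<..v} x \<partial>lborel :: real)"
    unfolding integral_unit_measure using assms
    by (intro Bochner_Integration.integral_cong refl) (auto simp: indicator_def)
  then show ?thesis using assms by simp
qed

text \<open>This Riemann sum is the variance of the step integral over the grid, the form in which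
  it appears when the characteristic functions of the increments are multiplied.\<close>

lemma integral_step_fun_grid_step_square:
  "(\<integral>x. (step_fun (grid_step g m) x)\<^sup>2 \<partial>unit_measure) =
     (\<Sum>i<Suc m. (g (real i / real (Suc m)))\<^sup>2 / real (Suc m))"
proof -
  have int: "integrable unit_measure (\<lambda>x. indicator {u<..v} x :: real)" for u v
    by (rule unit_measure.integrable_const_bound[where B = 1])
      (auto intro!: borel_measurable_unit_measure simp: indicator_def)
  have *: "(\<integral>x. indicator {real i / real (Suc m)<..real (Suc i) / real (Suc m)} x \<partial>unit_measure)
      = 1 / real (Suc m)" if "i < Suc m" for i
    using that by (subst integral_indicator_unit_measure) (auto simp: divide_right_mono diff_divide_distrib[symmetric])
  have "(\<integral>x. (step_fun (grid_step g m) x)\<^sup>2 \<partial>unit_measure) =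
      (\<integral>x. step_fun (grid_step (\<lambda>t. (g t)\<^sup>2) m) x \<partial>unit_measure)"
    by (intro Bochner_Integration.integral_cong refl step_fun_grid_step_square) simp
  also have "\<dots> = (\<Sum>i<Suc m. (g (real i / real (Suc m)))\<^sup>2 *
      (\<integral>x. indicator {real i / real (Suc m)<..real (Suc i) / real (Suc m)} x \<partial>unit_measure))"
    unfolding step_fun_grid_step
    by (subst Bochner_Integration.integral_sum) (auto intro!: integrable_mult_right int simp del: sum.lessThan_Suc of_nat_Suc)
  also have "\<dots> = (\<Sum>i<Suc m. (g (real i / real (Suc m)))\<^sup>2 / real (Suc m))"
    by (intro sum.cong refl) (simp only: * lessThan_iff, simp)
  finally show ?thesis .
qed

subsection \<open>The stochastic integral\<close>

text \<open>Polarisation: the product of two increments is a combination of four squared increments,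
  so its integral is fixed by the variances alone. Brownian motion and the indicators of (0,t] in
  L^2 thus share one computation.\<close>

lemma increment_mult:
  fixes X :: "real \<Rightarrow> 'a \<Rightarrow> real"
  assumes X: "\<And>r t. r \<in> {0..1} \<Longrightarrow> t \<in> {0..1} \<Longrightarrow> square_integrable N (\<lambda>x. X t x - X r x)"
    and var: "\<And>r t. r \<in> {0..1} \<Longrightarrow> t \<in> {0..1} \<Longrightarrow> (\<integral>x. (X t x - X r x)\<^sup>2 \<partial>N) = \<bar>t - r\<bar>"
    and I: "u \<in> {0..1}" "v \<in> {0..1}" "u' \<in> {0..1}" "v' \<in> {0..1}"
  shows "(\<integral>x. (X v x - X u x) * (X v' x - X u' x) \<partial>N) = (\<bar>v - u'\<bar> + \<bar>u - v'\<bar> - \<bar>v - v'\<bar> - \<bar>u - u'\<bar>) / 2"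
proof -
  have "(\<integral>x. (X v x - X u x) * (X v' x - X u' x) \<partial>N) =
    (\<integral>x. ((X v x - X u' x)\<^sup>2 + (X u x - X v' x)\<^sup>2 - (X v x - X v' x)\<^sup>2 - (X u x - X u' x)\<^sup>2) / 2 \<partial>N)"
    by (intro Bochner_Integration.integral_cong refl) (simp add: power2_eq_square field_simps)
  also have "\<dots> = (\<bar>v - u'\<bar> + \<bar>u - v'\<bar> - \<bar>v - v'\<bar> - \<bar>u - u'\<bar>) / 2"
    using I by (simp add: square_integrable_integrable[OF X] var)
  finally show ?thesis .
qed

lemma square_integrable_step_integral:
  assumes X: "\<And>r t. r \<in> {0..1} \<Longrightarrow> t \<in> {0..1} \<Longrightarrow> square_integrable N (\<lambda>x. X t x - X r x)"
    and "valid_step S"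
  shows "square_integrable N (step_integral X S)"
  using assms(2)
proof (induction S)
  case (Cons a S)
  obtain c u v where a: "a = (c, u, v)" by (cases a)
  have "square_integrable N (\<lambda>x. c * (X v x - X u x))"
    using Cons by (intro square_integrable_scale X) (auto simp: a)
  from square_integrable_add[OF this Cons.IH] Cons show ?case by (simp add: a fun_eq_iff)
qed (simp add: square_integrable_zero step_integral_def[abs_def])

text \<open>The right-hand side mentions neither \<open>N\<close> nor \<open>X\<close>. Comparing
  two instances of this lemma is how the isometry is obtained.\<close>

lemma step_integral_mult:
  assumes X: "\<And>r t. r \<in> {0..1} \<Longrightarrow> t \<in> {0..1} \<Longrightarrow> square_integrable N (\<lambda>x. X t x - X r x)"
    and var: "\<And>r t. r \<in> {0..1} \<Longrightarrow> t \<in> {0..1} \<Longrightarrow> (\<integral>x. (X t x - X r x)\<^sup>2 \<partial>N) = \<bar>t - r\<bar>"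
    and S: "valid_step S" "valid_step S'"
  shows "(\<integral>x. step_integral X S x * step_integral X S' x \<partial>N) =
    (\<Sum>(c, u, v)\<leftarrow>S. \<Sum>(c', u', v')\<leftarrow>S'. c * c' * ((\<bar>v - u'\<bar> + \<bar>u - v'\<bar> - \<bar>v - v'\<bar> - \<bar>u - u'\<bar>) / 2))"
  using S(1)
proof (induction S)
  case (Cons a S)
  obtain c u v where a: "a = (c, u, v)" by (cases a)
  have uv: "u \<in> {0..1}" "v \<in> {0..1}" using Cons by (auto simp: a)
  have *: "(\<integral>x. (X v x - X u x) * step_integral X S' x \<partial>N) =
     (\<Sum>(c', u', v')\<leftarrow>S'. c' * ((\<bar>v - u'\<bar> + \<bar>u - v'\<bar> - \<bar>v - v'\<bar> - \<bar>u - u'\<bar>) / 2))"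
    using S(2)
  proof (induction S')
    case (Cons a' S')
    obtain c' u' v' where a': "a' = (c', u', v')" by (cases a')
    have uv': "u' \<in> {0..1}" "v' \<in> {0..1}" "valid_step S'" using Cons by (auto simp: a')
    have "(\<integral>x. (X v x - X u x) * step_integral X (a' # S') x \<partial>N) =
      (\<integral>x. c' * ((X v x - X u x) * (X v' x - X u' x)) + (X v x - X u x) * step_integral X S' x \<partial>N)"
      by (intro Bochner_Integration.integral_cong refl) (simp add: a' algebra_simps)
    also have "\<dots> = c' * (\<integral>x. (X v x - X u x) * (X v' x - X u' x) \<partial>N) + (\<integral>x. (X v x - X u x) * step_integral X S' x \<partial>N)"
      using uv uv' by (subst Bochner_Integration.integral_add)
        (auto intro!: integrable_mult_right square_integrable_mult X square_integrable_step_integral[OF X])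
    finally show ?case using Cons.IH[OF uv'(3)] increment_mult[OF X var uv uv'(1,2)] by (simp add: a')
  qed simp
  have "(\<integral>x. step_integral X (a # S) x * step_integral X S' x \<partial>N) =
      (\<integral>x. c * ((X v x - X u x) * step_integral X S' x) + step_integral X S x * step_integral X S' x \<partial>N)"
    by (intro Bochner_Integration.integral_cong refl) (simp add: a algebra_simps)
  also have "\<dots> = c * (\<integral>x. (X v x - X u x) * step_integral X S' x \<partial>N) + (\<integral>x. step_integral X S x * step_integral X S' x \<partial>N)"
    using uv Cons.prems S(2) by (subst Bochner_Integration.integral_add)
      (auto intro!: integrable_mult_right square_integrable_mult X square_integrable_step_integral[OF X] simp: a)
  also have "\<dots> = (\<Sum>(c', u', v')\<leftarrow>S'. c * c' * ((\<bar>v - u'\<bar> + \<bar>u - v'\<bar> - \<bar>v - v'\<bar> - \<bar>u - u'\<bar>) / 2)) + (\<integral>x. step_integral X S x * step_integral X S' x \<partial>N)"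
    unfolding * by (simp only: sum_list_const_mult[symmetric] case_prod_unfold mult.assoc)
  finally show ?case using Cons by (simp add: a)
qed simp

text \<open>The indicator of (0,t], as a process in \<open>t\<close>, has increments of squared norm
  |t - r|, like Brownian motion. Written this way, step functions fall under
  \<open>step_integral_mult\<close>.\<close>

lemma step_fun_as_step_integral:
  assumes "valid_step S"
  shows "step_fun S x = step_integral (\<lambda>t. indicator {0<..t}) S x"
  using assms
proof (induction S)
  case (Cons a S)
  then show ?case by (cases a) (auto simp: indicator_def)
qed simp

lemma integral_indicator_increment:
  assumes "r \<in> {0..1}" "t \<in> {0..1}"
  shows "(\<integral>x. (indicator {0<..t} x - indicator {0<..r} x)\<^sup>2 \<partial>unit_measure) = \<bar>t - r\<bar>"
proof -
  have "(\<integral>x. (indicator {0<..t} x - indicator {0<..r} x)\<^sup>2 \<partial>unit_measure) =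
     (\<integral>x. indicator {min r t<..max r t} x \<partial>unit_measure :: real)"
    using assms by (intro Bochner_Integration.integral_cong refl) (auto simp: indicator_def)
  also have "\<dots> = \<bar>t - r\<bar>" using assms by (subst integral_indicator_unit_measure) auto
  finally show ?thesis .
qed

lemma square_integrable_indicator_increment:
  "square_integrable unit_measure (\<lambda>x. indicator {0<..t} x - indicator {0<..r} x)"
  by (rule unit_measure.square_integrable_bounded[where B = 1])
    (auto intro!: borel_measurable_unit_measure simp: indicator_def)

lemma has_stoch_integral_iff:
  "has_stoch_integral M Y g X \<longleftrightarrow> X \<in> borel_measurable M \<and>
     (\<exists>S :: nat \<Rightarrow> step. (\<forall>m. valid_step (S m)) \<and>
        (\<lambda>m. L2_dist_sq unit_measure g (step_fun (S m))) \<longlonglongrightarrow> 0 \<and>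
        (\<lambda>m. L2_dist_sq M X (step_integral Y (S m))) \<longlonglongrightarrow> 0)"
  unfolding has_stoch_integral_def valid_step_def by blast

text \<open>Riesz-Fischer for a fast Cauchy sequence: the geometric rate makes the expected absolute
  differences summable, hence the sequence converges almost surely, and Fatou's lemma passes the
  Cauchy bound to the limit.\<close>

lemma (in prob_space) L2_complete:
  assumes F: "\<And>i. square_integrable M (F i)"
    and cauchy: "\<And>i k. i \<le> k \<Longrightarrow> L2_dist_sq M (F k) (F i) \<le> ennreal (4 * (1/8) ^ i)"
  shows "\<exists>X\<in>borel_measurable M. (\<lambda>i. L2_dist_sq M X (F i)) \<longlonglongrightarrow> 0"
proof -
  have [measurable]: "F i \<in> borel_measurable M" for i using F by (rule square_integrable_measurable)
  define X where "X = (\<lambda>\<omega>. lim (\<lambda>i. F i \<omega>))"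
  have [measurable]: "X \<in> borel_measurable M" unfolding X_def by measurable
  have bound: "(\<integral>\<^sup>+\<omega>. ennreal \<bar>F (Suc i) \<omega> - F i \<omega>\<bar> \<partial>M) \<le> ennreal (5 * (1/2) ^ i)" for i
  proof -
    have "(\<integral>\<^sup>+\<omega>. ennreal \<bar>F (Suc i) \<omega> - F i \<omega>\<bar> \<partial>M) \<le>
        (\<integral>\<^sup>+\<omega>. ennreal ((1/2) ^ i) + ennreal (2 ^ i) * ennreal ((F (Suc i) \<omega> - F i \<omega>)\<^sup>2) \<partial>M)"
    proof (rule nn_integral_mono)
      fix \<omega>
      \<comment> \<open>A weighted AM-GM inequality. Its weight 2^i turns the rate 8^(-i) for
        squares into a rate 2^(-i) for absolute values.\<close>
      have "\<bar>x\<bar> \<le> (1/2) ^ i + 2 ^ i * x\<^sup>2" for x :: real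
      proof -
        have "0 \<le> ((2::real) ^ i * \<bar>x\<bar> - 1)\<^sup>2" by simp
        also have "\<dots> = 2 ^ i * (2 ^ i * x\<^sup>2 - 2 * \<bar>x\<bar> + (1/2) ^ i)"
          by (simp add: power2_eq_square algebra_simps power_divide)
        finally have "0 \<le> 2 ^ i * x\<^sup>2 - 2 * \<bar>x\<bar> + (1/2) ^ i"
          using zero_less_power[of "2::real" i] by (metis not_le zero_le_mult_iff zero_less_numeral)
        then show ?thesis using abs_ge_zero[of x] by linarith
      qed
      then show "ennreal \<bar>F (Suc i) \<omega> - F i \<omega>\<bar> \<le> ennreal ((1/2) ^ i) + ennreal (2 ^ i) * ennreal ((F (Suc i) \<omega> - F i \<omega>)\<^sup>2)"
        by (simp flip: ennreal_mult ennreal_plus)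
    qed
    also have "\<dots> = ennreal ((1/2) ^ i) + ennreal (2 ^ i) * L2_dist_sq M (F (Suc i)) (F i)"
      by (simp add: L2_dist_sq_def nn_integral_add nn_integral_cmult emeasure_space_1)
    also have "\<dots> \<le> ennreal ((1/2) ^ i) + ennreal (2 ^ i) * ennreal (4 * (1/8) ^ i)"
      by (intro add_left_mono mult_left_mono cauchy) auto
    also have "\<dots> = ennreal ((1/2) ^ i + 4 * (1/4) ^ i)"
      by (simp flip: ennreal_mult ennreal_plus power_mult_distrib)
    also have "\<dots> \<le> ennreal (5 * (1/2) ^ i)"
      using power_mono[of "1/4::real" "1/2" i] by (intro ennreal_leI) simp
    finally show ?thesis .
  qed
  have "(\<integral>\<^sup>+\<omega>. (\<Sum>i. ennreal \<bar>F (Suc i) \<omega> - F i \<omega>\<bar>) \<partial>M) = (\<Sum>i. \<integral>\<^sup>+\<omega>. ennreal \<bar>F (Suc i) \<omega> - F i \<omega>\<bar> \<partial>M)"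
    by (rule nn_integral_suminf) measurable
  also have "\<dots> \<le> (\<Sum>i. ennreal (5 * (1/2) ^ i))"
    by (intro suminf_le bound) auto
  also have "\<dots> = ennreal (\<Sum>i. 5 * (1/2) ^ i)"
    by (intro suminf_ennreal2) (auto intro!: summable_mult summable_geometric)
  also have "\<dots> < \<infinity>" by simp
  finally have "AE \<omega> in M. (\<Sum>i. ennreal \<bar>F (Suc i) \<omega> - F i \<omega>\<bar>) \<noteq> \<infinity>"
    by (intro nn_integral_PInf_AE) auto
  then have conv: "AE \<omega> in M. (\<lambda>i. F i \<omega>) \<longlonglongrightarrow> X \<omega>"
  proof eventually_elim
    case (elim \<omega>)
    then have "summable (\<lambda>i. \<bar>F (Suc i) \<omega> - F i \<omega>\<bar>)"
      by (intro summable_suminf_not_top) (auto simp: top_ennreal_def[symmetric])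
    then have "summable (\<lambda>i. F (Suc i) \<omega> - F i \<omega>)" by (rule summable_rabs_cancel)
    then have "convergent (\<lambda>n. \<Sum>i<n. F (Suc i) \<omega> - F i \<omega>)" by (simp add: summable_iff_convergent)
    moreover have "(\<lambda>n. \<Sum>i<n. F (Suc i) \<omega> - F i \<omega>) = (\<lambda>n. F n \<omega> - F 0 \<omega>)"
      by (rule ext, rule sum_lessThan_telescope)
    ultimately have "convergent (\<lambda>n. F n \<omega> - F 0 \<omega>)" by simp
    from convergent_add[OF this convergent_const[of "F 0 \<omega>"]] show ?case
      by (simp add: X_def convergent_LIMSEQ_iff)
  qed
  have "L2_dist_sq M X (F i) \<le> ennreal (4 * (1/8) ^ i)" for i
  proof -
    have "L2_dist_sq M X (F i) = (\<integral>\<^sup>+\<omega>. liminf (\<lambda>k. ennreal ((F k \<omega> - F i \<omega>)\<^sup>2)) \<partial>M)"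
      unfolding L2_dist_sq_def
    proof (rule nn_integral_cong_AE)
      from conv show "AE \<omega> in M. ennreal ((X \<omega> - F i \<omega>)\<^sup>2) = liminf (\<lambda>k. ennreal ((F k \<omega> - F i \<omega>)\<^sup>2))"
      proof eventually_elim
        case (elim \<omega>)
        have "(\<lambda>k. ennreal ((F k \<omega> - F i \<omega>)\<^sup>2)) \<longlonglongrightarrow> ennreal ((X \<omega> - F i \<omega>)\<^sup>2)"
          by (intro tendsto_ennrealI tendsto_intros elim)
        from lim_imp_Liminf[OF _ this] show ?case by simp
      qed
    qed
    also have "\<dots> \<le> liminf (\<lambda>k. \<integral>\<^sup>+\<omega>. ennreal ((F k \<omega> - F i \<omega>)\<^sup>2) \<partial>M)"
      by (intro nn_integral_liminf) measurable
    also have "\<dots> \<le> liminf (\<lambda>k. ennreal (4 * (1/8) ^ i))"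
      by (intro Liminf_mono eventually_sequentiallyI[of i]) (use cauchy in \<open>auto simp: L2_dist_sq_def\<close>)
    also have "\<dots> = ennreal (4 * (1/8) ^ i)" by (simp add: Liminf_const)
    finally show ?thesis .
  qed
  note le = this
  have "(\<lambda>i. 4 * (1/8) ^ i :: real) \<longlonglongrightarrow> 4 * 0"
    by (intro tendsto_mult tendsto_const LIMSEQ_realpow_zero) auto
  then have "(\<lambda>i. ennreal (4 * (1/8) ^ i)) \<longlonglongrightarrow> 0"
    by (intro tendsto_ennrealI[where x = 0, simplified]) simp
  with le have "(\<lambda>i. L2_dist_sq M X (F i)) \<longlonglongrightarrow> 0"
    by (rule ennreal_tendsto_0_squeeze)
  then show ?thesis by (intro bexI[of _ X]) auto
qed

section \<open>Isometry and existence of the integral of a continuous function\<close>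

context brownian_motion
begin

lemma increment_normal:
  assumes "0 \<le> r" "r < t" "t \<le> 1"
  shows "distr M borel (\<lambda>\<omega>. (W t \<omega> - W r \<omega>) / sqrt (t - r)) = std_normal_distribution"
proof -
  have "distributed M lborel (\<lambda>\<omega>. (W t \<omega> - W r \<omega> - 0) / sqrt (t - r)) std_normal_density"
    using gaussian_increments[OF assms] assms by (subst normal_standard_normal_convert[symmetric]) auto
  then have "distr M lborel (\<lambda>\<omega>. (W t \<omega> - W r \<omega>) / sqrt (t - r)) = std_normal_distribution"
    by (simp add: distributed_def)
  then show ?thesis by (simp cong: distr_cong)
qed

lemma increment_moments:
  assumes "r \<in> {0..1}" "t \<in> {0..1}"
  shows "square_integrable M (\<lambda>\<omega>. W t \<omega> - W r \<omega>)" (is ?A)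
    and "(\<integral>\<omega>. (W t \<omega> - W r \<omega>)\<^sup>2 \<partial>M) = \<bar>t - r\<bar>" (is ?B)
proof -
  have [measurable]: "W t \<in> borel_measurable M" "W r \<in> borel_measurable M"
    using assms by (auto intro: random_variable)
  have *: "integrable M (\<lambda>\<omega>. (W b \<omega> - W a \<omega>)\<^sup>2) \<and> (\<integral>\<omega>. (W b \<omega> - W a \<omega>)\<^sup>2 \<partial>M) = b - a"
    if "0 \<le> a" "a < b" "b \<le> 1" for a b
  proof -
    have D: "distributed M lborel (\<lambda>\<omega>. W b \<omega> - W a \<omega>) (normal_density 0 (sqrt (b - a)))"
      using gaussian_increments that by blast
    have m: "has_bochner_integral lborel (\<lambda>x. normal_density 0 (sqrt (b - a)) x * x\<^sup>2) (b - a)"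
      using normal_moment_even[of "sqrt (b - a)" 0 1] that
      by (simp add: fact_numeral diff_divide_distrib)
    show ?thesis
      using distributed_integrable[OF D, of "\<lambda>x. x\<^sup>2"] distributed_integral[OF D, of "\<lambda>x. x\<^sup>2"] m
      by (auto simp: has_bochner_integral_iff)
  qed
  have "integrable M (\<lambda>\<omega>. (W t \<omega> - W r \<omega>)\<^sup>2) \<and> ?B"
    using *[of r t] *[of t r] assms
    by (cases r t rule: linorder_cases) (auto simp: power2_commute[of "W t _"])
  then show ?A ?B by (auto simp: square_integrable_def)
qed

text \<open>Both sides are the same double sum of \<open>step_integral_mult\<close>, once for
  \<open>W\<close> and once for the indicators of (0,t].\<close>

lemma step_integral_isometry:
  assumes "valid_step S" "valid_step S'"
  shows "(\<integral>\<omega>. step_integral W S \<omega> * step_integral W S' \<omega> \<partial>M) = (\<integral>x. step_fun S x * step_fun S' x \<partial>unit_measure)"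
proof -
  have "(\<integral>x. step_fun S x * step_fun S' x \<partial>unit_measure) =
     (\<integral>x. step_integral (\<lambda>t. indicator {0<..t}) S x * step_integral (\<lambda>t. indicator {0<..t}) S' x \<partial>unit_measure)"
    by (simp add: step_fun_as_step_integral assms)
  then show ?thesis
    using step_integral_mult[of M W S S', OF increment_moments assms]
      step_integral_mult[of unit_measure "\<lambda>t. indicator {0<..t}" S S', OF square_integrable_indicator_increment integral_indicator_increment assms]
    by simp
qed

lemma square_integrable_W: "valid_step S \<Longrightarrow> square_integrable M (step_integral W S)"
  by (rule square_integrable_step_integral) (rule increment_moments)

lemma L2_dist_sq_step_integral:
  assumes "valid_step S" "valid_step S'"
  shows "L2_dist_sq M (step_integral W S) (step_integral W S') = L2_dist_sq unit_measure (step_fun S) (step_fun S')"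
proof -
  \<comment> \<open>The difference of two step integrals is the step integral of a single list, so
    the isometry applied to \<open>?D\<close> twice gives the distance.\<close>
  let ?D = "S @ scale_step (-1) S'"
  have "L2_dist_sq M (step_integral W S) (step_integral W S') = ennreal (\<integral>\<omega>. step_integral W ?D \<omega> * step_integral W ?D \<omega> \<partial>M)"
    using assms by (simp add: L2_dist_sq_eq square_integrable_W power2_eq_square)
  also have "\<dots> = ennreal (\<integral>x. step_fun ?D x * step_fun ?D x \<partial>unit_measure)"
    using assms by (subst step_integral_isometry) auto
  also have "\<dots> = L2_dist_sq unit_measure (step_fun S) (step_fun S')"
    by (simp add: L2_dist_sq_eq square_integrable_step_fun power2_eq_square)
  finally show ?thesis .
qed

text \<open>The definition supplies some approximating sequence; by the isometry any other one
  converges to the same limit. So every version of the integral may be approached along grids, where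
  characteristic functions are explicit.\<close>

lemma has_stoch_integral_tendsto:
  assumes X: "has_stoch_integral M W g X" and g: "g \<in> borel_measurable unit_measure"
    and S: "\<And>m. valid_step (S m)" "(\<lambda>m. L2_dist_sq unit_measure g (step_fun (S m))) \<longlonglongrightarrow> 0"
  shows "(\<lambda>m. L2_dist_sq M X (step_integral W (S m))) \<longlonglongrightarrow> 0"
proof -
  obtain T where T: "\<And>m. valid_step (T m)" "(\<lambda>m. L2_dist_sq unit_measure g (step_fun (T m))) \<longlonglongrightarrow> 0"
    "(\<lambda>m. L2_dist_sq M X (step_integral W (T m))) \<longlonglongrightarrow> 0" and [measurable]: "X \<in> borel_measurable M"
    using X unfolding has_stoch_integral_iff by blast
  show ?thesis
  proof (rule ennreal_tendsto_0_squeeze)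
    fix m
    have "L2_dist_sq M X (step_integral W (S m)) \<le>
        2 * L2_dist_sq M X (step_integral W (T m)) + 2 * L2_dist_sq M (step_integral W (T m)) (step_integral W (S m))"
      by (intro L2_dist_sq_triangle square_integrable_measurable[OF square_integrable_W] S T) auto
    also have "L2_dist_sq M (step_integral W (T m)) (step_integral W (S m)) \<le>
        2 * L2_dist_sq unit_measure (step_fun (T m)) g + 2 * L2_dist_sq unit_measure g (step_fun (S m))"
      unfolding L2_dist_sq_step_integral[OF T(1) S(1)]
      by (intro L2_dist_sq_triangle step_fun_measurable g)
    finally show "L2_dist_sq M X (step_integral W (S m)) \<le> 2 * L2_dist_sq M X (step_integral W (T m))
      + 2 * (2 * L2_dist_sq unit_measure g (step_fun (T m)) + 2 * L2_dist_sq unit_measure g (step_fun (S m)))"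
      by (simp add: L2_dist_sq_commute[of _ _ g] mult_left_mono add_left_mono)
  next
    have "(\<lambda>m. 2 * L2_dist_sq M X (step_integral W (T m))
      + 2 * (2 * L2_dist_sq unit_measure g (step_fun (T m)) + 2 * L2_dist_sq unit_measure g (step_fun (S m)))) \<longlonglongrightarrow> 0 + (0 + 0)"
      unfolding distrib_left mult.assoc[symmetric]
      by (intro tendsto_add ennreal_tendsto_cmult_0 S T) (auto simp: ennreal_mult_less_top)
    then show "(\<lambda>m. 2 * L2_dist_sq M X (step_integral W (T m))
      + 2 * (2 * L2_dist_sq unit_measure g (step_fun (T m)) + 2 * L2_dist_sq unit_measure g (step_fun (S m)))) \<longlonglongrightarrow> 0" by simp
  qed
qed

text \<open>\<open>stoch_integral\<close> is a choice, about which nothing is known until a witness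
  exists.\<close>

lemma has_stoch_integral_exists:
  assumes g: "continuous_on {0..1} g"
  shows "\<exists>X. has_stoch_integral M W g X"
proof -
  let ?d = "\<lambda>m. L2_dist_sq unit_measure g (step_fun (grid_step g m))"
  have gm: "g \<in> borel_measurable unit_measure"
    using g by (rule borel_measurable_unit_measure_continuous)
  \<comment> \<open>Grids fine enough for the rate that \<open>L2_complete\<close> asks for; the
    factor 4 there is the 2 + 2 of \<open>L2_dist_sq_triangle\<close>.\<close>
  have "\<exists>m. ?d m < ennreal ((1/8) ^ i)" for i
  proof -
    have "\<forall>\<^sub>F m in sequentially. ?d m < ennreal ((1/8) ^ i)"
      by (rule order_tendstoD(2)[OF grid_step_tendsto[OF g]]) simp
    then show ?thesis by (rule eventually_happens'[OF sequentially_bot])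
  qed
  then obtain m where m: "\<And>i. ?d (m i) < ennreal ((1/8) ^ i)" by metis
  define S where "S = (\<lambda>i. grid_step g (m i))"
  have valid: "valid_step (S i)" for i by (simp add: S_def valid_grid_step)
  have d: "L2_dist_sq unit_measure g (step_fun (S i)) \<le> ennreal ((1/8) ^ i)" for i
    using m[of i] by (simp add: S_def)
  have "L2_dist_sq M (step_integral W (S k)) (step_integral W (S i)) \<le> ennreal (4 * (1/8) ^ i)" if "i \<le> k" for i k
  proof -
    have "L2_dist_sq M (step_integral W (S k)) (step_integral W (S i)) \<le>
        2 * L2_dist_sq unit_measure (step_fun (S k)) g + 2 * L2_dist_sq unit_measure g (step_fun (S i))"
      unfolding L2_dist_sq_step_integral[OF valid valid]
      by (intro L2_dist_sq_triangle step_fun_measurable gm)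
    also have "\<dots> \<le> 2 * ennreal ((1/8) ^ i) + 2 * ennreal ((1/8) ^ i)"
      using d[of k] d[of i] power_decreasing[OF that, of "1/8::real"]
      by (intro add_mono mult_left_mono) (auto simp: L2_dist_sq_commute[of _ _ g] intro: order_trans)
    also have "\<dots> = ennreal (4 * (1/8) ^ i)"
      by (simp add: ennreal_mult'' flip: distrib_right)
    finally show ?thesis .
  qed
  from L2_complete[OF square_integrable_W[OF valid] this] obtain X where
    "X \<in> borel_measurable M" "(\<lambda>i. L2_dist_sq M X (step_integral W (S i))) \<longlonglongrightarrow> 0" by blast
  moreover have "(\<lambda>i. L2_dist_sq unit_measure g (step_fun (S i))) \<longlonglongrightarrow> 0"
  proof (rule ennreal_tendsto_0_squeeze[OF d])
    have "(\<lambda>i. ennreal ((1/8) ^ i)) \<longlonglongrightarrow> ennreal 0"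
      by (rule tendsto_ennrealI, rule LIMSEQ_realpow_zero) auto
    then show "(\<lambda>i. ennreal ((1/8) ^ i)) \<longlonglongrightarrow> 0" by simp
  qed
  ultimately show ?thesis using valid unfolding has_stoch_integral_iff by blast
qed

end

subsection \<open>Independence from the joint characteristic function\<close>

lemma iexp_eq_cos_sin: "iexp x = complex_of_real (cos x) + \<i> * complex_of_real (sin x)"
  by (simp add: cis_conv_exp[symmetric] complex_eq_iff)

context prob_space
begin

lemma integrable_mult_iexp:
  assumes "integrable M (V :: 'a \<Rightarrow> real)" "U \<in> borel_measurable M"
  shows "integrable M (\<lambda>\<omega>. complex_of_real (V \<omega>) * iexp (U \<omega>))"
  by (rule Bochner_Integration.integrable_bound[OF assms(1)]) (use assms in \<open>auto simp: norm_mult\<close>)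

text \<open>Under the probability measure with density \<open>w / E w\<close>, the variable \<open>X\<close> has its original
  characteristic function, hence its original law.\<close>

lemma expectation_indicator_of_char:
  assumes w: "integrable M (w :: 'a \<Rightarrow> real)" "\<And>\<omega>. \<omega> \<in> space M \<Longrightarrow> 0 \<le> w \<omega>"
    and X: "X \<in> borel_measurable M"
    and char: "\<And>t. (CLINT \<omega>|M. complex_of_real (w \<omega>) * iexp (t * X \<omega>)) =
      (CLINT \<omega>|M. iexp (t * X \<omega>)) * complex_of_real (\<integral>\<omega>. w \<omega> \<partial>M)"
    and A: "A \<in> sets borel"
  shows "(\<integral>\<omega>. w \<omega> * indicator A (X \<omega>) \<partial>M) = prob (X -` A \<inter> space M) * (\<integral>\<omega>. w \<omega> \<partial>M)"
proof (cases "(\<integral>\<omega>. w \<omega> \<partial>M) = 0")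
  case True
  have [measurable]: "w \<in> borel_measurable M" using w by auto
  note [measurable] = X A
  have "AE \<omega> in M. w \<omega> = 0"
    using integral_nonneg_eq_0_iff_AE[OF w(1)] w(2) True by auto
  then have "AE \<omega> in M. w \<omega> * indicator A (X \<omega>) = 0" by eventually_elim auto
  then have "(\<integral>\<omega>. w \<omega> * indicator A (X \<omega>) \<partial>M) = (\<integral>\<omega>. 0 \<partial>M)"
    by (intro integral_cong_AE) auto
  then show ?thesis using True by simp
next
  case False
  have [measurable]: "w \<in> borel_measurable M" using w by auto
  note [measurable] = X A
  define c where "c = (\<integral>\<omega>. w \<omega> \<partial>M)"
  have c: "c > 0" using False w(2) by (simp add: c_def less_le integral_nonneg_AE)
  define N where "N = density M (\<lambda>\<omega>. ennreal (w \<omega> / c))"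
  have int: "integrable M (\<lambda>\<omega>. w \<omega> / c)" using w by simp
  have nonneg: "AE \<omega> in M. 0 \<le> w \<omega> / c" using w c by (intro AE_I2) auto
  have [simp]: "sets N = sets M" "space N = space M" by (auto simp: N_def)
  have "emeasure N (space M) = (\<integral>\<^sup>+\<omega>. ennreal (w \<omega> / c) \<partial>M)"
    unfolding N_def by (subst emeasure_density) (auto intro!: nn_integral_cong)
  also have "\<dots> = ennreal (\<integral>\<omega>. w \<omega> / c \<partial>M)"
    by (rule nn_integral_eq_integral[OF int nonneg])
  also have "\<dots> = 1" using c by (simp add: c_def[symmetric])
  finally interpret N: prob_space N by (intro prob_spaceI) simp
  have XN: "X \<in> borel_measurable N" using X by (simp cong: measurable_cong_sets)
  have "distr N borel X = distr M borel X"
  proof (rule Levy_uniqueness)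
    show "char (distr N borel X) = char (distr M borel X)"
    proof
      fix t
      have "char (distr N borel X) t = (CLINT \<omega>|N. iexp (t * X \<omega>))"
        unfolding char_def using XN by (subst integral_distr) auto
      also have "\<dots> = (CLINT \<omega>|M. (w \<omega> / c) *\<^sub>R iexp (t * X \<omega>))"
        unfolding N_def by (rule integral_density) (use nonneg in auto)
      also have "\<dots> = (CLINT \<omega>|M. (1 / complex_of_real c) * (complex_of_real (w \<omega>) * iexp (t * X \<omega>)))"
        by (intro Bochner_Integration.integral_cong refl) (simp add: scaleR_conv_of_real)
      also have "\<dots> = (1 / complex_of_real c) * (CLINT \<omega>|M. complex_of_real (w \<omega>) * iexp (t * X \<omega>))"
        by (rule integral_mult_right_zero)
      also have "\<dots> = (CLINT \<omega>|M. iexp (t * X \<omega>))"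
        using c unfolding char c_def[symmetric] by simp
      also have "\<dots> = char (distr M borel X) t"
        unfolding char_def by (subst integral_distr) auto
      finally show "char (distr N borel X) t = char (distr M borel X) t" .
    qed
  qed (use XN in \<open>auto simp: real_distribution_def real_distribution_axioms_def intro: prob_space_distr N.prob_space_distr\<close>)
  then have "measure (distr N borel X) A = measure (distr M borel X) A" by simp
  then have eq: "measure N (X -` A \<inter> space M) = prob (X -` A \<inter> space M)"
    using XN by (simp add: measure_distr)
  have "ennreal (measure N (X -` A \<inter> space M)) = (\<integral>\<^sup>+\<omega>. ennreal (w \<omega> / c) * indicator (X -` A \<inter> space M) \<omega> \<partial>M)"
    unfolding N.emeasure_eq_measure[symmetric] unfolding N_def by (rule emeasure_density) auto
  also have "\<dots> = (\<integral>\<^sup>+\<omega>. ennreal (w \<omega> / c * indicator A (X \<omega>)) \<partial>M)"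
    by (intro nn_integral_cong) (auto simp: indicator_def)
  also have "\<dots> = ennreal (\<integral>\<omega>. w \<omega> / c * indicator A (X \<omega>) \<partial>M)"
  proof (rule nn_integral_eq_integral)
    show "integrable M (\<lambda>\<omega>. w \<omega> / c * indicator A (X \<omega>))"
      by (rule Bochner_Integration.integrable_bound[OF int]) (auto simp: indicator_def)
  qed (use nonneg in \<open>auto simp: indicator_def\<close>)
  finally have "measure N (X -` A \<inter> space M) = (\<integral>\<omega>. w \<omega> / c * indicator A (X \<omega>) \<partial>M)"
    using w(2) c by (subst (asm) ennreal_inj) (auto intro!: integral_nonneg_AE AE_I2)
  also have "\<dots> = (\<integral>\<omega>. w \<omega> * indicator A (X \<omega>) \<partial>M) / c" by simp
  finally show ?thesis using c unfolding eq c_def[symmetric] by (simp add: field_simps)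
qed

text \<open>A complex factor cannot serve as a density. The weights \<open>V\<close>, V (1 + cos U)
  and V (1 + sin U) can, since they are nonnegative; subtracting the first from the others and
  recombining cos and sin gives the complex identity. The values -1, 0, 1 of \<open>e\<close> are
  the frequencies of \<open>U\<close> occurring in these weights.\<close>

lemma expectation_indicator_iexp_of_char:
  assumes V: "integrable M (V :: 'a \<Rightarrow> real)" "\<And>\<omega>. \<omega> \<in> space M \<Longrightarrow> 0 \<le> V \<omega>"
    and X: "X \<in> borel_measurable M" and U: "U \<in> borel_measurable M"
    and char: "\<And>t e. e \<in> {-1, 0, 1} \<Longrightarrow> (CLINT \<omega>|M. complex_of_real (V \<omega>) * iexp (t * X \<omega> + e * U \<omega>)) =
      (CLINT \<omega>|M. iexp (t * X \<omega>)) * (CLINT \<omega>|M. complex_of_real (V \<omega>) * iexp (e * U \<omega>))"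
    and A: "A \<in> sets borel"
  shows "(CLINT \<omega>|M. complex_of_real (V \<omega> * indicator A (X \<omega>)) * iexp (U \<omega>)) =
    complex_of_real (prob (X -` A \<inter> space M)) * (CLINT \<omega>|M. complex_of_real (V \<omega>) * iexp (U \<omega>))"
proof -
  have [measurable]: "V \<in> borel_measurable M" using V by auto
  note [measurable] = X A U
  let ?P = "prob (X -` A \<inter> space M)"
  have bi: "integrable M (\<lambda>\<omega>. V \<omega> * h \<omega>)"
    if "h \<in> borel_measurable M" "\<And>\<omega>. \<bar>h \<omega>\<bar> \<le> 1" for h
    by (rule Bochner_Integration.integrable_bound[OF V(1)])
      (use that in \<open>auto simp: abs_mult intro!: AE_I2 mult_left_le\<close>)
  have ei: "integrable M (\<lambda>\<omega>. complex_of_real (V \<omega>) * iexp (t * X \<omega> + e * U \<omega>))" for t e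
    by (rule integrable_mult_iexp[OF V(1)]) measurable
  \<comment> \<open>The constant \<open>a\<close> dominates |h| and so makes the weight nonnegative.
    As a combination of exponentials of \<open>U\<close> and \<open>- U\<close>, \<open>h\<close>
    lets the characteristic function of the weighted law be read off from
    \<open>char\<close>.\<close>
  have key: "(\<integral>\<omega>. (V \<omega> * (a + h \<omega>)) * indicator A (X \<omega>) \<partial>M) = ?P * (\<integral>\<omega>. V \<omega> * (a + h \<omega>) \<partial>M)"
    if h: "\<And>\<omega>. complex_of_real (h \<omega>) = z * iexp (U \<omega>) + z' * iexp (- U \<omega>)"
      and hb: "\<And>\<omega>. \<bar>h \<omega>\<bar> \<le> a" and [measurable]: "h \<in> borel_measurable M" for h a z z'
  proof (rule expectation_indicator_of_char[OF _ _ X _ A])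
    show "integrable M (\<lambda>\<omega>. V \<omega> * (a + h \<omega>))"
    proof (rule Bochner_Integration.integrable_bound)
      show "integrable M (\<lambda>\<omega>. V \<omega> * (2 * a))" using V by simp
      show "AE \<omega> in M. norm (V \<omega> * (a + h \<omega>)) \<le> norm (V \<omega> * (2 * a))"
      proof (rule AE_I2)
        fix \<omega>
        have "\<bar>a + h \<omega>\<bar> \<le> \<bar>2 * a\<bar>" using hb[of \<omega>] by linarith
        then show "norm (V \<omega> * (a + h \<omega>)) \<le> norm (V \<omega> * (2 * a))"
          by (simp only: real_norm_def abs_mult[of "V \<omega>"] mult_left_mono[OF _ abs_ge_zero])
      qed
    qed measurable
    show "0 \<le> V \<omega> * (a + h \<omega>)" if "\<omega> \<in> space M" for \<omega>
      using V(2)[OF that] hb[of \<omega>] by (intro mult_nonneg_nonneg) linarith+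
    have expand: "complex_of_real (V \<omega> * (a + h \<omega>)) * iexp (t * X \<omega>) =
        complex_of_real a * (complex_of_real (V \<omega>) * iexp (t * X \<omega> + 0 * U \<omega>)) +
        (z * (complex_of_real (V \<omega>) * iexp (t * X \<omega> + 1 * U \<omega>)) +
        z' * (complex_of_real (V \<omega>) * iexp (t * X \<omega> + (-1) * U \<omega>)))" for t \<omega>
      by (simp add: h algebra_simps exp_add[symmetric] exp_diff exp_minus divide_inverse)
    have int: "(CLINT \<omega>|M. complex_of_real (V \<omega> * (a + h \<omega>)) * iexp (t * X \<omega>)) =
        complex_of_real a * (CLINT \<omega>|M. complex_of_real (V \<omega>) * iexp (t * X \<omega> + 0 * U \<omega>)) +
        (z * (CLINT \<omega>|M. complex_of_real (V \<omega>) * iexp (t * X \<omega> + 1 * U \<omega>)) +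
        z' * (CLINT \<omega>|M. complex_of_real (V \<omega>) * iexp (t * X \<omega> + (-1) * U \<omega>)))" for t
      unfolding expand
      by (subst Bochner_Integration.integral_add, (intro integrable_mult_right Bochner_Integration.integrable_add ei)+)+
        (simp only: integral_mult_right_zero)
    have "complex_of_real (\<integral>\<omega>. V \<omega> * (a + h \<omega>) \<partial>M) = (CLINT \<omega>|M. complex_of_real (V \<omega> * (a + h \<omega>)) * iexp (0 * X \<omega>))"
      by (subst integral_complex_of_real[symmetric]) simp
    then have e0: "complex_of_real (\<integral>\<omega>. V \<omega> * (a + h \<omega>) \<partial>M) =
        complex_of_real a * (CLINT \<omega>|M. complex_of_real (V \<omega>) * iexp (0 * U \<omega>)) +
        (z * (CLINT \<omega>|M. complex_of_real (V \<omega>) * iexp (1 * U \<omega>)) +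
        z' * (CLINT \<omega>|M. complex_of_real (V \<omega>) * iexp ((-1) * U \<omega>)))"
      unfolding int by simp
    show "(CLINT \<omega>|M. complex_of_real (V \<omega> * (a + h \<omega>)) * iexp (t * X \<omega>)) =
        (CLINT \<omega>|M. iexp (t * X \<omega>)) * complex_of_real (\<integral>\<omega>. V \<omega> * (a + h \<omega>) \<partial>M)" for t
      unfolding int e0 using char[of 0 t] char[of 1 t] char[of "-1" t]
      by (simp add: algebra_simps)
  qed
  have AV: "integrable M (\<lambda>\<omega>. V \<omega> * h \<omega> * indicator A (X \<omega>))"
    if "h \<in> borel_measurable M" "\<And>\<omega>. \<bar>h \<omega>\<bar> \<le> 1" for h
    using that by (intro Bochner_Integration.integrable_bound[OF bi[OF that]])
      (auto simp: indicator_def intro!: borel_measurable_times)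
  have split: "(\<integral>\<omega>. V \<omega> * h \<omega> * indicator A (X \<omega>) \<partial>M) = ?P * (\<integral>\<omega>. V \<omega> * h \<omega> \<partial>M)"
    if h: "\<And>\<omega>. complex_of_real (h \<omega>) = z * iexp (U \<omega>) + z' * iexp (- U \<omega>)"
      and hb: "\<And>\<omega>. \<bar>h \<omega>\<bar> \<le> 1" and hm: "h \<in> borel_measurable M" for h z z'
  proof -
    \<comment> \<open>The weight without \<open>h\<close>, to be subtracted from the shifted
      one.\<close>
    have 1: "(\<integral>\<omega>. V \<omega> * 1 * indicator A (X \<omega>) \<partial>M) = ?P * (\<integral>\<omega>. V \<omega> * 1 \<partial>M)"
      using key[of "\<lambda>_. 0" 0 0 1] by simp
    have 2: "(\<integral>\<omega>. V \<omega> * (1 + h \<omega>) * indicator A (X \<omega>) \<partial>M) = ?P * (\<integral>\<omega>. V \<omega> * (1 + h \<omega>) \<partial>M)"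
      using key[OF h hb hm] .
    have 3: "(\<integral>\<omega>. V \<omega> * (1 + h \<omega>) * indicator A (X \<omega>) \<partial>M) =
        (\<integral>\<omega>. V \<omega> * 1 * indicator A (X \<omega>) \<partial>M) + (\<integral>\<omega>. V \<omega> * h \<omega> * indicator A (X \<omega>) \<partial>M)"
      using AV[of "\<lambda>_. 1"] AV[OF hm hb]
      by (subst Bochner_Integration.integral_add[symmetric]) (auto simp: algebra_simps)
    have 4: "(\<integral>\<omega>. V \<omega> * (1 + h \<omega>) \<partial>M) = (\<integral>\<omega>. V \<omega> * 1 \<partial>M) + (\<integral>\<omega>. V \<omega> * h \<omega> \<partial>M)"
      using bi[of "\<lambda>_. 1"] bi[OF hm hb]
      by (subst Bochner_Integration.integral_add[symmetric]) (auto simp: algebra_simps)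
    show ?thesis using 1 2 3 4 by (simp add: algebra_simps)
  qed
  have c: "(\<integral>\<omega>. V \<omega> * cos (U \<omega>) * indicator A (X \<omega>) \<partial>M) = ?P * (\<integral>\<omega>. V \<omega> * cos (U \<omega>) \<partial>M)"
    by (rule split[of _ "1/2" "1/2"]) (auto simp: iexp_eq_cos_sin[of "U _"] iexp_eq_cos_sin[of "- U _", simplified] field_simps)
  have s: "(\<integral>\<omega>. V \<omega> * sin (U \<omega>) * indicator A (X \<omega>) \<partial>M) = ?P * (\<integral>\<omega>. V \<omega> * sin (U \<omega>) \<partial>M)"
    by (rule split[of _ "-\<i>/2" "\<i>/2"]) (auto simp: iexp_eq_cos_sin[of "U _"] iexp_eq_cos_sin[of "- U _", simplified] algebra_simps)
  have dec: "(CLINT \<omega>|M. complex_of_real (g \<omega>) * iexp (U \<omega>)) =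
      complex_of_real (\<integral>\<omega>. g \<omega> * cos (U \<omega>) \<partial>M) + \<i> * complex_of_real (\<integral>\<omega>. g \<omega> * sin (U \<omega>) \<partial>M)"
    if g: "integrable M (\<lambda>\<omega>. g \<omega> * cos (U \<omega>))" "integrable M (\<lambda>\<omega>. g \<omega> * sin (U \<omega>))" for g
  proof -
    have "(CLINT \<omega>|M. complex_of_real (g \<omega>) * iexp (U \<omega>)) =
      (CLINT \<omega>|M. complex_of_real (g \<omega> * cos (U \<omega>)) + \<i> * complex_of_real (g \<omega> * sin (U \<omega>)))"
      by (intro Bochner_Integration.integral_cong refl) (simp add: iexp_eq_cos_sin algebra_simps)
    also have "\<dots> = (CLINT \<omega>|M. complex_of_real (g \<omega> * cos (U \<omega>))) + (CLINT \<omega>|M. \<i> * complex_of_real (g \<omega> * sin (U \<omega>)))"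
      using g by (intro Bochner_Integration.integral_add integrable_mult_right integrable_of_real)
    finally show ?thesis by (simp only: integral_mult_right_zero integral_complex_of_real)
  qed
  have cA: "(\<integral>\<omega>. (V \<omega> * indicator A (X \<omega>)) * cos (U \<omega>) \<partial>M) = ?P * (\<integral>\<omega>. V \<omega> * cos (U \<omega>) \<partial>M)"
    unfolding c[symmetric] by (intro Bochner_Integration.integral_cong refl) (simp only: ac_simps)
  have sA: "(\<integral>\<omega>. (V \<omega> * indicator A (X \<omega>)) * sin (U \<omega>) \<partial>M) = ?P * (\<integral>\<omega>. V \<omega> * sin (U \<omega>) \<partial>M)"
    unfolding s[symmetric] by (intro Bochner_Integration.integral_cong refl) (simp only: ac_simps)
  have iA: "integrable M (\<lambda>\<omega>. (V \<omega> * indicator A (X \<omega>)) * cos (U \<omega>))"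
    "integrable M (\<lambda>\<omega>. (V \<omega> * indicator A (X \<omega>)) * sin (U \<omega>))"
    using AV[of "\<lambda>\<omega>. cos (U \<omega>)"] AV[of "\<lambda>\<omega>. sin (U \<omega>)"] by (auto simp: ac_simps)
  have iV: "integrable M (\<lambda>\<omega>. V \<omega> * cos (U \<omega>))" "integrable M (\<lambda>\<omega>. V \<omega> * sin (U \<omega>))"
    by (auto intro!: bi)
  show ?thesis
    unfolding dec[of "\<lambda>\<omega>. V \<omega> * indicator A (X \<omega>)", OF iA] dec[of V, OF iV] cA sA
    by (simp add: algebra_simps)
qed

text \<open>The variables are converted one at a time: in the factorised expectation each
  exponential is replaced by an indicator, while the variables not yet treated keep arbitrary
  frequencies. Once all relevant exponentials are gone, what is left is the product rule for
  probabilities.\<close>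

theorem indep_vars_of_char:
  assumes F: "finite F" and X: "\<And>k. k \<in> F \<Longrightarrow> X k \<in> borel_measurable M"
    and char: "\<And>\<theta>. (CLINT \<omega>|M. iexp (\<Sum>k\<in>F. \<theta> k * X k \<omega>)) = (\<Prod>k\<in>F. CLINT \<omega>|M. iexp (\<theta> k * X k \<omega>))"
  shows "indep_vars (\<lambda>_. borel) X F"
proof -
  let ?V = "\<lambda>A G \<omega>. \<Prod>k\<in>G. indicator (A k) (X k \<omega>) :: real"
  let ?c = "\<lambda>t k. CLINT \<omega>|M. iexp (t * X k \<omega>)"
  have main: "(CLINT \<omega>|M. complex_of_real (?V A G \<omega>) * iexp (\<Sum>k\<in>F - G. \<theta> k * X k \<omega>)) =
     (\<Prod>k\<in>G. complex_of_real (prob (X k -` A k \<inter> space M))) * (\<Prod>k\<in>F - G. ?c (\<theta> k) k)"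
    if "G \<subseteq> F" "\<And>k. k \<in> G \<Longrightarrow> A k \<in> sets borel" for G A \<theta>
  proof -
    have "finite G" using that(1) F finite_subset by blast
    then show ?thesis using that
    proof (induction G arbitrary: \<theta> rule: finite_induct)
      case empty
      then show ?case using char by simp
    next
      case (insert l G)
      let ?R = "F - insert l G"
      have R: "F - G = insert l ?R" "l \<notin> ?R" "finite ?R" using insert F by auto
      have [measurable]: "X k \<in> borel_measurable M" if "k \<in> F" for k using X that .
      have [measurable]: "(\<lambda>\<omega>. \<Sum>k\<in>?R. \<theta> k * X k \<omega>) \<in> borel_measurable M" by measurable
      have Vb: "0 \<le> ?V A G \<omega>" "?V A G \<omega> \<le> 1" for \<omega>
        by (auto intro!: prod_nonneg prod_le_1 simp: indicator_def)
      have Vm: "?V A G \<in> borel_measurable M"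
      proof (rule borel_measurable_prod)
        fix k assume "k \<in> G"
        then have [measurable]: "A k \<in> sets borel" "X k \<in> borel_measurable M" using insert X by auto
        show "(\<lambda>\<omega>. indicator (A k) (X k \<omega>) :: real) \<in> borel_measurable M" by measurable
      qed
      have Vi: "integrable M (?V A G)"
      proof (rule integrable_const_bound[of _ 1])
        show "AE \<omega> in M. norm (?V A G \<omega>) \<le> 1"
          using Vb by (intro AE_I2) (simp only: real_norm_def abs_of_nonneg)
      qed (rule Vm)
      \<comment> \<open>Using the induction hypothesis at \<open>\<eta>(l := t)\<close> isolates the
        frequency of the variable that is converted next; \<open>t = 0\<close> removes that
        variable.\<close>
      have IH: "(CLINT \<omega>|M. complex_of_real (?V A G \<omega>) * iexp (t * X l \<omega> + (\<Sum>k\<in>?R. \<eta> k * X k \<omega>))) =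
          (\<Prod>k\<in>G. complex_of_real (prob (X k -` A k \<inter> space M))) * (?c t l * (\<Prod>k\<in>?R. ?c (\<eta> k) k))" for t \<eta>
      proof -
        have s: "(\<Sum>k\<in>F - G. (\<eta>(l := t)) k * X k \<omega>) = t * X l \<omega> + (\<Sum>k\<in>?R. \<eta> k * X k \<omega>)" for \<omega>
        proof -
          have "(\<Sum>k\<in>?R. (\<eta>(l := t)) k * X k \<omega>) = (\<Sum>k\<in>?R. \<eta> k * X k \<omega>)"
            using R(2) by (intro sum.cong) auto
          then show ?thesis by (subst R(1), subst sum.insert[OF R(3,2)]) simp
        qed
        have p: "(\<Prod>k\<in>F - G. ?c ((\<eta>(l := t)) k) k) = ?c t l * (\<Prod>k\<in>?R. ?c (\<eta> k) k)"
        proof -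
          have "(\<Prod>k\<in>?R. ?c ((\<eta>(l := t)) k) k) = (\<Prod>k\<in>?R. ?c (\<eta> k) k)"
            using R(2) by (intro prod.cong) auto
          then show ?thesis by (subst R(1), subst prod.insert[OF R(3,2)]) simp
        qed
        show ?thesis using insert.IH[of "\<eta>(l := t)"] insert.prems unfolding s p by simp
      qed
      have c0: "?c 0 l = 1" by (simp add: prob_space)
      have "(CLINT \<omega>|M. complex_of_real (?V A G \<omega> * indicator (A l) (X l \<omega>)) * iexp (\<Sum>k\<in>?R. \<theta> k * X k \<omega>)) =
        complex_of_real (prob (X l -` A l \<inter> space M)) * (CLINT \<omega>|M. complex_of_real (?V A G \<omega>) * iexp (\<Sum>k\<in>?R. \<theta> k * X k \<omega>))"
      proof (rule expectation_indicator_iexp_of_char[OF Vi Vb(1)])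
        fix t e :: real
        have e: "e * (\<Sum>k\<in>?R. \<theta> k * X k \<omega>) = (\<Sum>k\<in>?R. (e * \<theta> k) * X k \<omega>)" for \<omega>
          by (simp add: sum_distrib_left mult.assoc)
        show "(CLINT \<omega>|M. complex_of_real (?V A G \<omega>) * iexp (t * X l \<omega> + e * (\<Sum>k\<in>?R. \<theta> k * X k \<omega>))) =
          ?c t l * (CLINT \<omega>|M. complex_of_real (?V A G \<omega>) * iexp (e * (\<Sum>k\<in>?R. \<theta> k * X k \<omega>)))"
          using IH[of t "\<lambda>k. e * \<theta> k"] IH[of 0 "\<lambda>k. e * \<theta> k"] unfolding e c0 by (simp add: mult.left_commute)
      qed (use insert X in auto)
      also have "(CLINT \<omega>|M. complex_of_real (?V A G \<omega>) * iexp (\<Sum>k\<in>?R. \<theta> k * X k \<omega>)) =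
          (\<Prod>k\<in>G. complex_of_real (prob (X k -` A k \<inter> space M))) * (\<Prod>k\<in>?R. ?c (\<theta> k) k)"
        using IH[of 0 \<theta>] unfolding c0 by simp
      finally show ?case using insert.hyps by (simp add: mult.commute mult.left_commute)
    qed
  qed
  have prod: "prob (\<Inter>k\<in>G. X k -` A k \<inter> space M) = (\<Prod>k\<in>G. prob (X k -` A k \<inter> space M))"
    if G: "G \<subseteq> F" "G \<noteq> {}" "\<And>k. k \<in> G \<Longrightarrow> A k \<in> sets borel" for G A
  proof -
    have "finite G" using G F finite_subset by blast
    have sets: "(\<Inter>k\<in>G. X k -` A k \<inter> space M) \<in> sets M"
      using G X \<open>finite G\<close> by (intro sets.finite_INT measurable_sets[of _ M borel]) auto
    have ind: "?V A G \<omega> = indicator (\<Inter>k\<in>G. X k -` A k \<inter> space M) \<omega>" if "\<omega> \<in> space M" for \<omega>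
      using that \<open>finite G\<close> by (auto simp: indicator_def prod_eq_1_iff)
    \<comment> \<open>Frequency 0 removes the variables outside \<open>G\<close>.\<close>
    have m0: "(CLINT \<omega>|M. complex_of_real (?V A G \<omega>) * iexp (\<Sum>k\<in>F - G. 0 * X k \<omega>)) =
       (\<Prod>k\<in>G. complex_of_real (prob (X k -` A k \<inter> space M))) * (\<Prod>k\<in>F - G. ?c 0 k)"
      by (rule main) (use G in auto)
    have "(CLINT \<omega>|M. complex_of_real (?V A G \<omega>) * iexp (\<Sum>k\<in>F - G. 0 * X k \<omega>)) =
       (CLINT \<omega>|M. complex_of_real (indicator (\<Inter>k\<in>G. X k -` A k \<inter> space M) \<omega>))"
      by (intro Bochner_Integration.integral_cong refl) (simp add: ind del: of_real_prod)
    also have "\<dots> = complex_of_real (prob (\<Inter>k\<in>G. X k -` A k \<inter> space M))"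
      unfolding integral_complex_of_real using sets by simp
    finally have "complex_of_real (prob (\<Inter>k\<in>G. X k -` A k \<inter> space M)) =
        complex_of_real (\<Prod>k\<in>G. prob (X k -` A k \<inter> space M))"
      using m0 by (simp add: prob_space)
    then show ?thesis by (simp only: of_real_eq_iff)
  qed
  show ?thesis
    unfolding indep_vars_def2
  proof (intro conjI ballI X indep_setsI)
    show "{X i -` A \<inter> space M |A. A \<in> sets borel} \<subseteq> events" if "i \<in> F" for i
      using X[OF that] by auto
    fix B G assume G: "G \<noteq> {}" "G \<subseteq> F" "finite G" and B: "\<forall>j\<in>G. B j \<in> {X j -` A \<inter> space M |A. A \<in> sets borel}"
    then obtain A where A: "\<And>j. j \<in> G \<Longrightarrow> B j = X j -` A j \<inter> space M \<and> A j \<in> sets borel"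
    proof -
      have "\<forall>j\<in>G. \<exists>A. B j = X j -` A \<inter> space M \<and> A \<in> sets borel" using B by blast
      then show ?thesis using that by (metis bchoice)
    qed
    then show "prob (\<Inter>j\<in>G. B j) = (\<Prod>j\<in>G. prob (B j))"
      using prod[OF G(2,1), of A] by (simp cong: INF_cong prod.cong)
  qed auto
qed

end

subsection \<open>Stochastic integrals of orthonormal functions\<close>

lemma std_normal_variable_square:
  assumes "prob_space M" "Z \<in> borel_measurable M" "distr M borel Z = std_normal_distribution"
  shows "integrable M (\<lambda>\<omega>. (Z \<omega>)\<^sup>2)" "(\<integral>\<omega>. (Z \<omega>)\<^sup>2 \<partial>M) = 1"
proof -
  have "integrable std_normal_distribution (\<lambda>x. x\<^sup>2)" by (rule integrable_std_normal_distribution_moment)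
  then show "integrable M (\<lambda>\<omega>. (Z \<omega>)\<^sup>2)"
    unfolding assms(3)[symmetric] using assms(2) by (subst (asm) integrable_distr_eq) auto
  have "(\<integral>\<omega>. (Z \<omega>)\<^sup>2 \<partial>M) = (\<integral>x. x\<^sup>2 \<partial>distr M borel Z)"
    using assms(2) by (subst integral_distr) auto
  then show "(\<integral>\<omega>. (Z \<omega>)\<^sup>2 \<partial>M) = 1"
    using std_normal_distribution_even_moments(1)[of 1] by (simp add: assms(3) fact_numeral)
qed

text \<open>Equivalent to (2k-1)!! \<le> (2k)^k, the double factorial being the 2k-th moment of a
  standard normal variable.\<close>

lemma fact_double_le: "fact (2 * k) \<le> (2 ^ k * fact k * (2 * real k) ^ k)"
proof -
  \<comment> \<open>The induction runs over \<open>m\<close> with the base 2k held fixed, so that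
    each step contributes one factor 2m + 1 \<le> 2k.\<close>
  have *: "fact (2 * m) \<le> (2 ^ m * fact m * (2 * real k) ^ m)" if "m \<le> k" for m
    using that
  proof (induction m)
    case (Suc m)
    have "fact (2 * Suc m) = (2 * real m + 2) * (2 * real m + 1) * fact (2 * m)"
      by (simp add: algebra_simps)
    also have "\<dots> \<le> (2 * real m + 2) * (2 * real k) * (2 ^ m * fact m * (2 * real k) ^ m)"
      using Suc by (intro mult_mono) auto
    also have "\<dots> = 2 ^ Suc m * fact (Suc m) * (2 * real k) ^ Suc m"
      by (simp add: algebra_simps)
    finally show ?case .
  qed simp
  show ?thesis by (rule *) simp
qed

text \<open>A power of two is either even, where the moment is a double factorial, or equal to 1.
  The bound is exactly the factor p^(p/2) of \<open>K_const\<close>.\<close>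

lemma std_normal_variable_abs_moment:
  assumes M: "prob_space M" and Z: "Z \<in> borel_measurable M" "distr M borel Z = std_normal_distribution"
    and p: "p = 2 ^ r"
  shows "integrable M (\<lambda>\<omega>. \<bar>Z \<omega>\<bar> ^ p)" "(\<integral>\<omega>. \<bar>Z \<omega>\<bar> ^ p \<partial>M) \<le> real p powr (real p / 2)"
proof -
  interpret prob_space M by (rule M)
  note sq = std_normal_variable_square[OF M Z]
  have "integrable std_normal_distribution (\<lambda>x. \<bar>x ^ p\<bar>)"
    using integrable_std_normal_distribution_moment[of p] by (rule integrable_abs)
  then show i: "integrable M (\<lambda>\<omega>. \<bar>Z \<omega>\<bar> ^ p)"
    unfolding Z(2)[symmetric] using Z(1) by (subst (asm) integrable_distr_eq) (auto simp: power_abs)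
  show "(\<integral>\<omega>. \<bar>Z \<omega>\<bar> ^ p \<partial>M) \<le> real p powr (real p / 2)"
  proof (cases r)
    case 0
    then have "p = 1" using p by simp
    \<comment> \<open>The exponent 1 is reduced to the second moment by 2|z| \<le> 1 + z^2.\<close>
    have "(\<integral>\<omega>. \<bar>Z \<omega>\<bar> \<partial>M) \<le> (\<integral>\<omega>. (1 + (Z \<omega>)\<^sup>2) / 2 \<partial>M)"
    proof (rule integral_mono)
      show "integrable M (\<lambda>\<omega>. \<bar>Z \<omega>\<bar>)" using i \<open>p = 1\<close> by simp
      show "integrable M (\<lambda>\<omega>. (1 + (Z \<omega>)\<^sup>2) / 2)" using sq by simp
      show "\<bar>Z \<omega>\<bar> \<le> (1 + (Z \<omega>)\<^sup>2) / 2" for \<omega>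
        using zero_le_power2[of "\<bar>Z \<omega>\<bar> - 1"] by (simp add: power2_diff)
    qed
    also have "\<dots> = 1" using sq by (simp add: prob_space)
    finally show ?thesis using \<open>p = 1\<close> by simp
  next
    case (Suc q)
    define k where "k = (2 ^ q :: nat)"
    have k: "p = 2 * k" "k > 0" using p Suc by (auto simp: k_def)
    have "(\<integral>\<omega>. \<bar>Z \<omega>\<bar> ^ p \<partial>M) = (\<integral>x. \<bar>x\<bar> ^ p \<partial>distr M borel Z)"
      using Z by (subst integral_distr) auto
    also have "\<dots> = fact (2 * k) / (2 ^ k * fact k)"
      unfolding Z(2) k(1) using std_normal_distribution_even_moments_abs(1)[of k] by simp
    also have "\<dots> \<le> (2 * real k) ^ k"
      using fact_double_le[of k] by (simp add: divide_le_eq mult.commute mult.left_commute)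
    also have "\<dots> = real p powr (real p / 2)"
      using k by (simp add: powr_realpow)
    finally show ?thesis .
  qed
qed

text \<open>Chernoff's bound with the optimal parameter \<open>x\<close>; the sum of the
  exponentials at \<open>x\<close> and \<open>-x\<close> treats both tails at once, which costs the
  factor 2.\<close>

lemma std_normal_variable_tail:
  assumes M: "prob_space M" and Z: "Z \<in> borel_measurable M" "distr M borel Z = std_normal_distribution"
    and x: "x \<ge> 0"
  shows "measure M {\<omega> \<in> space M. \<bar>Z \<omega>\<bar> > x} \<le> 2 * exp (- (x\<^sup>2 / 2))"
proof -
  interpret prob_space M by (rule M)
  note [measurable] = Z(1)
  have mgf: "(\<integral>\<^sup>+\<omega>. ennreal (exp (a * Z \<omega>)) \<partial>M) = ennreal (exp (a\<^sup>2 / 2))" for a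
  proof -
    have "(\<integral>\<^sup>+\<omega>. ennreal (exp (a * Z \<omega>)) \<partial>M) = (\<integral>\<^sup>+z. ennreal (exp (a * z)) \<partial>distr M borel Z)"
      by (subst nn_integral_distr) auto
    also have "\<dots> = (\<integral>\<^sup>+z. ennreal (std_normal_density z) * ennreal (exp (a * z)) \<partial>lborel)"
      unfolding Z(2) by (subst nn_integral_density) auto
    also have "\<dots> = (\<integral>\<^sup>+z. ennreal (exp (a\<^sup>2 / 2)) * ennreal (normal_density a 1 z) \<partial>lborel)"
    proof (intro nn_integral_cong)
      fix z
      \<comment> \<open>Completing the square: tilting a standard normal density shifts its mean to
        \<open>a\<close>.\<close>
      have "std_normal_density z * exp (a * z) = exp (a\<^sup>2 / 2) * normal_density a 1 z"
        by (simp add: normal_density_def exp_add[symmetric] power2_eq_square field_simps)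
      then show "ennreal (std_normal_density z) * ennreal (exp (a * z)) = ennreal (exp (a\<^sup>2 / 2)) * ennreal (normal_density a 1 z)"
        by (simp flip: ennreal_mult')
    qed
    also have "\<dots> = ennreal (exp (a\<^sup>2 / 2)) * (\<integral>\<^sup>+z. ennreal (normal_density a 1 z) \<partial>lborel)"
      by (rule nn_integral_cmult) auto
    also have "(\<integral>\<^sup>+z. ennreal (normal_density a 1 z) \<partial>lborel) = 1"
      by (subst nn_integral_eq_integral) (auto simp: normal_density_nonneg)
    finally show ?thesis by simp
  qed
  let ?A = "{\<omega> \<in> space M. \<bar>Z \<omega>\<bar> > x}"
  have "ennreal (exp (x\<^sup>2) * prob ?A) = (\<integral>\<^sup>+\<omega>. ennreal (exp (x\<^sup>2)) * indicator ?A \<omega> \<partial>M)"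
    by (simp add: nn_integral_cmult_indicator emeasure_eq_measure ennreal_mult)
  also have "\<dots> \<le> (\<integral>\<^sup>+\<omega>. ennreal (exp (x * Z \<omega>)) + ennreal (exp ((-x) * Z \<omega>)) \<partial>M)"
  proof (rule nn_integral_mono)
    fix \<omega>
    have "exp (x\<^sup>2) \<le> exp (x * Z \<omega>) + exp ((-x) * Z \<omega>)" if "\<bar>Z \<omega>\<bar> > x"
    proof -
      have "x\<^sup>2 \<le> x * \<bar>Z \<omega>\<bar>" using that x by (auto simp: power2_eq_square intro: mult_left_mono)
      then have "exp (x\<^sup>2) \<le> exp (x * \<bar>Z \<omega>\<bar>)" by simp
      also have "\<dots> \<le> exp (x * Z \<omega>) + exp ((-x) * Z \<omega>)"
        by (cases "Z \<omega> \<ge> 0") simp_all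
      finally show ?thesis .
    qed
    then show "ennreal (exp (x\<^sup>2)) * indicator ?A \<omega> \<le> ennreal (exp (x * Z \<omega>)) + ennreal (exp ((-x) * Z \<omega>))"
      by (auto simp: indicator_def simp flip: ennreal_plus)
  qed
  also have "\<dots> = ennreal (2 * exp (x\<^sup>2 / 2))"
    by (subst nn_integral_add) (auto simp: mgf mgf[of "-x", simplified] simp flip: ennreal_plus)
  finally have "exp (x\<^sup>2) * prob ?A \<le> 2 * exp (x\<^sup>2 / 2)" by (subst (asm) ennreal_le_iff) auto
  moreover have "exp (x\<^sup>2) = exp (x\<^sup>2 / 2) * exp (x\<^sup>2 / 2)" by (simp flip: exp_add)
  ultimately have "exp (x\<^sup>2 / 2) * (exp (x\<^sup>2 / 2) * prob ?A) \<le> exp (x\<^sup>2 / 2) * 2"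
    by (simp add: mult.assoc mult.commute)
  then have "exp (x\<^sup>2 / 2) * prob ?A \<le> 2" by simp
  then show ?thesis by (simp add: exp_minus field_simps)
qed

lemma norm_iexp_diff_le: "norm (iexp a - iexp b) \<le> \<bar>a - b\<bar>"
proof -
  have "iexp a - iexp b = iexp b * (iexp (a - b) - 1)"
    by (simp add: algebra_simps exp_add[symmetric])
  then have "norm (iexp a - iexp b) = norm (iexp (a - b) - 1)" by (simp add: norm_mult)
  also have "\<dots> \<le> \<bar>a - b\<bar>" using iexp_approx1[of "a - b" 0] by simp
  finally show ?thesis .
qed

text \<open>The map \<open>iexp\<close> is 1-Lipschitz, and mean absolute differences are bounded by
  root mean square ones.\<close>

lemma (in prob_space) char_tendsto_of_L2:
  assumes F: "\<And>m. square_integrable M (F m)" and X: "square_integrable M X"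
    and lim: "(\<lambda>m. L2_dist_sq M X (F m)) \<longlonglongrightarrow> 0"
  shows "(\<lambda>m. CLINT \<omega>|M. iexp (F m \<omega>)) \<longlonglongrightarrow> (CLINT \<omega>|M. iexp (X \<omega>))"
proof -
  let ?d = "\<lambda>m. \<integral>\<omega>. (X \<omega> - F m \<omega>)\<^sup>2 \<partial>M"
  have "(\<lambda>m. ennreal (?d m)) \<longlonglongrightarrow> ennreal 0"
    using lim L2_dist_sq_eq[OF X F] by simp
  then have "?d \<longlonglongrightarrow> 0" by (subst (asm) tendsto_ennreal_iff) auto
  then have "(\<lambda>m. sqrt (?d m)) \<longlonglongrightarrow> sqrt 0" by (intro tendsto_intros)
  then have lim0: "(\<lambda>m. sqrt (?d m)) \<longlonglongrightarrow> 0" by simp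
  have [measurable]: "F m \<in> borel_measurable M" "X \<in> borel_measurable M" for m
    using F X by (auto simp: square_integrable_def)
  have int: "integrable M (\<lambda>\<omega>. iexp (f \<omega>))" if "f \<in> borel_measurable M" for f
    using that by (intro integrable_const_bound[of _ 1]) auto
  have bound: "norm ((CLINT \<omega>|M. iexp (F m \<omega>)) - (CLINT \<omega>|M. iexp (X \<omega>))) \<le> sqrt (?d m)" for m
  proof -
    have one: "square_integrable M (\<lambda>\<omega>. 1)" by (simp add: square_integrable_def)
    have D: "square_integrable M (\<lambda>\<omega>. \<bar>X \<omega> - F m \<omega>\<bar>)"
      using square_integrable_diff[OF X F[of m]] by (simp add: square_integrable_def)
    have "norm ((CLINT \<omega>|M. iexp (F m \<omega>)) - (CLINT \<omega>|M. iexp (X \<omega>))) = norm (CLINT \<omega>|M. iexp (F m \<omega>) - iexp (X \<omega>))"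
      by (subst Bochner_Integration.integral_diff) (auto intro!: int)
    also have "\<dots> \<le> (\<integral>\<omega>. norm (iexp (F m \<omega>) - iexp (X \<omega>)) \<partial>M)"
      by (rule integral_norm_bound)
    also have "\<dots> \<le> (\<integral>\<omega>. \<bar>X \<omega> - F m \<omega>\<bar> * 1 \<partial>M)"
    proof (rule integral_mono)
      show "integrable M (\<lambda>\<omega>. norm (iexp (F m \<omega>) - iexp (X \<omega>)))"
        by (intro integrable_norm Bochner_Integration.integrable_diff int) auto
      show "norm (iexp (F m \<omega>) - iexp (X \<omega>)) \<le> \<bar>X \<omega> - F m \<omega>\<bar> * 1" for \<omega>
        using norm_iexp_diff_le[of "F m \<omega>" "X \<omega>"] by (simp add: abs_minus_commute)
    qed (rule square_integrable_mult[OF D one])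
    also have "\<dots> \<le> sqrt (?d m)"
      using Cauchy_Schwarz_integral[OF D one] by (intro real_le_rsqrt) (simp add: prob_space)
    finally show ?thesis .
  qed
  have "(\<lambda>m. (CLINT \<omega>|M. iexp (F m \<omega>)) - (CLINT \<omega>|M. iexp (X \<omega>))) \<longlonglongrightarrow> 0"
    by (rule Lim_null_comparison[OF always_eventually[OF allI[OF bound]] lim0])
  then show ?thesis by (rule LIM_zero_cancel)
qed

section \<open>Joint law of stochastic integrals\<close>

context brownian_motion
begin

lemma char_increment:
  assumes "0 \<le> r" "r < t" "t \<le> 1"
  shows "char (distr M borel (\<lambda>\<omega>. c * (W t \<omega> - W r \<omega>))) 1 = complex_of_real (exp (- (c\<^sup>2 * (t - r)) / 2))"
proof -
  have [measurable]: "W t \<in> borel_measurable M" "W r \<in> borel_measurable M"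
    using assms by (auto intro: random_variable)
  have pos: "sqrt (t - r) > 0" using assms by simp
  have "char (distr M borel (\<lambda>\<omega>. c * (W t \<omega> - W r \<omega>))) 1 =
      (CLINT \<omega>|M. iexp (c * (W t \<omega> - W r \<omega>)))"
    unfolding char_def by (subst integral_distr) auto
  also have "\<dots> = (CLINT \<omega>|M. iexp ((c * sqrt (t - r)) * ((W t \<omega> - W r \<omega>) / sqrt (t - r))))"
    using pos by (intro Bochner_Integration.integral_cong refl) simp
  also have "\<dots> = char (distr M borel (\<lambda>\<omega>. (W t \<omega> - W r \<omega>) / sqrt (t - r))) (c * sqrt (t - r))"
    unfolding char_def by (subst integral_distr) auto
  also have "\<dots> = complex_of_real (exp (- (c * sqrt (t - r))\<^sup>2 / 2))"
    unfolding increment_normal[OF assms] char_std_normal_distribution by simp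
  also have "(c * sqrt (t - r))\<^sup>2 = c\<^sup>2 * (t - r)"
    using assms by (simp add: power_mult_distrib)
  finally show ?thesis .
qed

text \<open>The increments over distinct cells are independent centred Gaussians, so the exponents
  add up to the Riemann sum of the squared integrand.\<close>

lemma char_step_integral_grid:
  "(CLINT \<omega>|M. iexp (step_integral W (grid_step g m) \<omega>)) =
     complex_of_real (exp (- (\<integral>x. (step_fun (grid_step g m) x)\<^sup>2 \<partial>unit_measure) / 2))"
proof -
  define \<tau> where "\<tau> i = real i / real (Suc m)" for i :: nat
  have \<tau>: "\<tau> i \<in> {0..1}" if "i \<le> Suc m" for i using that by (auto simp: \<tau>_def divide_le_eq)
  have \<tau>': "\<tau> i < \<tau> (Suc i)" "\<tau> (Suc i) - \<tau> i = 1 / real (Suc m)" for i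
    by (auto simp: \<tau>_def divide_strict_right_mono diff_divide_distrib[symmetric])
  let ?X = "\<lambda>i \<omega>. g (\<tau> i) * (W (\<tau> (Suc i)) \<omega> - W (\<tau> i) \<omega>)"
  have ind: "indep_vars (\<lambda>_. borel) (\<lambda>i \<omega>. W (\<tau> (Suc i)) \<omega> - W (\<tau> i) \<omega>) {..<Suc m}"
    by (rule independent_increments) (use \<tau> \<tau>' in auto)
  have "indep_vars (\<lambda>_. borel) (\<lambda>i \<omega>. (\<lambda>x. g (\<tau> i) * x) (W (\<tau> (Suc i)) \<omega> - W (\<tau> i) \<omega>)) {..<Suc m}"
    by (rule indep_vars_compose2[OF ind]) measurable
  then have ind': "indep_vars (\<lambda>_. borel) ?X {..<Suc m}" .
  have [measurable]: "step_integral W (grid_step g m) \<in> borel_measurable M"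
    by (intro square_integrable_measurable square_integrable_W valid_grid_step)
  have eq: "(\<lambda>\<omega>. \<Sum>i<Suc m. ?X i \<omega>) = step_integral W (grid_step g m)"
    unfolding step_integral_grid_step \<tau>_def by (rule refl)
  have "(CLINT \<omega>|M. iexp (step_integral W (grid_step g m) \<omega>)) = char (distr M borel (step_integral W (grid_step g m))) 1"
    unfolding char_def by (subst integral_distr) auto
  also have "\<dots> = (\<Prod>i<Suc m. char (distr M borel (?X i)) 1)"
    unfolding eq[symmetric] by (rule char_distr_sum[OF ind'])
  also have "\<dots> = (\<Prod>i<Suc m. complex_of_real (exp (- ((g (\<tau> i))\<^sup>2 / real (Suc m)) / 2)))"
  proof (intro prod.cong refl)
    fix i assume "i \<in> {..<Suc m}"
    then have "\<tau> i \<in> {0..1}" "\<tau> (Suc i) \<in> {0..1}" using \<tau>[of i] \<tau>[of "Suc i"] by simp_all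
    then show "char (distr M borel (?X i)) 1 = complex_of_real (exp (- ((g (\<tau> i))\<^sup>2 / real (Suc m)) / 2))"
      using char_increment[of "\<tau> i" "\<tau> (Suc i)" "g (\<tau> i)"] \<tau>'[of i] by simp
  qed
  also have "\<dots> = complex_of_real (exp (\<Sum>i<Suc m. - ((g (\<tau> i))\<^sup>2 / real (Suc m)) / 2))"
    unfolding of_real_prod[symmetric] exp_sum[OF finite_lessThan] by (rule refl)
  also have "(\<Sum>i<Suc m. - ((g (\<tau> i))\<^sup>2 / real (Suc m)) / 2) = - (\<Sum>i<Suc m. (g (\<tau> i))\<^sup>2 / real (Suc m)) / 2"
    by (simp only: sum_negf sum_divide_distrib[symmetric] minus_divide_left[symmetric])
  finally show ?thesis unfolding integral_step_fun_grid_step_square \<tau>_def .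
qed

lemma has_stoch_integral_grid:
  assumes "continuous_on {0..1} g" "has_stoch_integral M W g X"
  shows "(\<lambda>m. L2_dist_sq M X (step_integral W (grid_step g m))) \<longlonglongrightarrow> 0"
  using has_stoch_integral_tendsto[OF assms(2) borel_measurable_unit_measure_continuous[OF assms(1)]
      valid_grid_step grid_step_tendsto[OF assms(1)]] .

lemma has_stoch_integral_square_integrable:
  assumes "continuous_on {0..1} g" "has_stoch_integral M W g X"
  shows "square_integrable M X"
proof -
  have "\<forall>\<^sub>F m in sequentially. L2_dist_sq M X (step_integral W (grid_step g m)) < \<top>"
    using has_stoch_integral_grid[OF assms] by (rule order_tendstoD) simp
  then obtain m where "L2_dist_sq M X (step_integral W (grid_step g m)) < \<top>"
    using eventually_happens'[OF sequentially_bot] by blast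
  moreover have "X \<in> borel_measurable M" using assms(2) by (simp add: has_stoch_integral_def)
  ultimately show ?thesis
    using square_integrable_of_L2_dist square_integrable_W[OF valid_grid_step] by blast
qed

text \<open>Frequency 1 is enough, because any other frequency, and any linear combination of
  integrals, can be absorbed into \<open>g\<close> by linearity.\<close>

lemma char_has_stoch_integral:
  assumes g: "continuous_on {0..1} g" and X: "has_stoch_integral M W g X"
  shows "(CLINT \<omega>|M. iexp (X \<omega>)) = complex_of_real (exp (- (\<integral>x. (g x)\<^sup>2 \<partial>unit_measure) / 2))"
proof (rule LIMSEQ_unique)
  show "(\<lambda>m. CLINT \<omega>|M. iexp (step_integral W (grid_step g m) \<omega>)) \<longlonglongrightarrow> (CLINT \<omega>|M. iexp (X \<omega>))"
    by (intro char_tendsto_of_L2 square_integrable_W valid_grid_step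
        has_stoch_integral_square_integrable[OF g X] has_stoch_integral_grid[OF g X])
  show "(\<lambda>m. CLINT \<omega>|M. iexp (step_integral W (grid_step g m) \<omega>)) \<longlonglongrightarrow>
      complex_of_real (exp (- (\<integral>x. (g x)\<^sup>2 \<partial>unit_measure) / 2))"
    unfolding char_step_integral_grid
    by (intro tendsto_of_real tendsto_exp tendsto_divide tendsto_minus tendsto_const
        L2_tendsto_integral_square square_integrable_step_fun continuous_on_unit_bounded[OF g] grid_step_tendsto[OF g]) auto
qed

lemma has_stoch_integral_zero: "has_stoch_integral M W (\<lambda>x. 0) (\<lambda>\<omega>. 0)"
proof -
  have "L2_dist_sq unit_measure (\<lambda>x. 0) (step_fun []) = 0" "L2_dist_sq M (\<lambda>\<omega>. 0) (step_integral W []) = 0"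
    by (simp_all add: L2_dist_sq_def)
  then show ?thesis
    unfolding has_stoch_integral_iff by (intro conjI exI[of _ "\<lambda>m. []"]) auto
qed

lemma has_stoch_integral_scale_add:
  assumes X: "has_stoch_integral M W g X" "g \<in> borel_measurable unit_measure"
    and Y: "has_stoch_integral M W h Y" "h \<in> borel_measurable unit_measure"
  shows "has_stoch_integral M W (\<lambda>x. c * g x + h x) (\<lambda>\<omega>. c * X \<omega> + Y \<omega>)"
proof -
  obtain S where S: "\<And>m. valid_step (S m)" "(\<lambda>m. L2_dist_sq unit_measure g (step_fun (S m))) \<longlonglongrightarrow> 0"
    "(\<lambda>m. L2_dist_sq M X (step_integral W (S m))) \<longlonglongrightarrow> 0" and Xm: "X \<in> borel_measurable M"
    using X unfolding has_stoch_integral_iff by blast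
  obtain T where T: "\<And>m. valid_step (T m)" "(\<lambda>m. L2_dist_sq unit_measure h (step_fun (T m))) \<longlonglongrightarrow> 0"
    "(\<lambda>m. L2_dist_sq M Y (step_integral W (T m))) \<longlonglongrightarrow> 0" and Ym: "Y \<in> borel_measurable M"
    using Y unfolding has_stoch_integral_iff by blast
  let ?R = "\<lambda>m. scale_step c (S m) @ T m"
  \<comment> \<open>Stated for a general measure because it serves twice: for the integrands on
    \<open>unit_measure\<close> and for the integrals on \<open>M\<close>.\<close>
  have conv: "(\<lambda>m. L2_dist_sq N (\<lambda>x. c * f x + f' x) (\<lambda>x. c * u m x + u' m x)) \<longlonglongrightarrow> 0"
    if [measurable]: "f \<in> borel_measurable N" "f' \<in> borel_measurable N"
      "\<And>m. u m \<in> borel_measurable N" "\<And>m. u' m \<in> borel_measurable N"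
      and l: "(\<lambda>m. L2_dist_sq N f (u m)) \<longlonglongrightarrow> 0" "(\<lambda>m. L2_dist_sq N f' (u' m)) \<longlonglongrightarrow> 0"
    for N :: "'x measure" and f f' u u'
  proof (rule ennreal_tendsto_0_squeeze)
    fix m
    have "L2_dist_sq N (\<lambda>x. c * f x + f' x) (\<lambda>x. c * u m x + u' m x) \<le>
      2 * L2_dist_sq N (\<lambda>x. c * f x) (\<lambda>x. c * u m x) + 2 * L2_dist_sq N f' (u' m)"
      by (intro L2_dist_sq_add_le) measurable
    then show "L2_dist_sq N (\<lambda>x. c * f x + f' x) (\<lambda>x. c * u m x + u' m x) \<le>
      (2 * ennreal (c\<^sup>2)) * L2_dist_sq N f (u m) + 2 * L2_dist_sq N f' (u' m)"
      by (simp add: L2_dist_sq_scale mult.assoc)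
  next
    have "(\<lambda>m. (2 * ennreal (c\<^sup>2)) * L2_dist_sq N f (u m) + 2 * L2_dist_sq N f' (u' m)) \<longlonglongrightarrow> 0 + 0"
      by (intro tendsto_add ennreal_tendsto_cmult_0 l) (auto simp: ennreal_mult_less_top)
    then show "(\<lambda>m. (2 * ennreal (c\<^sup>2)) * L2_dist_sq N f (u m) + 2 * L2_dist_sq N f' (u' m)) \<longlonglongrightarrow> 0"
      by simp
  qed
  have sf: "step_fun (?R m) = (\<lambda>x. c * step_fun (S m) x + step_fun (T m) x)"
    "step_integral W (?R m) = (\<lambda>x. c * step_integral W (S m) x + step_integral W (T m) x)" for m
    by auto
  show ?thesis
    unfolding has_stoch_integral_iff
  proof (intro conjI exI[of _ ?R])
    show "(\<lambda>m. L2_dist_sq unit_measure (\<lambda>x. c * g x + h x) (step_fun (?R m))) \<longlonglongrightarrow> 0"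
      unfolding sf by (intro conv step_fun_measurable S T X Y)
    show "(\<lambda>m. L2_dist_sq M (\<lambda>\<omega>. c * X \<omega> + Y \<omega>) (step_integral W (?R m))) \<longlonglongrightarrow> 0"
      unfolding sf by (intro conv square_integrable_measurable[OF square_integrable_W] S T Xm Ym)
  qed (use S T Xm Ym in auto)
qed

lemma has_stoch_integral_sum:
  assumes "finite F" "\<And>k. k \<in> F \<Longrightarrow> has_stoch_integral M W (g k) (X k)"
    "\<And>k. k \<in> F \<Longrightarrow> g k \<in> borel_measurable unit_measure"
  shows "has_stoch_integral M W (\<lambda>x. \<Sum>k\<in>F. \<theta> k * g k x) (\<lambda>\<omega>. \<Sum>k\<in>F. \<theta> k * X k \<omega>)"
  using assms
proof (induction F rule: finite_induct)
  case empty
  then show ?case by (simp add: has_stoch_integral_zero)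
next
  case (insert k F)
  have "has_stoch_integral M W (\<lambda>x. \<theta> k * g k x + (\<Sum>k\<in>F. \<theta> k * g k x)) (\<lambda>\<omega>. \<theta> k * X k \<omega> + (\<Sum>k\<in>F. \<theta> k * X k \<omega>))"
    using insert by (intro has_stoch_integral_scale_add) auto
  then show ?case using insert by simp
qed

text \<open>A linear combination of the integrals is the integral of the combined function, whose
  squared norm is the sum of the squared coefficients by orthonormality. Hence the joint
  characteristic function factorises.\<close>

lemma orthonormal_stoch_integrals:
  assumes F: "finite F" and g: "\<And>k. k \<in> F \<Longrightarrow> continuous_on {0..1} (g k)"
    and X: "\<And>k. k \<in> F \<Longrightarrow> has_stoch_integral M W (g k) (X k)"
    and orth: "\<And>k l. k \<in> F \<Longrightarrow> l \<in> F \<Longrightarrow> (\<integral>x. g k x * g l x \<partial>unit_measure) = (if k = l then 1 else 0)"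
  shows "indep_vars (\<lambda>_. borel) X F" "\<And>k. k \<in> F \<Longrightarrow> distr M borel (X k) = std_normal_distribution"
proof -
  have Xm: "X k \<in> borel_measurable M" if "k \<in> F" for k
    using X[OF that] by (simp add: has_stoch_integral_def)
  have char: "(CLINT \<omega>|M. iexp (\<Sum>k\<in>G. \<theta> k * X k \<omega>)) = (\<Prod>k\<in>G. complex_of_real (exp (- (\<theta> k)\<^sup>2 / 2)))"
    if G: "G \<subseteq> F" for \<theta> G
  proof -
    have fin: "finite G" using G F finite_subset by blast
    have int: "integrable unit_measure (\<lambda>x. (\<theta> k * \<theta> l) * (g k x * g l x))" if "k \<in> G" "l \<in> G" for k l
      using that G g by (intro integrable_mult_right square_integrable_mult continuous_on_unit_bounded) auto
    have "(CLINT \<omega>|M. iexp (\<Sum>k\<in>G. \<theta> k * X k \<omega>)) =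
        complex_of_real (exp (- (\<integral>x. (\<Sum>k\<in>G. \<theta> k * g k x)\<^sup>2 \<partial>unit_measure) / 2))"
      using G g X fin
      by (intro char_has_stoch_integral has_stoch_integral_sum continuous_intros)
        (auto intro: borel_measurable_unit_measure_continuous)
    also have "(\<integral>x. (\<Sum>k\<in>G. \<theta> k * g k x)\<^sup>2 \<partial>unit_measure) =
        (\<integral>x. (\<Sum>k\<in>G. \<Sum>l\<in>G. (\<theta> k * \<theta> l) * (g k x * g l x)) \<partial>unit_measure)"
      by (intro Bochner_Integration.integral_cong refl) (simp add: power2_eq_square sum_product mult_ac)
    also have "\<dots> = (\<Sum>k\<in>G. \<integral>x. (\<Sum>l\<in>G. (\<theta> k * \<theta> l) * (g k x * g l x)) \<partial>unit_measure)"
      by (rule Bochner_Integration.integral_sum) (intro Bochner_Integration.integrable_sum int)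
    also have "\<dots> = (\<Sum>k\<in>G. \<Sum>l\<in>G. \<integral>x. (\<theta> k * \<theta> l) * (g k x * g l x) \<partial>unit_measure)"
      by (intro sum.cong refl Bochner_Integration.integral_sum int)
    also have "\<dots> = (\<Sum>k\<in>G. \<Sum>l\<in>G. (\<theta> k * \<theta> l) * (\<integral>x. g k x * g l x \<partial>unit_measure))"
      by simp
    also have "\<dots> = (\<Sum>k\<in>G. \<Sum>l\<in>G. if k = l then (\<theta> k)\<^sup>2 else 0)"
      using G by (intro sum.cong refl) (auto simp: orth subset_iff power2_eq_square)
    also have "\<dots> = (\<Sum>k\<in>G. (\<theta> k)\<^sup>2)" using fin by simp
    also have "complex_of_real (exp (- (\<Sum>k\<in>G. (\<theta> k)\<^sup>2) / 2)) = (\<Prod>k\<in>G. complex_of_real (exp (- (\<theta> k)\<^sup>2 / 2)))"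
      by (simp only: sum_negf[symmetric] sum_divide_distrib exp_sum[OF fin] of_real_prod)
    finally show ?thesis .
  qed
  have char1: "(CLINT \<omega>|M. iexp (t * X k \<omega>)) = complex_of_real (exp (- t\<^sup>2 / 2))" if "k \<in> F" for t k
    using char[of "{k}" "\<lambda>_. t"] that by simp
  show "indep_vars (\<lambda>_. borel) X F"
    by (rule indep_vars_of_char[OF F Xm], assumption, unfold char[OF order_refl])
      (intro prod.cong refl char1[symmetric])
  fix k assume k: "k \<in> F"
  show "distr M borel (X k) = std_normal_distribution"
  proof (rule Levy_uniqueness)
    show "real_distribution (distr M borel (X k))"
      using Xm[OF k] by (auto simp: real_distribution_def real_distribution_axioms_def intro: prob_space_distr)
    show "real_distribution std_normal_distribution" by (rule real_dist_normal_dist)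
    show "char (distr M borel (X k)) = char std_normal_distribution"
    proof
      fix t
      have "char (distr M borel (X k)) t = (CLINT \<omega>|M. iexp (t * X k \<omega>))"
        unfolding char_def using Xm[OF k] by (subst integral_distr) auto
      then show "char (distr M borel (X k)) t = char std_normal_distribution t"
        by (simp only: char1[OF k] char_std_normal_distribution)
    qed
  qed
qed

section \<open>Integrals against the observed process\<close>

lemma integral_upto_eq:
  assumes f: "square_integrable unit_measure f" and t: "t \<in> {0..1}"
  shows "(LINT u:{0..t}|lborel. f u) = (\<integral>x. indicator {0<..t} x * f x \<partial>unit_measure)"
proof -
  \<comment> \<open>\<open>f\<close> is known to be measurable on the unit interval only, so it is
    cut off before being integrated over the line.\<close>
  have [measurable]: "(\<lambda>x. indicator {0..1} x * f x) \<in> borel_measurable lborel"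
    using square_integrable_measurable[OF f] unfolding unit_measure_def
    by (subst (asm) borel_measurable_restrict_space_iff) (auto simp: mult.commute)
  have "(LINT u:{0..t}|lborel. f u) = (\<integral>x. indicator {0..t} x * (indicator {0..1} x * f x) \<partial>lborel)"
    unfolding set_lebesgue_integral_def using t
    by (intro Bochner_Integration.integral_cong refl) (auto simp: indicator_def)
  \<comment> \<open>The model integrates over the closed interval while step functions use left-open
    cells; the point 0 is a null set.\<close>
  also have "\<dots> = (\<integral>x. indicator {0<..t} x * (indicator {0..1} x * f x) \<partial>lborel)"
  proof (rule integral_cong_AE)
    have "AE x in lborel. x \<noteq> (0::real)" by (rule AE_lborel_singleton)
    then show "AE x in lborel. indicator {0..t} x * (indicator {0..1} x * f x) = indicator {0<..t} x * (indicator {0..1} x * f x)"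
      by eventually_elim (auto simp: indicator_def)
  qed measurable
  also have "\<dots> = (\<integral>x. indicator {0<..t} x * f x \<partial>unit_measure)"
    unfolding integral_unit_measure by (simp add: mult_ac)
  finally show ?thesis .
qed

lemma step_integral_white_noise:
  assumes f: "square_integrable unit_measure f" and S: "valid_step S"
  shows "step_integral (white_noise W n f) S \<omega> =
    (\<integral>x. step_fun S x * f x \<partial>unit_measure) + step_integral W S \<omega> / sqrt (real n)"
  using S
proof (induction S)
  case (Cons a S)
  obtain c u v where a: "a = (c, u, v)" by (cases a)
  have uv: "u \<in> {0..1}" "v \<in> {0..1}" "u \<le> v" and S: "valid_step S" using Cons.prems by (auto simp: a)
  have i: "integrable unit_measure (\<lambda>x. indicator {0<..t} x * f x)" for t
  proof (rule square_integrable_mult[OF unit_measure.square_integrable_bounded[where B = 1] f])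
    show "indicator {0<..t} \<in> borel_measurable unit_measure"
      by (rule borel_measurable_unit_measure) measurable
  qed (auto simp: indicator_def)
  have "(\<integral>x. step_fun (a # S) x * f x \<partial>unit_measure) =
     (\<integral>x. c * (indicator {0<..v} x * f x - indicator {0<..u} x * f x) + step_fun S x * f x \<partial>unit_measure)"
    using uv by (intro Bochner_Integration.integral_cong refl) (auto simp: a indicator_def algebra_simps)
  also have "\<dots> = c * ((LINT u:{0..v}|lborel. f u) - (LINT u:{0..u}|lborel. f u)) + (\<integral>x. step_fun S x * f x \<partial>unit_measure)"
    using uv i square_integrable_mult[OF square_integrable_step_fun f, of S] by (simp add: integral_upto_eq[OF f])
  finally show ?case using Cons.IH[OF S] by (simp add: a white_noise_def algebra_simps add_divide_distrib diff_divide_distrib)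
qed simp

text \<open>Both directions matter: one carries existence from \<open>W\<close> over to the observed
  process, so that the choice in \<open>stoch_integral\<close> has a witness; the other reads the
  chosen version back as an integral against \<open>W\<close>. Each is an affine change of the
  approximating sequences, in which the drift terms converge separately.\<close>

lemma has_stoch_integral_white_noise_iff:
  assumes f: "square_integrable unit_measure f" and g: "continuous_on {0..1} g" and n: "n > 0"
  shows "has_stoch_integral M (white_noise W n f) g X \<longleftrightarrow>
    has_stoch_integral M W g (\<lambda>\<omega>. sqrt (real n) * (X \<omega> - (\<integral>x. f x * g x \<partial>unit_measure)))"
proof -
  define r where "r = sqrt (real n)"
  have r: "r > 0" using n by (simp add: r_def)
  define c where "c = (\<integral>x. f x * g x \<partial>unit_measure)"
  let ?c = "\<lambda>S. \<integral>x. step_fun S x * f x \<partial>unit_measure"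
  have cc: "(\<lambda>m. L2_dist_sq M (\<lambda>\<omega>. a * c) (\<lambda>\<omega>. a * ?c (S m))) \<longlonglongrightarrow> 0"
    if "(\<lambda>m. L2_dist_sq unit_measure g (step_fun (S m))) \<longlonglongrightarrow> 0" for S a
  proof -
    have "(\<lambda>m. ?c (S m)) \<longlonglongrightarrow> c"
      using L2_tendsto_integral_mult[OF square_integrable_step_fun continuous_on_unit_bounded[OF g] f that]
      by (simp add: c_def mult.commute)
    then have "(\<lambda>m. ennreal ((a * c - a * ?c (S m))\<^sup>2)) \<longlonglongrightarrow> ennreal ((a * c - a * c)\<^sup>2)"
      by (intro tendsto_ennrealI tendsto_intros)
    then show ?thesis by (simp add: L2_dist_sq_def emeasure_space_1)
  qed
  have conv: "(\<lambda>m. L2_dist_sq M (\<lambda>\<omega>. a * U \<omega> + b * c) (\<lambda>\<omega>. a * V m \<omega> + b * ?c (S m))) \<longlonglongrightarrow> 0"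
    if [measurable]: "U \<in> borel_measurable M" "\<And>m. V m \<in> borel_measurable M"
      and S: "(\<lambda>m. L2_dist_sq unit_measure g (step_fun (S m))) \<longlonglongrightarrow> 0"
      and l: "(\<lambda>m. L2_dist_sq M U (V m)) \<longlonglongrightarrow> 0" for U V S a b
  proof (rule ennreal_tendsto_0_squeeze)
    fix m
    have "L2_dist_sq M (\<lambda>x. a * U x + b * c) (\<lambda>x. a * V m x + b * ?c (S m)) \<le>
      2 * L2_dist_sq M (\<lambda>x. a * U x) (\<lambda>x. a * V m x) + 2 * L2_dist_sq M (\<lambda>x. b * c) (\<lambda>x. b * ?c (S m))"
      by (intro L2_dist_sq_add_le) measurable
    then show "L2_dist_sq M (\<lambda>x. a * U x + b * c) (\<lambda>x. a * V m x + b * ?c (S m)) \<le>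
      (2 * ennreal (a\<^sup>2)) * L2_dist_sq M U (V m) + 2 * L2_dist_sq M (\<lambda>x. b * c) (\<lambda>x. b * ?c (S m))"
      by (simp add: L2_dist_sq_scale mult.assoc)
  next
    have "(\<lambda>m. (2 * ennreal (a\<^sup>2)) * L2_dist_sq M U (V m) + 2 * L2_dist_sq M (\<lambda>x. b * c) (\<lambda>x. b * ?c (S m))) \<longlonglongrightarrow> 0 + 0"
      by (intro tendsto_add ennreal_tendsto_cmult_0 l cc S) (auto simp: ennreal_mult_less_top)
    then show "(\<lambda>m. (2 * ennreal (a\<^sup>2)) * L2_dist_sq M U (V m) + 2 * L2_dist_sq M (\<lambda>x. b * c) (\<lambda>x. b * ?c (S m))) \<longlonglongrightarrow> 0"
      by simp
  qed
  have sw: "step_integral (white_noise W n f) (S m) = (\<lambda>\<omega>. (1/r) * step_integral W (S m) \<omega> + 1 * ?c (S m))"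
    "step_integral W (S m) = (\<lambda>\<omega>. r * step_integral (white_noise W n f) (S m) \<omega> + (-r) * ?c (S m))"
    if "valid_step (S m)" for S :: "nat \<Rightarrow> step" and m
    using step_integral_white_noise[OF f that, of n] r by (auto simp: fun_eq_iff r_def[symmetric] field_simps)
  have me: "step_integral W S \<in> borel_measurable M" "step_integral (white_noise W n f) S \<in> borel_measurable M" if "valid_step S" for S
  proof -
    show 1: "step_integral W S \<in> borel_measurable M" using that by (intro square_integrable_measurable square_integrable_W)
    show "step_integral (white_noise W n f) S \<in> borel_measurable M"
      using 1 unfolding sw(1)[of "\<lambda>_. S", OF that] by measurable
  qed
  show ?thesis
  proof
    assume X: "has_stoch_integral M (white_noise W n f) g X"
    then obtain S where S: "\<And>m. valid_step (S m)" "(\<lambda>m. L2_dist_sq unit_measure g (step_fun (S m))) \<longlonglongrightarrow> 0"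
      "(\<lambda>m. L2_dist_sq M X (step_integral (white_noise W n f) (S m))) \<longlonglongrightarrow> 0" and Xm: "X \<in> borel_measurable M"
      unfolding has_stoch_integral_iff by blast
    have "(\<lambda>m. L2_dist_sq M (\<lambda>\<omega>. r * X \<omega> + (-r) * c) (\<lambda>\<omega>. r * step_integral (white_noise W n f) (S m) \<omega> + (-r) * ?c (S m))) \<longlonglongrightarrow> 0"
      by (rule conv[OF Xm me(2)[OF S(1)] S(2,3)])
    moreover have "(\<lambda>\<omega>. r * X \<omega> + (-r) * c) = (\<lambda>\<omega>. r * (X \<omega> - c))" by (auto simp: algebra_simps)
    ultimately have "(\<lambda>m. L2_dist_sq M (\<lambda>\<omega>. r * (X \<omega> - c)) (step_integral W (S m))) \<longlonglongrightarrow> 0"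
      unfolding sw(2)[of S, OF S(1), symmetric] by simp
    then show "has_stoch_integral M W g (\<lambda>\<omega>. sqrt (real n) * (X \<omega> - (\<integral>x. f x * g x \<partial>unit_measure)))"
      unfolding has_stoch_integral_iff c_def[symmetric] r_def[symmetric] using S(1,2) Xm by (intro conjI exI[of _ S]) auto
  next
    assume "has_stoch_integral M W g (\<lambda>\<omega>. sqrt (real n) * (X \<omega> - (\<integral>x. f x * g x \<partial>unit_measure)))"
    then obtain S where S: "\<And>m. valid_step (S m)" "(\<lambda>m. L2_dist_sq unit_measure g (step_fun (S m))) \<longlonglongrightarrow> 0"
      "(\<lambda>m. L2_dist_sq M (\<lambda>\<omega>. r * (X \<omega> - c)) (step_integral W (S m))) \<longlonglongrightarrow> 0"
      and Xm: "(\<lambda>\<omega>. r * (X \<omega> - c)) \<in> borel_measurable M"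
      unfolding has_stoch_integral_iff c_def[symmetric] r_def[symmetric] by blast
    have eq: "X = (\<lambda>\<omega>. (1/r) * (r * (X \<omega> - c)) + 1 * c)" using r by (auto simp: fun_eq_iff)
    have "(\<lambda>\<omega>. (1/r) * (r * (X \<omega> - c)) + 1 * c) \<in> borel_measurable M" using Xm by measurable
    then have Xm': "X \<in> borel_measurable M" unfolding eq[symmetric] .
    have "(\<lambda>m. L2_dist_sq M (\<lambda>\<omega>. (1/r) * (r * (X \<omega> - c)) + 1 * c) (\<lambda>\<omega>. (1/r) * step_integral W (S m) \<omega> + 1 * ?c (S m))) \<longlonglongrightarrow> 0"
      by (rule conv[OF Xm me(1)[OF S(1)] S(2,3)])
    then have "(\<lambda>m. L2_dist_sq M X (step_integral (white_noise W n f) (S m))) \<longlonglongrightarrow> 0"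
      unfolding sw(1)[of S, OF S(1), symmetric] eq[symmetric] .
    then show "has_stoch_integral M (white_noise W n f) g X"
      unfolding has_stoch_integral_iff using S(1,2) Xm' by (intro conjI exI[of _ S]) auto
  qed
qed

lemma stoch_integral_white_noise:
  assumes f: "square_integrable unit_measure f" and g: "continuous_on {0..1} g" and n: "n > 0"
  shows "has_stoch_integral M W g (\<lambda>\<omega>. sqrt (real n) *
    (stoch_integral M (white_noise W n f) g \<omega> - (\<integral>x. f x * g x \<partial>unit_measure)))"
proof -
  obtain X where X: "has_stoch_integral M W g X" using has_stoch_integral_exists[OF g] by blast
  let ?c = "\<integral>x. f x * g x \<partial>unit_measure"
  have "X = (\<lambda>\<omega>. sqrt (real n) * ((X \<omega> / sqrt (real n) + ?c) - ?c))" using n by auto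
  then have "has_stoch_integral M (white_noise W n f) g (\<lambda>\<omega>. X \<omega> / sqrt (real n) + ?c)"
    unfolding has_stoch_integral_white_noise_iff[OF assms] using X by simp
  then have "has_stoch_integral M (white_noise W n f) g (stoch_integral M (white_noise W n f) g)"
    unfolding stoch_integral_def by (rule someI[of "has_stoch_integral M (white_noise W n f) g"])
  then show ?thesis using has_stoch_integral_white_noise_iff[OF assms] by blast
qed

end

subsection \<open>Truncation on a single resolution level\<close>

text \<open>Convexity of powers. The induction step is Chebyshev's observation that x^p - y^p and x
  - y have the same sign.\<close>

lemma power_add_le_power:
  fixes x y :: real
  assumes "0 \<le> x" "0 \<le> y"
  shows "(x + y) ^ Suc p \<le> 2 ^ p * (x ^ Suc p + y ^ Suc p)"
proof (induction p)
  case (Suc p)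
  have "(x ^ Suc p - y ^ Suc p) * (x - y) \<ge> 0"
  proof (cases "x \<le> y")
    case True
    then have "x ^ Suc p \<le> y ^ Suc p" using assms by (intro power_mono)
    then show ?thesis using True by (intro mult_nonpos_nonpos) auto
  next
    case False
    then have "y ^ Suc p \<le> x ^ Suc p" using assms by (intro power_mono) auto
    then show ?thesis using False by (intro mult_nonneg_nonneg) auto
  qed
  then have *: "(x ^ Suc p + y ^ Suc p) * (x + y) \<le> 2 * (x ^ Suc (Suc p) + y ^ Suc (Suc p))"
    by (simp add: algebra_simps)
  have "(x + y) ^ Suc (Suc p) = (x + y) ^ Suc p * (x + y)" by simp
  also have "\<dots> \<le> 2 ^ p * (x ^ Suc p + y ^ Suc p) * (x + y)"
    using Suc.IH assms by (intro mult_right_mono) auto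
  also have "\<dots> = 2 ^ p * ((x ^ Suc p + y ^ Suc p) * (x + y))" by (rule mult.assoc)
  also have "\<dots> \<le> 2 ^ p * (2 * (x ^ Suc (Suc p) + y ^ Suc (Suc p)))"
    using * by (intro mult_left_mono) auto
  also have "\<dots> = 2 ^ Suc p * (x ^ Suc (Suc p) + y ^ Suc (Suc p))"
    by (simp only: power_Suc mult.assoc mult.left_commute)
  finally show ?case .
qed simp

lemma power_add_le_power':
  fixes x y :: real
  assumes "0 \<le> x" "0 \<le> y" "p > 0"
  shows "2 * (x + y) ^ p \<le> 2 ^ p * (x ^ p + y ^ p)"
proof -
  obtain q where "p = Suc q" using assms(3) by (cases p) auto
  then show ?thesis using power_add_le_power[OF assms(1,2), of q] by (simp add: mult.assoc)
qed

lemma L_min_attained: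
  assumes "D_sets I n y j p \<noteq> {}"
  obtains S where "S \<in> D_sets I n y j p" "L_min I n y j p = of_nat (card S)"
    "\<And>S'. S' \<in> D_sets I n y j p \<Longrightarrow> card S \<le> card S'"
proof -
  obtain S0 where "S0 \<in> D_sets I n y j p" using assms by blast
  then obtain S where S: "S \<in> D_sets I n y j p" "\<And>S'. S' \<in> D_sets I n y j p \<Longrightarrow> card S \<le> card S'"
    using ex_has_least_nat[of "\<lambda>S. S \<in> D_sets I n y j p" S0 card] by blast
  moreover have "L_min I n y j p = of_nat (card S)"
    unfolding L_min_def
    using S by (intro antisym INF_lower2[OF S(1)] INF_greatest) auto
  ultimately show ?thesis using that by blast
qed

text \<open>The size that the \<open>p\<close>-th power sum of the noise on the level exceeds only
  with tiny probability. Membership in \<open>D_sets\<close> asks for 2^p times as much.\<close>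

definition noise_level :: "(int \<Rightarrow> int set) \<Rightarrow> nat \<Rightarrow> int \<Rightarrow> nat \<Rightarrow> real" where
  "noise_level I n j p = K_const p * real n powr (- (real p / 2)) * real (card (I j))"

lemma K_const_pos: "p > 0 \<Longrightarrow> K_const p > 0"
  unfolding K_const_def by (intro mult_pos_pos) (auto intro!: add_nonneg_pos)

text \<open>The data \<open>y\<close> are an arbitrary array: truncation is analysed
  deterministically and applied path by path later.\<close>

locale resolution_level =
  fixes I :: "int \<Rightarrow> int set" and n :: nat and y :: "int \<Rightarrow> int \<Rightarrow> real" and j :: int
  assumes fin: "finite (I j)" and card: "card (I j) > 0" and n: "n > 0"
begin

lemma noise_level_pos: "p > 0 \<Longrightarrow> noise_level I n j p > 0"
  using card n K_const_pos[of p] by (simp add: noise_level_def)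

lemma D_sets_iff:
  "S \<in> D_sets I n y j p \<longleftrightarrow> S \<subseteq> I j \<and> 2 ^ p * noise_level I n j p \<le> (\<Sum>k\<in>S. \<bar>y j k\<bar> ^ p)"
  by (simp add: D_sets_def noise_level_def mult.assoc)

text \<open>The three cases are a minimal cardinality of 1 (convention 1/0), an empty family
  (convention 1/\<infinity>) and a minimal cardinality of at least 2. In the last, the equation for
  \<open>t\<close> says that one element fewer than the minimum, each of size \<open>t\<close>,
  already carries the critical mass.\<close>

lemma threshold_p_cases:
  assumes p: "p > 0"
  obtains (top) S where "threshold_p I n y j p = \<top>" "S \<in> D_sets I n y j p" "card S = 1"
  | (zero) "threshold_p I n y j p = ennreal 0" "D_sets I n y j p = {}"
  | (pos) t S where "threshold_p I n y j p = ennreal t" "t \<ge> 0" "S \<in> D_sets I n y j p" "card S \<ge> 2"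
      "\<And>S'. S' \<in> D_sets I n y j p \<Longrightarrow> card S \<le> card S'"
      "t ^ p * (real (card S) - 1) = 2 ^ p * noise_level I n j p"
proof (cases "D_sets I n y j p = {}")
  case True
  then have "L_min I n y j p = \<top>" by (simp add: L_min_def)
  then have "threshold_p I n y j p = ennreal 0" using p by (simp add: threshold_p_def epowr_def)
  then show ?thesis using True that(2) by blast
next
  case False
  then obtain S where S: "S \<in> D_sets I n y j p" "L_min I n y j p = of_nat (card S)"
    "\<And>S'. S' \<in> D_sets I n y j p \<Longrightarrow> card S \<le> card S'"
    by (rule L_min_attained) blast
  have pos: "2 ^ p * noise_level I n j p > 0" using noise_level_pos[OF p] by simp
  have KN: "K_const p * real (card (I j)) > 0" using K_const_pos[OF p] card by simp
  \<comment> \<open>The required mass is positive, which rules out a minimal cardinality of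
    0.\<close>
  have "S \<noteq> {}" using S(1) pos by (auto simp: D_sets_iff)
  moreover have "finite S" using S(1) fin finite_subset by (auto simp: D_sets_iff)
  ultimately have "card S \<ge> 1" by (simp add: Suc_le_eq card_gt_0_iff)
  show ?thesis
  proof (cases "card S = 1")
    case True
    have "L_min I n y j p - 1 = 0" using S True by simp
    then have "ennreal (K_const p * real (card (I j))) / (L_min I n y j p - 1) = \<top>"
      using KN card by (auto simp: ennreal_divide_eq_top_iff)
    then have "threshold_p I n y j p = \<top>"
      using n unfolding threshold_p_def by (simp add: epowr_def ennreal_mult_eq_top_iff)
    then show ?thesis using that(1) S True by blast
  next
    case False
    then have m: "card S \<ge> 2" using \<open>card S \<ge> 1\<close> by simp
    define r where "r = real (card S) - 1"
    have r: "r > 0" using m by (simp add: r_def)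
    have "L_min I n y j p - 1 = ennreal r"
      using m unfolding S(2) r_def by (simp add: ennreal_of_nat_eq_real_of_nat ennreal_minus flip: ennreal_1)
    then have "ennreal (K_const p * real (card (I j))) / (L_min I n y j p - 1) = ennreal (K_const p * real (card (I j)) / r)"
      using r KN by (simp add: divide_ennreal)
    then have thr: "threshold_p I n y j p = ennreal (2 / sqrt (real n) * (K_const p * real (card (I j)) / r) powr (1 / real p))"
      using KN r unfolding threshold_p_def epowr_def by (simp add: ennreal_mult'[symmetric])
    have pw: "(x powr a) ^ p = x powr (a * real p)" if "x > 0" for x a :: real
      using that by (subst powr_realpow[symmetric]) (auto simp: powr_powr)
    have "K_const p * real (card (I j)) / r > 0" using KN r by simp
    then have root: "((K_const p * real (card (I j)) / r) powr (1 / real p)) ^ p = K_const p * real (card (I j)) / r"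
      using p by (subst pw) (simp_all add: abs_of_pos del: abs_divide)
    have "(2 / sqrt (real n) * (K_const p * real (card (I j)) / r) powr (1 / real p)) ^ p =
        2 ^ p * (1 / sqrt (real n)) ^ p * (K_const p * real (card (I j)) / r)"
      by (simp only: power_mult_distrib power_divide root) simp
    also have "(1 / sqrt (real n)) ^ p = real n powr (- (real p / 2))"
      using n pw[of "real n" "1/2"] by (simp add: powr_half_sqrt powr_minus_divide power_divide)
    finally have "(2 / sqrt (real n) * (K_const p * real (card (I j)) / r) powr (1 / real p)) ^ p * r = 2 ^ p * noise_level I n j p"
      using r by (simp add: noise_level_def)
    then show ?thesis using that(3)[OF thr _ S(1) m S(3)] by (simp add: r_def)
  qed
qed

text \<open>Minimality: were the mass above the threshold larger, the set of these indices would
  belong to \<open>D_sets\<close> and thus have at least the minimal cardinality L. Already L - 1 of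
  its elements, each exceeding \<open>t\<close>, would then carry the critical mass. This is the
  purpose of the \<open>- 1\<close> in the threshold.\<close>

lemma sum_above_threshold_p:
  assumes p: "p > 0"
  shows "(\<Sum>k | k \<in> I j \<and> threshold_p I n y j p < ennreal \<bar>y j k\<bar>. \<bar>y j k\<bar> ^ p) \<le> 2 ^ p * noise_level I n j p"
    (is "sum _ ?H \<le> _")
  using p
proof (cases rule: threshold_p_cases)
  case (top S)
  then have "?H = {}" by simp
  then show ?thesis using noise_level_pos[OF p] by (simp only: sum.empty) simp
next
  case zero
  moreover have "?H \<subseteq> I j" by blast
  ultimately have "\<not> 2 ^ p * noise_level I n j p \<le> (\<Sum>k\<in>?H. \<bar>y j k\<bar> ^ p)"
    using D_sets_iff[of ?H p] by blast
  then show ?thesis by linarith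
next
  case (pos t S)
  show ?thesis
  proof (rule ccontr)
    assume *: "\<not> ?thesis"
    then have "2 ^ p * noise_level I n j p \<le> (\<Sum>k\<in>?H. \<bar>y j k\<bar> ^ p)" by linarith
    moreover have "?H \<subseteq> I j" by blast
    ultimately have "?H \<in> D_sets I n y j p" using D_sets_iff[of ?H p] by blast
    from pos(5)[OF this] have "card S - 1 \<le> card ?H" by linarith
    \<comment> \<open>\<open>H'\<close> is the smaller member of \<open>D_sets\<close> that
      contradicts minimality.\<close>
    then obtain H' where H': "H' \<subseteq> ?H" "card H' = card S - 1" "finite H'"
      by (rule obtain_subset_with_card_n)
    have "2 ^ p * noise_level I n j p = (\<Sum>k\<in>H'. t ^ p)"
      using H' pos(4) pos(6) by (simp add: of_nat_diff mult.commute)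
    also have "\<dots> \<le> (\<Sum>k\<in>H'. \<bar>y j k\<bar> ^ p)"
    proof (intro sum_mono power_mono pos(2))
      fix k assume "k \<in> H'"
      then have "ennreal t < ennreal \<bar>y j k\<bar>" using H' pos(1) by auto
      then show "t \<le> \<bar>y j k\<bar>" using pos(2) by (simp add: ennreal_less_iff)
    qed
    finally have "2 ^ p * noise_level I n j p \<le> (\<Sum>k\<in>H'. \<bar>y j k\<bar> ^ p)" .
    moreover have "H' \<subseteq> I j" using H'(1) by blast
    ultimately have "H' \<in> D_sets I n y j p" using D_sets_iff[of H' p] by blast
    then show False using pos(5)[of H'] H' pos(4) by simp
  qed
qed

text \<open>A set in \<open>D_sets\<close> carries mass at least 2^p V, where V is the noise level.
  By convexity the noise accounts for at most half of it, so the signal must supply the rest: V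
  \<le> card S times B^p. Few large coefficients are then impossible, and a large minimal
  cardinality means a small threshold.\<close>

lemma threshold_p_le:
  assumes p: "p > 0" and z: "(\<Sum>k\<in>I j. \<bar>y j k - d k\<bar> ^ p) \<le> noise_level I n j p"
    and d: "\<And>k. k \<in> I j \<Longrightarrow> \<bar>d k\<bar> \<le> B" and B: "0 \<le> B" "B ^ p < noise_level I n j p"
  shows "threshold_p I n y j p \<le> ennreal (4 * B)"
proof -
  let ?V = "noise_level I n j p"
  have key: "?V \<le> real (card S) * B ^ p" if "S \<in> D_sets I n y j p" for S
  proof -
    have S: "S \<subseteq> I j" "2 ^ p * ?V \<le> (\<Sum>k\<in>S. \<bar>y j k\<bar> ^ p)" using that by (auto simp: D_sets_iff)
    have "2 * (2 ^ p * ?V) \<le> 2 * (\<Sum>k\<in>S. \<bar>y j k\<bar> ^ p)" using S by simp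
    also have "\<dots> \<le> (\<Sum>k\<in>S. 2 ^ p * (B ^ p + \<bar>y j k - d k\<bar> ^ p))"
      unfolding sum_distrib_left
    proof (rule sum_mono)
      fix k assume "k \<in> S"
      then have "\<bar>y j k\<bar> \<le> B + \<bar>y j k - d k\<bar>" using d[of k] S(1) by (auto simp: abs_if split: if_splits)
      then have "2 * \<bar>y j k\<bar> ^ p \<le> 2 * (B + \<bar>y j k - d k\<bar>) ^ p" by (simp add: power_mono)
      also have "\<dots> \<le> 2 ^ p * (B ^ p + \<bar>y j k - d k\<bar> ^ p)"
        using B p by (intro power_add_le_power') auto
      finally show "2 * \<bar>y j k\<bar> ^ p \<le> 2 ^ p * (B ^ p + \<bar>y j k - d k\<bar> ^ p)" .
    qed
    also have "\<dots> = 2 ^ p * (real (card S) * B ^ p + (\<Sum>k\<in>S. \<bar>y j k - d k\<bar> ^ p))"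
      by (simp add: sum.distrib flip: sum_distrib_left)
    also have "(\<Sum>k\<in>S. \<bar>y j k - d k\<bar> ^ p) \<le> (\<Sum>k\<in>I j. \<bar>y j k - d k\<bar> ^ p)"
      using S fin by (intro sum_mono2) auto
    finally have "2 ^ p * (2 * ?V) \<le> 2 ^ p * (real (card S) * B ^ p + ?V)"
      using z by (simp add: mult.left_commute)
    then show ?thesis by simp
  qed
  from p show ?thesis
  proof (cases rule: threshold_p_cases)
    case (top S)
    \<comment> \<open>An infinite threshold would come from a single index carrying the mass, giving
      V \<le> B^p against the assumption.\<close>
    then show ?thesis using key[of S] B by simp
  next
    case zero
    then show ?thesis using B by simp
  next
    case (pos t S)
    let ?m = "real (card S)"
    \<comment> \<open>Replacing \<open>?m\<close> by \<open>?m - 1\<close> costs a factor 2 \<le>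
      2^p; together with the 2^p of the threshold this produces the 4 in 4B.\<close>
    have m: "?m - 1 > 0" "?m \<le> 2 * (?m - 1)" using pos(4) by auto
    have "t ^ p * (?m - 1) = 2 ^ p * ?V" by (rule pos)
    also have "\<dots> \<le> 2 ^ p * (?m * B ^ p)" using key[OF pos(3)] by simp
    also have "\<dots> \<le> 2 ^ p * ((2 * (?m - 1)) * B ^ p)"
      using m B by (intro mult_left_mono mult_right_mono) auto
    also have "\<dots> \<le> 2 ^ p * ((2 ^ p * (?m - 1)) * B ^ p)"
      using m B p self_le_power[of "2::real" p] by (intro mult_left_mono mult_right_mono) auto
    also have "\<dots> = (4 * B) ^ p * (?m - 1)"
    proof -
      have "(4::real) ^ p = 2 ^ p * 2 ^ p" by (simp flip: power_mult_distrib)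
      then show ?thesis by (simp add: power_mult_distrib)
    qed
    finally have "t ^ p \<le> (4 * B) ^ p" using m by simp
    then have "t \<le> 4 * B" using p B pos(2) by (subst (asm) power_mono_iff) auto
    then show ?thesis using pos(1) by (simp add: ennreal_leI)
  qed
qed

lemma truncated_coeff_eq:
  "ennreal \<bar>y j k\<bar> \<le> threshold I n y j \<Longrightarrow> truncated_coeff I n y j k = y j k"
  by (simp add: truncated_coeff_def min_absorb1 sgn_mult_abs)

lemma truncated_coeff_diff_le: "\<bar>truncated_coeff I n y j k - y j k\<bar> \<le> \<bar>y j k\<bar>"
proof -
  define m where "m = enn2real (min (ennreal \<bar>y j k\<bar>) (threshold I n y j))"
  have "m \<le> enn2real (ennreal \<bar>y j k\<bar>)"
    unfolding m_def by (rule enn2real_mono) auto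
  then have "0 \<le> m" "m \<le> \<bar>y j k\<bar>" by (auto simp: m_def)
  then show ?thesis
    unfolding truncated_coeff_def m_def[symmetric]
    by (auto simp: sgn_if abs_if)
qed

lemma truncated_coeff_le:
  assumes "threshold I n y j \<le> ennreal t" "0 \<le> t"
  shows "\<bar>truncated_coeff I n y j k\<bar> \<le> t"
proof -
  have "enn2real (min (ennreal \<bar>y j k\<bar>) (threshold I n y j)) \<le> enn2real (ennreal t)"
    using assms by (intro enn2real_mono min.coboundedI2) auto
  then have "enn2real (min (ennreal \<bar>y j k\<bar>) (threshold I n y j)) \<le> t" using assms by simp
  then show ?thesis using assms(2) by (auto simp: truncated_coeff_def abs_mult abs_sgn_eq)
qed

lemma exponents_pos: "p \<in> exponents n \<Longrightarrow> p > 0"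
  by (auto simp: exponents_def)

text \<open>Beyond the noise, truncation errs only at indices above the threshold, there by at most
  |y|, and the mass of those indices is limited by \<open>sum_above_threshold_p\<close>. As the
  threshold is the largest of the \<open>threshold_p\<close>, this works for every exponent
  simultaneously.\<close>

lemma truncation_error_power_sum:
  assumes p: "p \<in> exponents n" and z: "(\<Sum>k\<in>I j. \<bar>y j k - d k\<bar> ^ p) \<le> noise_level I n j p"
  shows "(\<Sum>k\<in>I j. \<bar>truncated_coeff I n y j k - d k\<bar> ^ p) \<le> 4 ^ p * noise_level I n j p"
proof -
  let ?V = "noise_level I n j p"
  have p0: "p > 0" using p by (rule exponents_pos)
  have V: "?V > 0" using noise_level_pos[OF p0] .
  let ?H = "{k. k \<in> I j \<and> threshold_p I n y j p < ennreal \<bar>y j k\<bar>}"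
  let ?i = "\<lambda>k. if k \<in> ?H then \<bar>y j k\<bar> else 0"
  have le: "\<bar>truncated_coeff I n y j k - d k\<bar> \<le> \<bar>y j k - d k\<bar> + ?i k" if "k \<in> I j" for k
  proof (cases "ennreal \<bar>y j k\<bar> \<le> threshold I n y j")
    case True
    then show ?thesis by (simp add: truncated_coeff_eq)
  next
    case False
    \<comment> \<open>Covers the infinite threshold of the first case of the definition as
      well.\<close>
    have "threshold_p I n y j p \<le> threshold I n y j"
      using p by (auto simp: threshold_def intro: SUP_upper)
    then have "k \<in> ?H" using False that by auto
    then show ?thesis using truncated_coeff_diff_le[of k] by auto
  qed
  have "2 * (\<Sum>k\<in>I j. \<bar>truncated_coeff I n y j k - d k\<bar> ^ p) \<le> (\<Sum>k\<in>I j. 2 ^ p * (\<bar>y j k - d k\<bar> ^ p + ?i k ^ p))"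
    unfolding sum_distrib_left
  proof (rule sum_mono)
    fix k assume k: "k \<in> I j"
    have "2 * \<bar>truncated_coeff I n y j k - d k\<bar> ^ p \<le> 2 * (\<bar>y j k - d k\<bar> + ?i k) ^ p"
      using le[OF k] by (intro mult_left_mono power_mono) auto
    also have "\<dots> \<le> 2 ^ p * (\<bar>y j k - d k\<bar> ^ p + ?i k ^ p)"
      using p0 by (intro power_add_le_power') auto
    finally show "2 * \<bar>truncated_coeff I n y j k - d k\<bar> ^ p \<le> 2 ^ p * (\<bar>y j k - d k\<bar> ^ p + ?i k ^ p)" .
  qed
  also have "\<dots> = 2 ^ p * ((\<Sum>k\<in>I j. \<bar>y j k - d k\<bar> ^ p) + (\<Sum>k\<in>I j. ?i k ^ p))"
    by (simp only: sum.distrib[symmetric] sum_distrib_left)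
  also have "(\<Sum>k\<in>I j. ?i k ^ p) = (\<Sum>k\<in>?H. \<bar>y j k\<bar> ^ p)"
    using fin p0 by (intro sum.mono_neutral_cong_right) auto
  also have "2 ^ p * ((\<Sum>k\<in>I j. \<bar>y j k - d k\<bar> ^ p) + (\<Sum>k\<in>?H. \<bar>y j k\<bar> ^ p)) \<le> 2 ^ p * (?V + 2 ^ p * ?V)"
    using z sum_above_threshold_p[OF p0] by (intro mult_left_mono add_mono) auto
  also have "\<dots> \<le> 2 ^ p * (2 ^ p * ?V + 2 ^ p * ?V)"
    using V by (intro mult_left_mono add_right_mono) auto
  also have "\<dots> = 2 * (4 ^ p * ?V)"
  proof -
    have "(4::real) ^ p = 2 ^ p * 2 ^ p" by (simp flip: power_mult_distrib)
    then show ?thesis by simp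
  qed
  finally show ?thesis by simp
qed

text \<open>Either the maximum test fires and nothing is truncated, or every |y| is at most 3
  sqrt(log n / n), which then bounds what truncation can remove.\<close>

lemma truncation_error_sup:
  assumes k: "k \<in> I j"
  shows "\<bar>truncated_coeff I n y j k - d k\<bar> \<le> \<bar>y j k - d k\<bar> + 3 * sqrt (ln (real n) / real n)"
proof (cases "(MAX k\<in>I j. \<bar>y j k\<bar>) > 3 * sqrt (ln (real n) / real n)")
  case True
  then have "truncated_coeff I n y j k = y j k"
    by (intro truncated_coeff_eq) (simp add: threshold_def)
  moreover have "0 \<le> 3 * sqrt (ln (real n) / real n)" using n by (cases "n = 1") auto
  ultimately show ?thesis by simp
next
  case False
  have "\<bar>y j k\<bar> \<le> (MAX k\<in>I j. \<bar>y j k\<bar>)" using fin k by (intro Max_ge) auto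
  then have "\<bar>y j k\<bar> \<le> 3 * sqrt (ln (real n) / real n)" using False by linarith
  then show ?thesis using truncated_coeff_diff_le[of k] by linarith
qed

text \<open>By \<open>aB\<close> the maximum test cannot fire, so the threshold is the supremum of
  the \<open>threshold_p\<close>, all at most 4B; the signal itself adds one more B.\<close>

lemma truncation_error_signal:
  assumes z: "\<And>p. p \<in> exponents n \<Longrightarrow> (\<Sum>k\<in>I j. \<bar>y j k - d k\<bar> ^ p) \<le> noise_level I n j p"
    and zb: "\<And>k. k \<in> I j \<Longrightarrow> \<bar>y j k - d k\<bar> \<le> a" and aB: "a + B \<le> 3 * sqrt (ln (real n) / real n)"
    and d: "\<And>k. k \<in> I j \<Longrightarrow> \<bar>d k\<bar> \<le> B" and B: "\<And>p. p \<in> exponents n \<Longrightarrow> B ^ p < noise_level I n j p"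
    and k: "k \<in> I j"
  shows "\<bar>truncated_coeff I n y j k - d k\<bar> \<le> 5 * B"
proof -
  have B0: "0 \<le> B" using d[OF k] by linarith
  have "(MAX k\<in>I j. \<bar>y j k\<bar>) \<le> 3 * sqrt (ln (real n) / real n)"
  proof (subst Max_le_iff)
    show "\<forall>x\<in>(\<lambda>k. \<bar>y j k\<bar>) ` I j. x \<le> 3 * sqrt (ln (real n) / real n)"
    proof clarify
      fix k assume "k \<in> I j"
      with zb[of k] d[of k] aB show "\<bar>y j k\<bar> \<le> 3 * sqrt (ln (real n) / real n)" by linarith
    qed
  qed (use fin k in auto)
  then have "threshold I n y j = (SUP p\<in>exponents n. threshold_p I n y j p)"
    by (simp add: threshold_def)
  also have "\<dots> \<le> ennreal (4 * B)"
    using threshold_p_le[OF exponents_pos z d B0 B] by (intro SUP_least) auto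
  finally have "\<bar>truncated_coeff I n y j k\<bar> \<le> 4 * B" using B0 by (intro truncated_coeff_le) auto
  then show ?thesis using d[OF k] by linarith
qed

end

text \<open>Hoeffding's inequality needs bounded summands, hence the clipping at \<open>H\<close>.
  The clipped mean is at most p^(p/2) by the moment bound, and \<open>K_const\<close> is at least
  twice that, so exceeding it is a deviation of at least p^(p/2) per summand.\<close>

lemma (in prob_space) clipped_moment_tail:
  assumes A: "finite A" "A \<noteq> {}" and ind: "indep_vars (\<lambda>_. borel) Z A"
    and Z: "\<And>k. k \<in> A \<Longrightarrow> distr M borel (Z k) = std_normal_distribution"
    and p: "p = 2 ^ r" and H: "H > 0"
  shows "prob {\<omega> \<in> space M. (\<Sum>k\<in>A. min (\<bar>Z k \<omega>\<bar> ^ p) H) > K_const p * real (card A)}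
    \<le> exp (- (2 * real (card A) * real p ^ p / H\<^sup>2))"
proof -
  have Zm: "Z k \<in> borel_measurable M" if "k \<in> A" for k
    using ind that unfolding indep_vars_def2 by blast
  have p0: "p > 0" using p by simp
  define q where "q = real p powr (real p / 2)"
  have q: "q > 0" "q\<^sup>2 = real p ^ p"
    using p0 by (auto simp: q_def power2_eq_square powr_realpow simp flip: powr_add)
  let ?X = "\<lambda>k \<omega>. min (\<bar>Z k \<omega>\<bar> ^ p) H"
  have indX: "indep_vars (\<lambda>_. borel) ?X A"
    using indep_vars_compose2[OF ind, of "\<lambda>k x. min (\<bar>x\<bar> ^ p) H" "\<lambda>_. borel"] by simp
  interpret Hoeffding_ineq M A ?X "\<lambda>_. 0" "\<lambda>_. H" "\<Sum>k\<in>A. expectation (?X k)"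
    by unfold_locales (use A indX H in auto)
  let ?\<mu> = "\<Sum>k\<in>A. expectation (?X k)"
  let ?N = "real (card A)"
  have N: "?N > 0" using A by (simp add: card_gt_0_iff)
  have "?\<mu> \<le> (\<Sum>k\<in>A. q)"
  proof (rule sum_mono)
    fix k assume k: "k \<in> A"
    note mom = std_normal_variable_abs_moment[OF prob_space_axioms Zm[OF k] Z[OF k] p]
    have "expectation (?X k) \<le> expectation (\<lambda>\<omega>. \<bar>Z k \<omega>\<bar> ^ p)"
    proof (rule integral_mono[OF _ mom(1)])
      show "integrable M (?X k)"
        using mom(1) Zm[OF k] H by (intro Bochner_Integration.integrable_bound[OF mom(1)]) auto
    qed simp
    then show "expectation (?X k) \<le> q" using mom(2) by (simp add: q_def)
  qed
  then have \<mu>: "?\<mu> \<le> ?N * q" by simp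
  have "sqrt 2 * exp 1 \<ge> (1::real)"
    using mult_mono[of 1 "sqrt 2" 1 "exp 1 :: real"] by simp
  then have "(6 * sqrt 2 * exp 1 + 1) * q \<ge> 2 * q"
    using q by (intro mult_right_mono) auto
  then have K: "K_const p \<ge> 2 * q" unfolding K_const_def q_def[symmetric] .
  define \<delta> where "\<delta> = K_const p * ?N - ?\<mu>"
  have "\<delta> \<ge> 2 * q * ?N - ?N * q" unfolding \<delta>_def using K \<mu> N by (intro diff_mono mult_right_mono) auto
  then have \<delta>: "\<delta> \<ge> ?N * q" by (simp add: algebra_simps)
  have \<delta>0: "\<delta> \<ge> 0" using \<delta> N q by (meson mult_nonneg_nonneg less_imp_le order_trans)
  have "prob {\<omega> \<in> space M. (\<Sum>k\<in>A. ?X k \<omega>) > K_const p * ?N} \<le> prob {\<omega> \<in> space M. (\<Sum>k\<in>A. ?X k \<omega>) \<ge> ?\<mu> + \<delta>}"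
    by (rule finite_measure_mono) (auto simp: \<delta>_def)
  also have "\<dots> \<le> exp (-2 * \<delta>\<^sup>2 / (\<Sum>k\<in>A. (H - 0)\<^sup>2))"
    by (rule Hoeffding_ineq_ge) (use \<delta>0 N H in auto)
  also have "\<dots> \<le> exp (- (2 * ?N * real p ^ p / H\<^sup>2))"
  proof -
    have "(?N * q)\<^sup>2 \<le> \<delta>\<^sup>2" using \<delta> N q by (intro power_mono) auto
    then have "?N * ?N * q\<^sup>2 \<le> \<delta>\<^sup>2" by (simp only: power2_eq_square mult_ac)
    then have "?N * ?N * real p ^ p \<le> \<delta>\<^sup>2" unfolding q(2) .
    then have "2 * ?N * real p ^ p / H\<^sup>2 \<le> 2 * \<delta>\<^sup>2 / (?N * H\<^sup>2)"
      using N H by (simp add: field_simps)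
    then show ?thesis using N by simp
  qed
  finally show ?thesis .
qed

subsection \<open>Wavelet coefficients\<close>

lemma regular_continuous:
  assumes "regular s g"
  shows "continuous_on A g"
proof -
  have "continuous_on UNIV g"
  proof (cases "s = 0")
    case True
    then show ?thesis using assms by (simp add: regular_def)
  next
    case False
    then have "\<forall>x. (deriv ^^ 0) g differentiable (at x)" using assms unfolding regular_def by blast
    then have "\<forall>x. isCont g x" by (auto intro: differentiable_imp_continuous_within)
    then show ?thesis by (simp add: continuous_on_eq_continuous_at)
  qed
  then show ?thesis by (rule continuous_on_subset) simp
qed

context interval_wavelet_basis
begin

text \<open>Continuity is what the grid approximation of stochastic integrals asks for. Edge
  functions inherit it from \<phi>, of which they are finite combinations.\<close>

lemma basis_continuous:
  assumes "-1 \<le> j" "k \<in> I j"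
  shows "continuous_on {0..1} (b j k)"
proof -
  have \<phi>: "continuous_on A (\<lambda>x. \<phi> (c * x - d))" "continuous_on A (\<lambda>x. \<psi> (c * x - d))" for A c d
    by (rule continuous_on_compose2[OF regular_continuous[OF regular_scaling, of UNIV]]
        continuous_on_compose2[OF regular_continuous[OF regular_wavelet, of UNIV]],
        intro continuous_intros, simp)+
  have w: "continuous_on {0..1} (wavelet \<phi> \<psi> j k)"
  proof (cases "j = -1")
    case True
    then show ?thesis using \<phi>(1)[of _ 1] by (simp add: wavelet_def[abs_def])
  next
    case False
    have "continuous_on {0..1} (\<lambda>x. 2 powr (of_int j / 2) * \<psi> (2 powr of_int j * x - of_int k))"
      by (rule continuous_on_mult[OF continuous_on_const \<phi>(2)])
    moreover have "wavelet \<phi> \<psi> j k = (\<lambda>x. 2 powr (of_int j / 2) * \<psi> (2 powr of_int j * x - of_int k))"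
      by (rule ext) (simp only: wavelet_def if_not_P[OF False])
    ultimately show ?thesis by (simp only:)
  qed
  obtain E where E: "\<forall>g\<in>E. \<exists>m. scaling_comb \<phi> m g" and all: "\<forall>j\<ge>-1. \<forall>k\<in>I j.
        (\<forall>x\<in>{0..1}. b j k x = wavelet \<phi> \<psi> j k x) \<or>
        (\<exists>g\<in>E. \<exists>a\<in>{0, 1}. \<forall>x\<in>{0..1}.
           b j k x = 2 powr (of_int (max j 0) / 2) * g (2 powr of_int (max j 0) * (x - a)))"
    using shape by (elim exE conjE)
  note cases = all[rule_format, OF assms]
  from cases show ?thesis
  proof
    assume "\<forall>x\<in>{0..1}. b j k x = wavelet \<phi> \<psi> j k x"
    then show ?thesis by (intro continuous_on_eq[OF w]) simp
  next
    assume "\<exists>g\<in>E. \<exists>a\<in>{0, 1}. \<forall>x\<in>{0..1}.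
           b j k x = 2 powr (of_int (max j 0) / 2) * g (2 powr of_int (max j 0) * (x - a))"
    then obtain g a where g: "g \<in> E" and eq: "\<forall>x\<in>{0..1}.
           b j k x = 2 powr (of_int (max j 0) / 2) * g (2 powr of_int (max j 0) * (x - a))" by (elim bexE)
    from E g obtain m where "scaling_comb \<phi> m g" by blast
    then obtain F c where "\<And>x. g x = (\<Sum>k\<in>F. c k * \<phi> (2 ^ m * x - of_int k))"
      unfolding scaling_comb_def by blast
    then have "g = (\<lambda>x. \<Sum>k\<in>F. c k * \<phi> (2 ^ m * x - of_int k))" by (rule ext)
    then have gc: "continuous_on UNIV g" by (simp only:) (rule continuous_on_sum, rule continuous_on_mult[OF continuous_on_const \<phi>(1)])
    have "continuous_on {0..1} (\<lambda>x. g (2 powr of_int (max j 0) * (x - a)))"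
      by (rule continuous_on_compose2[OF gc], intro continuous_on_mult continuous_on_diff continuous_on_const continuous_on_id) simp
    then have "continuous_on {0..1} (\<lambda>x. 2 powr (of_int (max j 0) / 2) * g (2 powr of_int (max j 0) * (x - a)))"
      by (rule continuous_on_mult[OF continuous_on_const])
    then show ?thesis by (rule continuous_on_eq) (simp only: eq)
  qed
qed

lemmas basis_square_integrable = continuous_on_unit_bounded[OF basis_continuous]

lemma basis_orthonormal:
  assumes "-1 \<le> j" "k \<in> I j" "-1 \<le> j'" "k' \<in> I j'"
  shows "(\<integral>x. b j k x * b j' k' x \<partial>unit_measure) = (if j = j' \<and> k = k' then 1 else 0)"
proof -
  have "(\<forall>i\<in>Sigma {-1..} I. \<forall>i'\<in>Sigma {-1..} I.
      (\<integral>x. (case i of (j, k) \<Rightarrow> b j k) x * (case i' of (j, k) \<Rightarrow> b j k) x \<partial>unit_measure) = (if i = i' then 1 else 0))"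
    using unit_basis unfolding orthonormal_basis_def by blast
  then have "(\<integral>x. (case (j, k) of (j, k) \<Rightarrow> b j k) x * (case (j', k') of (j, k) \<Rightarrow> b j k) x \<partial>unit_measure) =
     (if (j, k) = (j', k') then 1 else 0)"
    using assms by (auto simp del: prod.inject)
  then show ?thesis by simp
qed

lemma partial_sum_square_integrable:
  "square_integrable unit_measure (\<lambda>x. \<Sum>j\<in>{-1..m}. \<Sum>k\<in>I j. d j k * b j k x)"
  by (intro square_integrable_sum square_integrable_scale basis_square_integrable) auto

lemma has_expansion_square_integrable:
  assumes "has_expansion I b d f"
  shows "square_integrable unit_measure f"
proof -
  let ?P = "\<lambda>m::nat. \<lambda>x. \<Sum>j\<in>{-1..int m}. \<Sum>k\<in>I j. d j k * b j k x"
  have "\<forall>\<^sub>F m in sequentially. L2_dist_sq unit_measure f (?P m) < \<top>"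
    using assms unfolding has_expansion_def by (intro order_tendstoD[where y = 0]) auto
  then obtain m where "L2_dist_sq unit_measure f (?P m) < \<top>"
    using eventually_happens'[OF sequentially_bot] by blast
  then show ?thesis
    using assms square_integrable_of_L2_dist[OF _ partial_sum_square_integrable]
    unfolding has_expansion_def by blast
qed

text \<open>Coefficients in an L^2 expansion are inner products. So the array witnessing membership
  in \<open>param_space\<close> is also the array of means of the empirical coefficients.\<close>

lemma has_expansion_coeff:
  assumes f: "has_expansion I b d f" and j: "-1 \<le> j" "k \<in> I j"
  shows "(\<integral>x. f x * b j k x \<partial>unit_measure) = d j k"
proof (rule LIMSEQ_unique)
  let ?P = "\<lambda>m::nat. \<lambda>x. \<Sum>j\<in>{-1..int m}. \<Sum>k\<in>I j. d j k * b j k x"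
  show "(\<lambda>m. \<integral>x. ?P m x * b j k x \<partial>unit_measure) \<longlonglongrightarrow> (\<integral>x. f x * b j k x \<partial>unit_measure)"
    by (rule L2_tendsto_integral_mult[OF partial_sum_square_integrable has_expansion_square_integrable[OF f]
          basis_square_integrable[OF j]]) (use f in \<open>simp add: has_expansion_def\<close>)
  have "(\<integral>x. ?P m x * b j k x \<partial>unit_measure) = d j k" if m: "int m \<ge> j" for m
  proof -
    let ?h = "\<lambda>j' k' x. d j' k' * (b j' k' x * b j k x)"
    have int: "integrable unit_measure (?h j' k')" if "j' \<in> {-1..int m}" "k' \<in> I j'" for j' k'
      using that j by (intro integrable_mult_right square_integrable_mult basis_square_integrable) auto
    have "(\<integral>x. ?P m x * b j k x \<partial>unit_measure) = (\<integral>x. (\<Sum>j'\<in>{-1..int m}. \<Sum>k'\<in>I j'. ?h j' k' x) \<partial>unit_measure)"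
      by (intro Bochner_Integration.integral_cong refl) (simp add: sum_distrib_right mult.assoc)
    also have "\<dots> = (\<Sum>j'\<in>{-1..int m}. \<integral>x. (\<Sum>k'\<in>I j'. ?h j' k' x) \<partial>unit_measure)"
      by (intro Bochner_Integration.integral_sum Bochner_Integration.integrable_sum int)
    also have "\<dots> = (\<Sum>j'\<in>{-1..int m}. \<Sum>k'\<in>I j'. \<integral>x. ?h j' k' x \<partial>unit_measure)"
      by (intro sum.cong refl Bochner_Integration.integral_sum int)
    also have "\<dots> = (\<Sum>j'\<in>{-1..int m}. \<Sum>k'\<in>I j'. if k' = k then if j' = j then d j k else 0 else 0)"
      using j by (intro sum.cong refl) (auto simp: basis_orthonormal)
    also have "\<dots> = (\<Sum>j'\<in>{-1..int m}. if j' = j then d j k else 0)"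
      using finite_index j by (intro sum.cong refl) (auto simp: sum.delta)
    also have "\<dots> = d j k" using m j by simp
    finally show ?thesis .
  qed
  then have "\<forall>\<^sub>F m in sequentially. d j k = (\<integral>x. ?P m x * b j k x \<partial>unit_measure)"
    by (intro eventually_sequentiallyI[of "nat (max j 0)"]) (smt (verit) nat_le_iff)
  then show "(\<lambda>m. \<integral>x. ?P m x * b j k x \<partial>unit_measure) \<longlonglongrightarrow> d j k"
    by (rule tendsto_eventually[OF eventually_mono]) simp
qed

text \<open>The test against \<open>J0_level\<close> comes first because the estimator keeps those
  levels even when \<open>J n\<close> is smaller.\<close>

definition error_coeff :: "(nat \<Rightarrow> int) \<Rightarrow> nat \<Rightarrow> (int \<Rightarrow> int \<Rightarrow> real) \<Rightarrow> (int \<Rightarrow> int \<Rightarrow> real) \<Rightarrow> int \<Rightarrow> int \<Rightarrow> real" where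
  "error_coeff J n y d j k =
     (if j \<le> J0_level I n then y j k else if j \<le> J n then truncated_coeff I n y j k else 0) - d j k"

text \<open>For large \<open>m\<close> the partial sum contains the whole estimator, which cancels
  and leaves the tail of the expansion of \<open>f\<close>. This makes the norm bound for the basis
  applicable to the error.\<close>

lemma estimator_error_expansion:
  assumes f: "has_expansion I b d f" and J0: "J0_level I n \<ge> -1"
  shows "has_expansion I b (error_coeff J n y d) (\<lambda>x. estimator I b J n y x - f x)"
proof -
  let ?J0 = "J0_level I n"
  let ?e = "error_coeff J n y d"
  let ?P = "\<lambda>m::nat. \<lambda>x. \<Sum>j\<in>{-1..int m}. \<Sum>k\<in>I j. d j k * b j k x"
  let ?R = "\<lambda>m::nat. \<lambda>x. \<Sum>j\<in>{-1..int m}. \<Sum>k\<in>I j. ?e j k * b j k x"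
  have fm: "f \<in> borel_measurable unit_measure" using f by (simp add: has_expansion_def)
  have bm: "b j k \<in> borel_measurable unit_measure" if "-1 \<le> j" "k \<in> I j" for j k
    using that by (intro square_integrable_measurable basis_square_integrable)
  have em: "(\<lambda>x. estimator I b J n y x) \<in> borel_measurable unit_measure"
    unfolding estimator_def using J0
    by (intro borel_measurable_add borel_measurable_sum borel_measurable_times borel_measurable_const bm) auto
  have eq: "?R m x = estimator I b J n y x - ?P m x" if m: "int m \<ge> ?J0" "int m \<ge> J n" for m x
  proof -
    have 1: "(\<Sum>j\<in>{-1..?J0}. \<Sum>k\<in>I j. y j k * b j k x) =
       (\<Sum>j\<in>{-1..int m}. if j \<le> ?J0 then \<Sum>k\<in>I j. y j k * b j k x else 0)"
      using m by (intro sum.mono_neutral_cong_left) auto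
    have 2: "(\<Sum>j\<in>{?J0 + 1..J n}. \<Sum>k\<in>I j. truncated_coeff I n y j k * b j k x) =
       (\<Sum>j\<in>{-1..int m}. if ?J0 < j \<and> j \<le> J n then \<Sum>k\<in>I j. truncated_coeff I n y j k * b j k x else 0)"
      using m J0 by (intro sum.mono_neutral_cong_left) auto
    show ?thesis
      unfolding estimator_def 1 2 sum.distrib[symmetric] sum_subtractf[symmetric]
      by (intro sum.cong refl) (auto simp: error_coeff_def left_diff_distrib sum_subtractf sum_negf)
  qed
  have "\<forall>\<^sub>F m in sequentially. L2_dist_sq unit_measure (\<lambda>x. estimator I b J n y x - f x) (?R m) = L2_dist_sq unit_measure f (?P m)"
  proof (rule eventually_sequentiallyI[of "nat (max ?J0 (J n))"])
    fix m assume "m \<ge> nat (max ?J0 (J n))"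
    then have m: "int m \<ge> ?J0" "int m \<ge> J n" by linarith+
    have "L2_dist_sq unit_measure (\<lambda>x. estimator I b J n y x - f x) (?R m) = L2_dist_sq unit_measure (?P m) f"
      unfolding eq[OF m] L2_dist_sq_def by simp
    then show "L2_dist_sq unit_measure (\<lambda>x. estimator I b J n y x - f x) (?R m) = L2_dist_sq unit_measure f (?P m)"
      by (simp only: L2_dist_sq_commute)
  qed
  moreover have "(\<lambda>m. L2_dist_sq unit_measure f (?P m)) \<longlonglongrightarrow> 0" using f by (simp add: has_expansion_def)
  ultimately have "(\<lambda>m. L2_dist_sq unit_measure (\<lambda>x. estimator I b J n y x - f x) (?R m)) \<longlonglongrightarrow> 0"
    by (simp add: tendsto_cong)
  then show ?thesis unfolding has_expansion_def using em fm by auto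
qed

end

subsection \<open>Norms on a single level\<close>

definition level_weight :: "ennreal \<Rightarrow> int \<Rightarrow> ennreal" where
  "level_weight p j = ennreal (2 powr (of_int j * (1/2 - (if p = \<top> then 0 else 1 / enn2real p))))"

text \<open>The cardinality enters as (C 2^j)^(1/p), which cancels the 2^(-j/p) of the weight. What
  remains, C 2^(j/2), is free of \<open>p\<close> because C^(1/p) \<le> C.\<close>

lemma level_norm_le_power:
  assumes A: "finite A" and card: "real (card A) \<le> C * 2 powr of_int j" and C: "C \<ge> 1"
    and p: "1 \<le> p" "p < \<top>" and m: "0 \<le> m"
    and e: "(\<Sum>k\<in>A. \<bar>e k\<bar> powr enn2real p) \<le> real (card A) * m powr enn2real p"
  shows "level_weight p j * Lp_norm p (count_space A) e \<le> ennreal (C * 2 powr (of_int j / 2) * m)"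
proof -
  define P where "P = enn2real p"
  have P: "P \<ge> 1" using p enn2real_mono[of 1 p] by (simp add: P_def)
  let ?S = "\<Sum>k\<in>A. \<bar>e k\<bar> powr P"
  have S: "0 \<le> ?S" by (intro sum_nonneg) auto
  have "(\<integral>\<^sup>+x. ennreal (\<bar>e x\<bar> powr P) \<partial>count_space A) = ennreal ?S"
    using A by (simp add: nn_integral_count_space_finite)
  then have L: "Lp_norm p (count_space A) e = ennreal (?S powr (1 / P))"
    using p S unfolding Lp_norm_def epowr_def P_def by (simp add: less_top)
  have "?S powr (1 / P) \<le> (C * 2 powr of_int j * m powr P) powr (1 / P)"
    using e card S P by (intro powr_mono2 order_trans[OF e[folded P_def]] mult_right_mono) auto
  also have "\<dots> = C powr (1 / P) * 2 powr (of_int j / P) * m"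
    using C P m by (simp add: powr_mult powr_powr)
  also have "\<dots> \<le> C * 2 powr (of_int j / P) * m"
    using C P m powr_mono[of "1 / P" 1 C] by (intro mult_right_mono) auto
  finally have "2 powr (of_int j * (1/2 - 1 / P)) * ?S powr (1 / P) \<le>
      2 powr (of_int j * (1/2 - 1 / P)) * (C * 2 powr (of_int j / P) * m)"
    by (intro mult_left_mono) auto
  also have "\<dots> = C * (2 powr (of_int j * (1/2 - 1 / P)) * 2 powr (of_int j / P)) * m" by simp
  also have "2 powr (of_int j * (1/2 - 1 / P)) * 2 powr (of_int j / P) = (2::real) powr (of_int j / 2)"
    by (simp add: powr_add[symmetric] algebra_simps)
  finally show ?thesis
    unfolding level_weight_def L using p by (simp add: P_def[symmetric] less_top ennreal_mult[symmetric] ennreal_leI)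
qed

text \<open>A bound on every single coefficient gives the estimate for all exponents at once, the
  infinite one included.\<close>

lemma level_norm_le_sup:
  assumes A: "finite A" and card: "real (card A) \<le> C * 2 powr of_int j" and C: "C \<ge> 1"
    and p: "1 \<le> p" and m: "0 \<le> m" and e: "\<And>k. k \<in> A \<Longrightarrow> \<bar>e k\<bar> \<le> m"
  shows "level_weight p j * Lp_norm p (count_space A) e \<le> ennreal (C * 2 powr (of_int j / 2) * m)"
proof (cases "p = \<top>")
  case True
  have "Lp_norm p (count_space A) e \<le> ennreal m"
    unfolding Lp_norm_def using True e by (auto intro!: esssup_I simp: AE_count_space ennreal_leI)
  then have "level_weight p j * Lp_norm p (count_space A) e \<le> ennreal (2 powr (of_int j / 2)) * ennreal m"
    unfolding level_weight_def using True by (intro mult_mono) auto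
  also have "\<dots> = ennreal (2 powr (of_int j / 2) * m)" using m by (simp add: ennreal_mult)
  also have "\<dots> \<le> ennreal (C * 2 powr (of_int j / 2) * m)"
    using C m mult_right_mono[of 1 C "2 powr (of_int j / 2) * m"] by (intro ennreal_leI) (simp add: mult.assoc)
  finally show ?thesis .
next
  case False
  have "(\<Sum>k\<in>A. \<bar>e k\<bar> powr enn2real p) \<le> (\<Sum>k\<in>A. m powr enn2real p)"
    using e by (intro sum_mono powr_mono2) auto
  then show ?thesis
    using False by (intro level_norm_le_power[OF A card C p _ m]) (auto simp: less_top)
qed

text \<open>Summing over \<open>x\<close>, this compares power means up to a factor without convexity.\<close>

lemma powr_le_add_powr:
  fixes x m :: real
  assumes "0 \<le> x" "0 < m" "0 \<le> p" "p \<le> q"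
  shows "x powr p \<le> m powr p + x powr q * m powr (p - q)"
proof (cases "x \<le> m")
  case True
  then have "x powr p \<le> m powr p" using assms by (intro powr_mono2) auto
  moreover have "0 \<le> x powr q * m powr (p - q)" by simp
  ultimately show ?thesis by linarith
next
  case False
  then have "x powr (p - q) \<le> m powr (p - q)" using assms by (intro powr_mono2') auto
  then have "x powr q * x powr (p - q) \<le> x powr q * m powr (p - q)" by (intro mult_left_mono) auto
  then have "x powr p \<le> x powr q * m powr (p - q)" by (simp flip: powr_add)
  then show ?thesis using powr_ge_zero[of m p] by linarith
qed

text \<open>Passes from a power of two \<open>q\<close>, where truncation is controlled, to a real
  exponent \<open>p\<close> below it. The splitting inequality produces two equal terms, and 2 \<le>
  2^p moves the factor inside.\<close>

lemma power_sum_lower_exponent: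
  fixes e :: "'a \<Rightarrow> real"
  assumes A: "finite A" and m: "0 < m" and p: "1 \<le> p" "p \<le> real q" and q: "q > 0"
    and e: "(\<Sum>k\<in>A. \<bar>e k\<bar> ^ q) \<le> real (card A) * m ^ q"
  shows "(\<Sum>k\<in>A. \<bar>e k\<bar> powr p) \<le> real (card A) * (2 * m) powr p"
proof -
  have pw: "x powr real q = x ^ q" if "x \<ge> 0" for x :: real
    using that q by (cases "x = 0") (auto simp: powr_realpow)
  have "(\<Sum>k\<in>A. \<bar>e k\<bar> powr p) \<le> (\<Sum>k\<in>A. m powr p + \<bar>e k\<bar> ^ q * m powr (p - q))"
    using powr_le_add_powr[OF _ m, of _ p "real q"] p by (intro sum_mono) (auto simp: pw)
  also have "\<dots> = real (card A) * m powr p + (\<Sum>k\<in>A. \<bar>e k\<bar> ^ q) * m powr (p - q)"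
    by (simp add: sum.distrib sum_distrib_right)
  also have "\<dots> \<le> real (card A) * m powr p + (real (card A) * m ^ q) * m powr (p - q)"
    by (intro add_left_mono mult_right_mono e) auto
  also have "(real (card A) * m ^ q) * m powr (p - q) = real (card A) * m powr p"
    using m by (simp add: powr_realpow[symmetric] powr_add[symmetric])
  also have "real (card A) * m powr p + real (card A) * m powr p = real (card A) * (2 powr 1 * m powr p)"
    by simp
  also have "\<dots> \<le> real (card A) * (2 powr p * m powr p)"
    using p by (intro mult_left_mono mult_right_mono powr_mono) auto
  also have "2 powr p * m powr p = (2 * m) powr p" using m by (simp add: powr_mult)
  finally show ?thesis .
qed

subsection \<open>Dyadic sums\<close>

text \<open>A geometric series read downwards from the largest admissible level, the floor of log2
  x. Reindexing by the distance to it is injective on any finite \<open>F\<close>.\<close>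

lemma dyadic_sum_upper:
  fixes F :: "int set" and a x :: real
  assumes F: "finite F" and a: "a > 0" and x: "x > 0" and le: "\<And>j. j \<in> F \<Longrightarrow> 2 powr of_int j \<le> x"
  shows "(\<Sum>j\<in>F. 2 powr (a * of_int j)) \<le> x powr a / (1 - 2 powr (-a))"
proof -
  define m where "m = \<lfloor>log 2 x\<rfloor>"
  define q where "q = (2::real) powr (-a)"
  have q: "0 < q" "q < 1" using a by (auto simp: q_def powr_less_one)
  have jm: "j \<le> m" if "j \<in> F" for j
  proof -
    have "real_of_int j \<le> log 2 x" using le[OF that] x by (simp add: le_log_iff)
    then show ?thesis by (simp add: m_def le_floor_iff)
  qed
  have "(\<Sum>j\<in>F. 2 powr (a * of_int j)) = (\<Sum>j\<in>F. 2 powr (a * of_int m) * q ^ nat (m - j))"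
  proof (intro sum.cong refl)
    fix j assume "j \<in> F"
    then have "real (nat (m - j)) = of_int m - of_int j" using jm by simp
    then have "q ^ nat (m - j) = 2 powr (- a * (of_int m - of_int j))"
      using q by (simp add: powr_realpow[symmetric] q_def powr_powr)
    then show "2 powr (a * of_int j) = 2 powr (a * of_int m) * q ^ nat (m - j)"
      by (simp add: powr_add[symmetric] algebra_simps)
  qed
  also have "\<dots> = 2 powr (a * of_int m) * (\<Sum>j\<in>F. q ^ nat (m - j))"
    by (simp add: sum_distrib_left)
  also have "(\<Sum>j\<in>F. q ^ nat (m - j)) = (\<Sum>i\<in>(\<lambda>j. nat (m - j)) ` F. q ^ i)"
  proof (rule sum.reindex_cong[symmetric, where l = "\<lambda>j. nat (m - j)"])
    show "inj_on (\<lambda>j. nat (m - j)) F"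
    proof (rule inj_onI)
      fix i j assume "i \<in> F" "j \<in> F" "nat (m - i) = nat (m - j)"
      then show "i = j" using jm[of i] jm[of j] by (simp add: eq_nat_nat_iff)
    qed
  qed auto
  also have "2 powr (a * of_int m) * \<dots> \<le> 2 powr (a * of_int m) * (1 / (1 - q))"
  proof (intro mult_left_mono)
    have "(\<Sum>i\<in>(\<lambda>j. nat (m - j)) ` F. q ^ i) \<le> (\<Sum>i. q ^ i)"
      using F q by (intro sum_le_suminf summable_geometric) auto
    then show "(\<Sum>i\<in>(\<lambda>j. nat (m - j)) ` F. q ^ i) \<le> 1 / (1 - q)"
      using q by (simp add: suminf_geometric)
  qed simp
  also have "\<dots> \<le> x powr a * (1 / (1 - q))"
  proof (intro mult_right_mono)
    have "2 powr of_int m \<le> x" using x by (simp add: m_def powr_le_iff)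
    then have "(2 powr of_int m) powr a \<le> x powr a" using a by (intro powr_mono2) auto
    then show "2 powr (a * of_int m) \<le> x powr a" by (simp add: powr_powr mult.commute)
  qed (use q in auto)
  finally show ?thesis by (simp add: q_def)
qed

lemma dyadic_sum_lower:
  fixes F :: "int set" and a x :: real
  assumes F: "finite F" and a: "a > 0" and x: "x > 0" and le: "\<And>j. j \<in> F \<Longrightarrow> x \<le> 2 powr of_int j"
  shows "(\<Sum>j\<in>F. 2 powr (- a * of_int j)) \<le> x powr (-a) / (1 - 2 powr (-a))"
proof -
  have "(\<Sum>j\<in>F. 2 powr (- a * of_int j)) = (\<Sum>j\<in>uminus ` F. 2 powr (a * of_int j))"
    by (subst sum.reindex) (auto simp: inj_on_def)
  also have "\<dots> \<le> (1 / x) powr a / (1 - 2 powr (-a))"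
  proof (rule dyadic_sum_upper)
    fix j assume "j \<in> uminus ` F"
    then obtain i where i: "i \<in> F" "j = - i" by auto
    then show "2 powr of_int j \<le> 1 / x"
      using le[OF i(1)] x by (simp add: powr_minus_divide frac_le)
  qed (use F a x in auto)
  also have "(1 / x) powr a = x powr (-a)" using x by (simp add: powr_divide powr_minus_divide)
  finally show ?thesis .
qed

definition coeff_bound :: "real \<Rightarrow> real \<Rightarrow> int \<Rightarrow> real" where
  "coeff_bound \<beta> Q j = Q * 2 powr (- (of_int j / 2) * (2 * \<beta> + 1))"

lemma coeff_bound_weighted: "2 powr (of_int j / 2) * coeff_bound \<beta> Q j = Q * 2 powr (- \<beta> * of_int j)"
proof -
  have "2 powr (of_int j / 2) * coeff_bound \<beta> Q j = Q * (2 powr (of_int j / 2) * 2 powr (- (of_int j / 2) * (2 * \<beta> + 1)))"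
    by (simp add: coeff_bound_def)
  also have "2 powr (of_int j / 2) * 2 powr (- (of_int j / 2) * (2 * \<beta> + 1)) = (2::real) powr (- \<beta> * of_int j)"
    unfolding powr_add[symmetric] by (simp add: algebra_simps)
  finally show ?thesis .
qed

lemma sum_coeff_bound_le:
  assumes "\<beta> > 0" "Q > 0"
  obtains C where "C > 0" "\<And>F. finite F \<Longrightarrow> (\<And>j. j \<in> F \<Longrightarrow> -1 \<le> j) \<Longrightarrow> (\<Sum>j\<in>F. 2 powr (of_int j / 2) * coeff_bound \<beta> Q j) \<le> C"
proof
  let ?C = "Q * ((1/2) powr (-\<beta>) / (1 - 2 powr (-\<beta>)))"
  show "?C > 0" using assms by (auto simp: powr_less_one)
  fix F :: "int set" assume F: "finite F" "\<And>j. j \<in> F \<Longrightarrow> -1 \<le> j"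
  have "(\<Sum>j\<in>F. 2 powr (of_int j / 2) * coeff_bound \<beta> Q j) = Q * (\<Sum>j\<in>F. 2 powr (- \<beta> * of_int j))"
    unfolding coeff_bound_weighted by (simp add: sum_distrib_left)
  also have "\<dots> \<le> ?C"
  proof (intro mult_left_mono dyadic_sum_lower F)
    fix j assume "j \<in> F"
    \<comment> \<open>The lowest level is -1, hence the lower bound 1/2 for the dyadic sum.\<close>
    then have "(2::real) powr (-1) \<le> 2 powr of_int j" using F(2)[of j] by (intro powr_mono) auto
    then show "1/2 \<le> (2::real) powr of_int j" by (simp add: powr_minus)
  qed (use assms in auto)
  finally show "(\<Sum>j\<in>F. 2 powr (of_int j / 2) * coeff_bound \<beta> Q j) \<le> ?C" .
qed

text \<open>The crossover \<open>X\<close> is the value of \<open>2\<^sup>j\<close> at which the coefficient bound equals \<open>\<kappa> s\<close>.\<close>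

lemma bias_variance_sum:
  assumes \<beta>: "\<beta> > 0" and Q: "Q > 0" and \<kappa>: "\<kappa> > 0"
  obtains C where "C > 0" "\<And>s T F. s > 0 \<Longrightarrow> T \<ge> 0 \<Longrightarrow> finite F \<Longrightarrow>
    (\<Sum>j\<in>F. 2 powr (of_int j / 2) * (if coeff_bound \<beta> Q j > \<kappa> * s then T * s else 5 * coeff_bound \<beta> Q j))
      \<le> C * (T + 1) * s powr (2 * \<beta> / (2 * \<beta> + 1))"
proof -
  \<comment> \<open>Chosen so that the coefficient bound is \<open>Q\<close> times the power
    -\<gamma> of 2^j.\<close>
  define \<gamma> where "\<gamma> = \<beta> + 1/2"
  have \<gamma>: "\<gamma> > 0" using \<beta> by (simp add: \<gamma>_def)
  let ?r = "2 * \<beta> / (2 * \<beta> + 1)"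
  \<comment> \<open>Below the crossover the sum is of order s X^(1/2), above it of order
    X^(-\<beta>); with X proportional to s^(-1/\<gamma>) these identities give both the exponent
    \<open>?r\<close>.\<close>
  have r: "\<beta> / \<gamma> = ?r" "1 / (2 * \<gamma>) = 1 - ?r" using \<beta> by (auto simp: \<gamma>_def field_simps)
  define C1 where "C1 = (Q / \<kappa>) powr (1 / (2 * \<gamma>)) / (1 - 2 powr (-(1/2)))"
  define C2 where "C2 = 5 * Q * ((Q / \<kappa>) powr (- (\<beta> / \<gamma>)) / (1 - 2 powr (-\<beta>)))"
  have C1: "C1 > 0" using Q \<kappa> by (auto simp: C1_def powr_less_one intro!: divide_pos_pos)
  have C2: "C2 > 0" using Q \<kappa> \<beta> by (auto simp: C2_def powr_less_one intro!: divide_pos_pos)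
  show ?thesis
  proof (rule that[of "C1 + C2"])
    fix s T :: real and F :: "int set"
    assume s: "s > 0" and T: "T \<ge> 0" and F: "finite F"
    define X where "X = (Q / (\<kappa> * s)) powr (1 / \<gamma>)"
    have X: "X > 0" using Q \<kappa> s by (simp add: X_def)
    have B: "coeff_bound \<beta> Q j = Q / (2 powr of_int j) powr \<gamma>" for j
    proof -
      have "- (real_of_int j / 2) * (2 * \<beta> + 1) = - (of_int j * \<gamma>)" by (simp add: \<gamma>_def field_simps)
      then show ?thesis by (simp only: coeff_bound_def powr_powr powr_minus_divide) simp
    qed
    have Xg: "X powr \<gamma> = Q / (\<kappa> * s)" using Q \<kappa> s \<gamma> by (simp add: X_def powr_powr)
    have iff: "coeff_bound \<beta> Q j > \<kappa> * s \<longleftrightarrow> 2 powr of_int j < X" for j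
    proof -
      have "coeff_bound \<beta> Q j > \<kappa> * s \<longleftrightarrow> (2 powr of_int j) powr \<gamma> < X powr \<gamma>"
        unfolding B Xg using Q \<kappa> s by (simp add: field_simps)
      also have "\<dots> \<longleftrightarrow> 2 powr of_int j < X"
        using X \<gamma> by (metis linorder_not_less powr_ge_zero powr_less_mono2 powr_mono2 less_imp_le order_less_imp_le)
      finally show ?thesis .
    qed
    let ?A = "{j \<in> F. 2 powr real_of_int j < X}" and ?B = "{j \<in> F. \<not> 2 powr real_of_int j < X}"
    have "(\<Sum>j\<in>F. 2 powr (of_int j / 2) * (if coeff_bound \<beta> Q j > \<kappa> * s then T * s else 5 * coeff_bound \<beta> Q j)) =
       (\<Sum>j\<in>F. if 2 powr of_int j < X then T * s * 2 powr ((1/2) * of_int j) else 5 * Q * 2 powr (- \<beta> * of_int j))"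
      unfolding iff
    proof (intro sum.cong refl)
      fix j :: int
      have "2 powr (of_int j / 2) * (5 * coeff_bound \<beta> Q j) = 5 * (2 powr (of_int j / 2) * coeff_bound \<beta> Q j)"
        by (rule mult.left_commute)
      also have "\<dots> = 5 * Q * 2 powr (- \<beta> * of_int j)"
        unfolding coeff_bound_weighted by (rule mult.assoc[symmetric])
      finally have "2 powr (of_int j / 2) * (5 * coeff_bound \<beta> Q j) = 5 * Q * 2 powr (- \<beta> * of_int j)" .
      moreover have "1/2 * real_of_int j = of_int j / 2" by simp
      ultimately show "2 powr (of_int j / 2) * (if 2 powr of_int j < X then T * s else 5 * coeff_bound \<beta> Q j) =
          (if 2 powr of_int j < X then T * s * 2 powr ((1/2) * of_int j) else 5 * Q * 2 powr (- \<beta> * of_int j))"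
        by (cases "2 powr real_of_int j < X") (simp_all only: if_True if_False mult.commute)
    qed
    also have "\<dots> = T * s * (\<Sum>j\<in>?A. 2 powr ((1/2) * of_int j)) + 5 * Q * (\<Sum>j\<in>?B. 2 powr (- \<beta> * of_int j))"
    proof -
      have "F \<inter> {j. 2 powr real_of_int j < X} = ?A" "F \<inter> - {j. 2 powr real_of_int j < X} = ?B" by auto
      then show ?thesis by (simp only: sum.If_cases[OF F] sum_distrib_left)
    qed
    also have "\<dots> \<le> T * s * (X powr (1/2) / (1 - 2 powr (-(1/2)))) + 5 * Q * (X powr (-\<beta>) / (1 - 2 powr (-\<beta>)))"
      using F X \<beta> T s Q by (intro add_mono mult_left_mono dyadic_sum_upper dyadic_sum_lower) auto
    also have "T * s * (X powr (1/2) / (1 - 2 powr (-(1/2)))) = C1 * T * s powr ?r"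
    proof -
      have "X powr (1/2) = (Q / \<kappa> * (1 / s)) powr (1 / (2 * \<gamma>))"
        using \<gamma> by (simp add: X_def powr_powr mult.commute)
      also have "\<dots> = (Q / \<kappa>) powr (1 / (2 * \<gamma>)) * (1 / s) powr (1 / (2 * \<gamma>))"
        by (rule powr_mult)
      also have "(1 / s) powr (1 / (2 * \<gamma>)) = s powr (?r - 1)"
        unfolding r using s by (simp add: powr_divide powr_minus_divide[symmetric])
      finally have "s * X powr (1/2) = (Q / \<kappa>) powr (1 / (2 * \<gamma>)) * (s powr 1 * s powr (?r - 1))"
        using s by simp
      also have "s powr 1 * s powr (?r - 1) = s powr ?r" unfolding powr_add[symmetric] by simp
      finally have "s * X powr (1/2) = (Q / \<kappa>) powr (1 / (2 * \<gamma>)) * s powr ?r" .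
      then show ?thesis by (simp add: C1_def mult.assoc)
    qed
    also have "5 * Q * (X powr (-\<beta>) / (1 - 2 powr (-\<beta>))) = C2 * s powr ?r"
    proof -
      have "X powr (-\<beta>) = (Q / \<kappa> * (1 / s)) powr (- (\<beta> / \<gamma>))"
        using \<gamma> by (simp add: X_def powr_powr)
      also have "\<dots> = (Q / \<kappa>) powr (- (\<beta> / \<gamma>)) * (1 / s) powr (- (\<beta> / \<gamma>))"
        by (rule powr_mult)
      also have "(1 / s) powr (- (\<beta> / \<gamma>)) = s powr ?r"
        using s unfolding r(1) by (simp add: powr_divide powr_minus_divide)
      finally show ?thesis by (simp add: C2_def)
    qed
    also have "C1 * T * s powr ?r + C2 * s powr ?r \<le> (C1 + C2) * (T + 1) * s powr ?r"
    proof -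
      have "C1 * T + C2 \<le> (C1 + C2) * (T + 1)" using C1 C2 T by (simp add: algebra_simps)
      then show ?thesis by (metis distrib_right mult_right_mono powr_ge_zero)
    qed
    finally show "(\<Sum>j\<in>F. 2 powr (of_int j / 2) * (if coeff_bound \<beta> Q j > \<kappa> * s then T * s else 5 * coeff_bound \<beta> Q j))
      \<le> (C1 + C2) * (T + 1) * s powr ?r" .
  qed (use C1 C2 in auto)
qed

subsection \<open>Asymptotics in the sample size\<close>

lemma exponents_bounds:
  assumes "p \<in> exponents n" "ln (ln (real n)) > 0"
  shows "real p \<ge> 1" "real p \<le> ln (real n) / (ln (ln (real n)))\<^sup>2" "real p * (ln (ln (real n)))\<^sup>2 \<le> ln (real n)"
proof -
  have "p > 0" using assms by (auto simp: exponents_def)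
  then show "real p \<ge> 1" by simp
  show *: "real p \<le> ln (real n) / (ln (ln (real n)))\<^sup>2" using assms by (auto simp: exponents_def)
  then show "real p * (ln (ln (real n)))\<^sup>2 \<le> ln (real n)" using assms(2) by (simp add: field_simps)
qed

lemma level_size_eq:
  assumes "n > 0"
  shows "real n powr (1 / ln (ln (real n))) = exp (ln (real n) / ln (ln (real n)))"
  using assms by (simp add: powr_def)

text \<open>With L = log log n, the condition p L^2 \<le> log n gives (log n)^(p/2) \<le> exp(log n
  / (2L)), half the exponent of the level size exp(log n / L). It will keep the noise level above
  B^p.\<close>

lemma eventually_level_size_dominates:
  fixes \<kappa> :: real
  assumes \<kappa>: "\<kappa> > 0"
  shows "\<forall>\<^sub>F n in sequentially. \<forall>p\<in>exponents n. \<forall>N. N \<ge> \<kappa> * real n powr (1 / ln (ln (real n))) \<longrightarrow>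
    sqrt (ln (real n)) ^ p < N"
proof -
  have ev: "\<forall>\<^sub>F n::nat in sequentially. exp (ln (real n) / (2 * ln (ln (real n)))) < \<kappa> * exp (ln (real n) / ln (ln (real n)))"
    using \<kappa> by real_asymp
  have ev2: "\<forall>\<^sub>F n::nat in sequentially. ln (ln (real n)) > 1" by real_asymp
  have ev3: "\<forall>\<^sub>F n::nat in sequentially. ln (real n) > 0" by real_asymp
  show ?thesis using ev ev2 ev3 eventually_gt_at_top[of 0]
  proof eventually_elim
    case (elim n)
    define L where "L = ln (ln (real n))"
    have l: "ln (real n) > 0" using elim by simp
    show ?case
    proof (intro ballI allI impI)
      fix p N assume p: "p \<in> exponents n" and N: "N \<ge> \<kappa> * real n powr (1 / ln (ln (real n)))"
      have "sqrt (ln (real n)) ^ p = exp (real p * L / 2)"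
      proof -
        have "sqrt (ln (real n)) = exp (L / 2)"
          unfolding L_def ln_sqrt[OF less_imp_le[OF l], symmetric] using l by simp
        then show ?thesis by (simp add: exp_of_nat_mult[symmetric])
      qed
      also have "real p * L / 2 \<le> ln (real n) / (2 * L)"
        using exponents_bounds(3)[OF p] elim(2) by (simp add: L_def[symmetric] field_simps power2_eq_square)
      then have "exp (real p * L / 2) \<le> exp (ln (real n) / (2 * L))" by simp
      also have "\<dots> < \<kappa> * exp (ln (real n) / L)" using elim(1) by (simp add: L_def)
      also have "\<dots> \<le> N" using N elim by (simp add: level_size_eq L_def)
      finally show "sqrt (ln (real n)) ^ p < N" .
    qed
  qed
qed

text \<open>For x = 9 log n / p the quotient of p^p and the squared clipping level is exp(- p log
  x). As p \<le> log n / L^2 with L = log log n, x is at least L^2 and p log x is of smaller order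
  than log n / L, the logarithm of the level size; so the Hoeffding exponent outgrows 6 log
  n.\<close>

lemma eventually_hoeffding_exponent:
  fixes \<kappa> :: real
  assumes \<kappa>: "\<kappa> > 0"
  shows "\<forall>\<^sub>F n in sequentially. \<forall>p\<in>exponents n. \<forall>N. N \<ge> \<kappa> * real n powr (1 / ln (ln (real n))) \<longrightarrow>
    exp (- (2 * N * real p ^ p / ((9 * ln (real n)) powr (real p / 2))\<^sup>2)) \<le> real n powr (-6)"
proof -
  have ev: "\<forall>\<^sub>F n::nat in sequentially. 6 * ln (real n) \<le>
      2 * (\<kappa> * exp (ln (real n) / ln (ln (real n)))) * exp (- (36 * ln (real n) * ln (ln (real n)) powr (-3/2)))"
    using \<kappa> by real_asymp
  have ev2: "\<forall>\<^sub>F n::nat in sequentially. ln (ln (real n)) > 1" by real_asymp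
  have ev3: "\<forall>\<^sub>F n::nat in sequentially. ln (real n) > 1" by real_asymp
  show ?thesis using ev ev2 ev3 eventually_gt_at_top[of 0]
  proof eventually_elim
    case (elim n)
    define l where "l = ln (real n)"
    define L where "L = ln l"
    have l: "l > 1" "L > 1" using elim by (auto simp: l_def L_def)
    show ?case
    proof (intro ballI allI impI)
      fix p N assume p: "p \<in> exponents n" and N: "N \<ge> \<kappa> * real n powr (1 / ln (ln (real n)))"
      have pb: "real p \<ge> 1" "real p * L\<^sup>2 \<le> l"
        using exponents_bounds[OF p] elim by (auto simp: L_def l_def)
      define x where "x = 9 * l / real p"
      have x: "x \<ge> L\<^sup>2" "x > 0"
        using pb l by (auto simp: x_def field_simps)
      \<comment> \<open>Makes p log x = 9 l log x / x of order l x^(-3/4) \<le> l L^(-3/2). Any root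
        of exponent below 1/2 would stay below l / L.\<close>
      have lnx: "ln x \<le> 4 * x powr (1/4)"
      proof -
        have "ln (x powr (1/4)) \<le> x powr (1/4)" using x ln_bound[of "x powr (1/4)"] by simp
        then show ?thesis using x by (simp add: ln_powr)
      qed
      have "real p * ln x \<le> real p * (4 * x powr (1/4))" using lnx pb by (intro mult_left_mono) auto
      also have "real p * (4 * x powr (1/4)) = 36 * l * x powr (-3/4)"
      proof -
        have "real p = 9 * l * x powr (-1)" using pb l x by (simp add: x_def powr_minus field_simps)
        then have "real p * (4 * x powr (1/4)) = 36 * l * (x powr (-1) * x powr (1/4))" by simp
        also have "x powr (-1) * x powr (1/4) = x powr (-3/4)" unfolding powr_add[symmetric] by simp
        finally show ?thesis .
      qed
      also have "36 * l * x powr (-3/4) \<le> 36 * l * (L\<^sup>2) powr (-3/4)"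
        using x l by (intro mult_left_mono powr_mono2') auto
      also have "(L\<^sup>2) powr (-3/4) = L powr (-3/2)"
        using l by (simp add: powr_powr flip: powr_numeral)
      finally have px: "real p * ln x \<le> 36 * l * L powr (-3/2)" .
      have "((9 * l) powr (real p / 2))\<^sup>2 = (9 * l) ^ p"
        using l by (simp add: power2_eq_square powr_realpow flip: powr_add)
      then have "real p ^ p / ((9 * l) powr (real p / 2))\<^sup>2 = (1 / x) ^ p"
        using pb l by (simp add: x_def power_divide)
      also have "\<dots> = exp (- (real p * ln x))"
        using x by (simp add: exp_minus exp_of_nat_mult power_one_over inverse_eq_divide)
      also have "\<dots> \<ge> exp (- (36 * l * L powr (-3/2)))" using px by simp
      finally have ge: "real p ^ p / ((9 * l) powr (real p / 2))\<^sup>2 \<ge> exp (- (36 * l * L powr (-3/2)))" .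
      have "6 * l \<le> 2 * (\<kappa> * exp (l / L)) * exp (- (36 * l * L powr (-3/2)))"
        using elim(1) by (simp add: l_def L_def)
      also have "\<dots> \<le> 2 * N * (real p ^ p / ((9 * l) powr (real p / 2))\<^sup>2)"
      proof -
        have N': "\<kappa> * exp (l / L) \<le> N" using N elim by (simp add: level_size_eq l_def L_def)
        moreover have "0 < \<kappa> * exp (l / L)" using \<kappa> by simp
        ultimately have "0 \<le> N" by linarith
        with N' ge \<kappa> show ?thesis by (intro mult_mono) auto
      qed
      finally have "exp (- (2 * N * real p ^ p / ((9 * l) powr (real p / 2))\<^sup>2)) \<le> exp (-6 * l)" by simp
      also have "\<dots> = real n powr (-6)" using elim by (simp add: powr_def l_def)
      finally show "exp (- (2 * N * real p ^ p / ((9 * ln (real n)) powr (real p / 2))\<^sup>2)) \<le> real n powr (-6)"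
        unfolding l_def .
    qed
  qed
qed

text \<open>Rounding up to a power of two at most doubles \<open>P\<close>, and since 2r < 1 the
  power (log n)^(2r) is of smaller order than log n / (log log n)^2.\<close>

lemma eventually_exponent_exists:
  assumes r: "0 < r" "r < 1/2"
  shows "\<forall>\<^sub>F n in sequentially. \<forall>P. 1 \<le> P \<longrightarrow> P \<le> ln (real n) powr (2 * r) \<longrightarrow>
    (\<exists>q\<in>exponents n. P \<le> real q \<and> real q \<le> 2 * P)"
proof -
  have "\<forall>\<^sub>F n::nat in sequentially. 2 * ln (real n) powr (2 * r) + 1 \<le> ln (real n) / (ln (ln (real n)))\<^sup>2"
    using r by real_asymp
  then show ?thesis
  proof eventually_elim
    case (elim n)
    show ?case
    proof (intro allI impI)
      fix P assume P: "1 \<le> P" "P \<le> ln (real n) powr (2 * r)"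
      define k where "k = nat \<lceil>log 2 P\<rceil>"
      have "log 2 P \<ge> 0" using P by simp
      then have k: "log 2 P \<le> real k" "real k \<le> log 2 P + 1" unfolding k_def by linarith+
      have "P = 2 powr (log 2 P)" using P by simp
      also have "\<dots> \<le> 2 powr (real k)" using k by (intro powr_mono) auto
      finally have lo: "P \<le> real (2 ^ k)" by (simp add: powr_realpow)
      have "real (2 ^ k) = 2 powr (real k)" by (simp add: powr_realpow)
      also have "\<dots> \<le> 2 powr (log 2 P + 1)" using k by (intro powr_mono) auto
      also have "\<dots> = 2 * P" using P by (simp add: powr_add)
      finally have hi: "real (2 ^ k) \<le> 2 * P" .
      have "2 ^ k \<in> exponents n"
        unfolding exponents_def using hi P elim by auto
      then show "\<exists>q\<in>exponents n. P \<le> real q \<and> real q \<le> 2 * P" using lo hi by blast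
    qed
  qed
qed

subsection \<open>The risk for a fixed sample size\<close>

text \<open>The cardinalities grow like 2^j, so some level exceeds the bound. \<open>LEAST\<close>
  over the integers gives a minimum only once one is exhibited; it is found over the
  naturals.\<close>

lemma J0_level_properties:
  assumes lower: "\<And>j. -1 \<le> j \<Longrightarrow> cl * 2 powr of_int j \<le> real (card (I j))" and cl: "cl > 0"
  shows "-1 \<le> J0_level I n" "real (card (I (J0_level I n))) > real n powr (1 / ln (ln (real n)))"
    "\<And>j. -1 \<le> j \<Longrightarrow> j < J0_level I n \<Longrightarrow> real (card (I j)) \<le> real n powr (1 / ln (ln (real n)))"
proof -
  let ?x = "real n powr (1 / ln (ln (real n)))"
  let ?P = "\<lambda>j. -1 \<le> j \<and> real (card (I j)) > ?x"
  obtain m :: nat where "?x / cl < real m" using reals_Archimedean2 by blast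
  also have "real m < 2 ^ m" by (rule of_nat_less_two_power)
  finally have "?x < cl * 2 powr of_int (int m)" using cl by (simp add: powr_realpow field_simps)
  also have "\<dots> \<le> real (card (I (int m)))" by (rule lower) simp
  finally have "?P (int m)" by simp
  then have ex: "?P (int (Suc m) - 1)" by simp
  \<comment> \<open>Levels start at -1, so level j corresponds to the natural number j + 1.\<close>
  define i where "i = (LEAST i::nat. ?P (int i - 1))"
  have i: "?P (int i - 1)" unfolding i_def by (rule LeastI[of "\<lambda>i. ?P (int i - 1)", OF ex])
  have le: "i \<le> i'" if "?P (int i' - 1)" for i' unfolding i_def by (rule Least_le[of "\<lambda>i. ?P (int i - 1)", OF that])
  have min: "int i - 1 \<le> j" if j: "?P j" for j
  proof -
    have "int (nat (j + 1)) - 1 = j" using j by simp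
    then have "i \<le> nat (j + 1)" using j by (intro le) simp
    then show ?thesis using j by linarith
  qed
  have J0: "J0_level I n = int i - 1"
    unfolding J0_level_def using i min by (rule Least_equality[of ?P])
  show "-1 \<le> J0_level I n" "real (card (I (J0_level I n))) > ?x" unfolding J0 using i by simp_all
  show "real (card (I j)) \<le> ?x" if "-1 \<le> j" "j < J0_level I n" for j
    using min[of j] that unfolding J0 by (meson linorder_not_le)
qed

text \<open>One sample size and one regression function. The facts that hold for large
  \<open>n\<close> only are assumed here as conditions on \<open>n\<close>. Independence is required
  within each level, not between levels.\<close>

locale noisy_coefficients = interval_wavelet_basis \<phi> \<psi> s I b + prob_space M
  for \<phi> \<psi> s I b and M :: "'w measure" +
  fixes n :: nat and J :: "nat \<Rightarrow> int" and d :: "int \<Rightarrow> int \<Rightarrow> real" and \<epsilon> :: "int \<Rightarrow> int \<Rightarrow> 'w \<Rightarrow> real"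
    and \<beta> Q cl cu :: real
  assumes n: "n > 0" and log_n: "ln (real n) > 1" and loglog_n: "ln (ln (real n)) \<ge> 1"
    and indep: "\<And>j. -1 \<le> j \<Longrightarrow> indep_vars (\<lambda>_. borel) (\<epsilon> j) (I j)"
    and normal: "\<And>j k. -1 \<le> j \<Longrightarrow> k \<in> I j \<Longrightarrow> distr M borel (\<epsilon> j k) = std_normal_distribution"
    and Q: "Q > 0" and d_bound: "\<And>j k. -1 \<le> j \<Longrightarrow> k \<in> I j \<Longrightarrow> \<bar>d j k\<bar> \<le> coeff_bound \<beta> Q j"
    and cl: "cl > 0" and cu: "cu \<ge> 1"
    and card_lower: "\<And>j. -1 \<le> j \<Longrightarrow> cl * 2 powr of_int j \<le> real (card (I j))"
    and card_upper: "\<And>j. -1 \<le> j \<Longrightarrow> real (card (I j)) \<le> cu * 2 powr of_int j"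
    and level_size_dominates: "\<And>p N. p \<in> exponents n \<Longrightarrow> N \<ge> cl / cu * real n powr (1 / ln (ln (real n))) \<Longrightarrow>
      sqrt (ln (real n)) ^ p < N"
    and hoeffding_exponent: "\<And>p N. p \<in> exponents n \<Longrightarrow> N \<ge> cl / cu * real n powr (1 / ln (ln (real n))) \<Longrightarrow>
      exp (- (2 * N * real p ^ p / ((9 * ln (real n)) powr (real p / 2))\<^sup>2)) \<le> real n powr (-6)"
begin

section \<open>Sizes of the levels around \<open>J0\<close>\<close>

abbreviation "J0 \<equiv> J0_level I n"
abbreviation "N j \<equiv> real (card (I j))"
abbreviation "B \<equiv> coeff_bound \<beta> Q"

lemma J0_lower: "-1 \<le> J0"
  and J0_size: "N J0 > real n powr (1 / ln (ln (real n)))"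
  and below_J0: "\<And>j. -1 \<le> j \<Longrightarrow> j < J0 \<Longrightarrow> N j \<le> real n powr (1 / ln (ln (real n)))"
  using J0_level_properties[OF card_lower cl] by blast+

lemma card_pos:
  assumes "-1 \<le> j"
  shows "N j > 0"
proof -
  have "0 < cl * 2 powr of_int j" using cl by simp
  also have "\<dots> \<le> N j" by (rule card_lower[OF assms])
  finally show ?thesis .
qed

lemma B_pos: "B j > 0"
  using Q by (simp add: coeff_bound_def)

lemma noise_measurable [measurable]: "-1 \<le> j \<Longrightarrow> k \<in> I j \<Longrightarrow> \<epsilon> j k \<in> borel_measurable M"
  using indep unfolding indep_vars_def2 by blast

text \<open>Cardinalities need not increase with the level. Comparison through 2^j loses the factor
  \<open>cl / cu\<close>, which is why the conditions on \<open>n\<close> carry it.\<close>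

lemma level_size:
  assumes "J0 < j"
  shows "N j \<ge> cl / cu * real n powr (1 / ln (ln (real n)))"
proof -
  note J0 = J0_lower J0_size below_J0
  have "cl / cu * real n powr (1 / ln (ln (real n))) \<le> cl / cu * N J0"
    using J0(2) cl cu by (intro mult_left_mono) auto
  also have "\<dots> \<le> cl / cu * (cu * 2 powr of_int J0)"
    using card_upper[OF J0(1)] cl cu by (intro mult_left_mono) auto
  also have "\<dots> = cl * 2 powr of_int J0" using cu by simp
  also have "\<dots> \<le> cl * 2 powr of_int j" using assms cl by (intro mult_left_mono powr_mono) auto
  also have "\<dots> \<le> N j" using assms J0(1) by (intro card_lower) auto
  finally show ?thesis .
qed

text \<open>Level \<open>J0 - 1\<close> is still small and one level up doubles 2^j. The extra
  \<open>+ 1\<close> covers \<open>J0 = -1\<close>, which has no level below it.\<close>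

lemma J0_upper: "2 powr of_int J0 \<le> (2 / cl + 1) * real n powr (1 / ln (ln (real n)))"
proof (cases "J0 = -1")
  case True
  have "ln (ln (real n)) > 0" using log_n by simp
  then have "1 \<le> real n powr (1 / ln (ln (real n)))" using n by (intro ge_one_powr_ge_zero) auto
  then have "1 * 1 \<le> (2 / cl + 1) * real n powr (1 / ln (ln (real n)))" using cl by (intro mult_mono) auto
  moreover have "2 powr of_int J0 \<le> (1::real)" using True by (simp add: powr_minus)
  ultimately show ?thesis by linarith
next
  case False
  note J0 = J0_lower J0_size below_J0
  have "cl * 2 powr of_int (J0 - 1) \<le> N (J0 - 1)" using False J0(1) by (intro card_lower) auto
  also have "\<dots> \<le> real n powr (1 / ln (ln (real n)))" using False J0(1) by (intro J0(3)) auto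
  finally have "cl * (2 powr of_int J0 / 2) \<le> real n powr (1 / ln (ln (real n)))"
    by (simp add: powr_diff)
  then have "2 powr of_int J0 \<le> 2 / cl * real n powr (1 / ln (ln (real n)))"
    using cl by (simp add: field_simps)
  also have "\<dots> \<le> (2 / cl + 1) * real n powr (1 / ln (ln (real n)))" by (intro mult_right_mono) auto
  finally show ?thesis .
qed

section \<open>The exceptional event\<close>

definition y :: "'w \<Rightarrow> int \<Rightarrow> int \<Rightarrow> real" where
  "y \<omega> j k = d j k + \<epsilon> j k \<omega> / sqrt (real n)"

text \<open>The \<open>p\<close>-th power of 3 sqrt(log n), hence above |\<epsilon>|^p whenever
  \<epsilon> is not \<open>large\<close>.\<close>

definition clip :: "nat \<Rightarrow> real" where
  "clip p = (9 * ln (real n)) powr (real p / 2)"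

text \<open>The constant 29/10 lies below the 3 of the estimator's maximum test, leaving 1/10 for
  the signal, and its square is 8.41 > 2 * 4.2, which gives the tail n^(-4.2).\<close>

definition large :: "int \<Rightarrow> int \<Rightarrow> 'w set" where
  "large j k = {\<omega> \<in> space M. \<bar>\<epsilon> j k \<omega>\<bar> > 29/10 * sqrt (ln (real n))}"

definition heavy :: "int \<Rightarrow> nat \<Rightarrow> 'w set" where
  "heavy j p = {\<omega> \<in> space M. (\<Sum>k\<in>I j. min (\<bar>\<epsilon> j k \<omega>\<bar> ^ p) (clip p)) > K_const p * N j}"

definition bad :: "'w set" where
  "bad = (\<Union>j\<in>{J0 + 1..J n}. (\<Union>k\<in>I j. large j k) \<union> (\<Union>p\<in>exponents n. heavy j p))"

lemma exponents_subset: "exponents n \<subseteq> {1..n}"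
proof
  fix p assume p: "p \<in> exponents n"
  have "real p \<le> real p * (ln (ln (real n)))\<^sup>2"
    using loglog_n by (simp add: mult_le_cancel_left1 one_le_power)
  also have "\<dots> \<le> ln (real n)" using exponents_bounds(3)[OF p] loglog_n by simp
  also have "\<dots> \<le> real n" using n ln_bound[of "real n"] by simp
  finally show "p \<in> {1..n}" using exponents_bounds(1)[OF p] loglog_n by simp
qed

lemma finite_exponents: "finite (exponents n)"
  using exponents_subset finite_subset by blast

lemma card_exponents: "real (card (exponents n)) \<le> real n"
  using card_mono[OF _ exponents_subset] by simp

lemma clip_pos: "clip p > 0"
  using log_n by (simp add: clip_def)

lemma sets_large: "-1 \<le> j \<Longrightarrow> k \<in> I j \<Longrightarrow> large j k \<in> sets M"
  unfolding large_def by measurable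

lemma sets_heavy: "-1 \<le> j \<Longrightarrow> heavy j p \<in> sets M"
  unfolding heavy_def by measurable

lemma sets_bad: "bad \<in> sets M"
  unfolding bad_def using J0_lower finite_index finite_exponents
  by (intro sets.finite_UN sets.Un sets_large sets_heavy) auto

lemma prob_large:
  assumes "-1 \<le> j" "k \<in> I j"
  shows "prob (large j k) \<le> 2 * real n powr (-4.2)"
proof -
  have "prob (large j k) \<le> 2 * exp (- ((29/10 * sqrt (ln (real n)))\<^sup>2 / 2))"
    unfolding large_def using log_n
    by (intro std_normal_variable_tail[OF prob_space_axioms noise_measurable normal] assms) auto
  also have "(29/10 * sqrt (ln (real n)))\<^sup>2 = 841/100 * ln (real n)" using log_n by (simp add: power_mult_distrib power2_eq_square)
  also have "2 * exp (- (841/100 * ln (real n) / 2)) \<le> 2 * exp (-4.2 * ln (real n))" using log_n by simp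
  also have "\<dots> = 2 * real n powr (-4.2)" using n by (simp add: powr_def)
  finally show ?thesis .
qed

lemma prob_heavy:
  assumes j: "J0 < j" and p: "p \<in> exponents n"
  shows "prob (heavy j p) \<le> real n powr (-6)"
proof -
  have j': "-1 \<le> j" using j J0_lower by simp
  obtain r where r: "p = 2 ^ r" using p by (auto simp: exponents_def)
  have "prob (heavy j p) \<le> exp (- (2 * N j * real p ^ p / (clip p)\<^sup>2))"
    unfolding heavy_def using card_pos[OF j'] finite_index[OF j']
    by (intro clipped_moment_tail[OF _ _ indep normal r clip_pos]) (use j' in \<open>auto simp: card_gt_0_iff\<close>)
  also have "\<dots> \<le> real n powr (-6)"
    unfolding clip_def by (rule hoeffding_exponent[OF p level_size[OF j]])
  finally show ?thesis .
qed

lemma prob_bad: "prob bad \<le> (\<Sum>j\<in>{J0 + 1..J n}. N j * (2 * real n powr (-4.2) + real n powr (-5)))"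
proof -
  have "prob bad \<le> (\<Sum>j\<in>{J0 + 1..J n}. prob ((\<Union>k\<in>I j. large j k) \<union> (\<Union>p\<in>exponents n. heavy j p)))"
    unfolding bad_def using J0_lower finite_index finite_exponents
    by (intro finite_measure_subadditive_finite) (auto intro!: sets.finite_UN sets.Un sets_large sets_heavy)
  also have "\<dots> \<le> (\<Sum>j\<in>{J0 + 1..J n}. N j * (2 * real n powr (-4.2) + real n powr (-5)))"
  proof (rule sum_mono)
    fix j assume "j \<in> {J0 + 1..J n}"
    then have j: "J0 < j" "-1 \<le> j" using J0_lower by auto
    have N1: "1 \<le> N j" using card_pos[OF j(2)] by (simp add: Suc_le_eq)
    have "prob ((\<Union>k\<in>I j. large j k) \<union> (\<Union>p\<in>exponents n. heavy j p)) \<le>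
        prob (\<Union>k\<in>I j. large j k) + prob (\<Union>p\<in>exponents n. heavy j p)"
      using finite_index finite_exponents j
      by (intro measure_Un_le) (auto intro!: sets.finite_UN sets_large sets_heavy)
    also have "prob (\<Union>k\<in>I j. large j k) \<le> (\<Sum>k\<in>I j. prob (large j k))"
      using finite_index j by (intro finite_measure_subadditive_finite) (auto intro!: sets_large)
    also have "\<dots> \<le> N j * (2 * real n powr (-4.2))"
      using prob_large[OF j(2)] by (intro sum_bounded_above[where 'a = real, simplified]) auto
    also have "prob (\<Union>p\<in>exponents n. heavy j p) \<le> (\<Sum>p\<in>exponents n. prob (heavy j p))"
      using finite_exponents j by (intro finite_measure_subadditive_finite) (auto intro!: sets_heavy)
    also have "\<dots> \<le> real (card (exponents n)) * real n powr (-6)"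
      using prob_heavy[OF j(1)] by (intro sum_bounded_above[where 'a = real, simplified]) auto
    also have "\<dots> \<le> real n powr 1 * real n powr (-6)"
      using card_exponents n by (intro mult_right_mono) auto
    also have "\<dots> = real n powr (-5)" unfolding powr_add[symmetric] by simp
    \<comment> \<open>The level is nonempty, so both terms can be given the common factor
      \<open>N j\<close>.\<close>
    also have "\<dots> \<le> N j * real n powr (-5)" using N1 by (simp add: mult_le_cancel_right1)
    finally show "prob ((\<Union>k\<in>I j. large j k) \<union> (\<Union>p\<in>exponents n. heavy j p)) \<le>
        N j * (2 * real n powr (-4.2) + real n powr (-5))"
      by (simp add: distrib_left)
  qed
  finally show ?thesis .
qed

lemma resolution_level: "-1 \<le> j \<Longrightarrow> resolution_level I n j"
  using finite_index card_pos n by unfold_locales auto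

lemma sqrt_n_power: "(1 / sqrt (real n)) ^ p = real n powr (- (real p / 2))"
  using n by (simp add: powr_half_sqrt[symmetric] powr_realpow[symmetric] powr_powr powr_minus_divide power_divide)

text \<open>Outside \<open>bad\<close> no noise is \<open>large\<close>, so clipping changes nothing
  and the bound from \<open>heavy\<close> applies to the true power sums.\<close>

lemma good_noise:
  assumes \<omega>: "\<omega> \<in> space M - bad" and j: "J0 < j" "j \<le> J n"
  shows "\<And>k. k \<in> I j \<Longrightarrow> \<bar>y \<omega> j k - d j k\<bar> \<le> 29/10 * sqrt (ln (real n) / real n)"
    and "\<And>p. p \<in> exponents n \<Longrightarrow> (\<Sum>k\<in>I j. \<bar>y \<omega> j k - d j k\<bar> ^ p) \<le> noise_level I n j p"
proof -
  have jm: "j \<in> {J0 + 1..J n}" using j by auto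
  have \<epsilon>: "\<bar>\<epsilon> j k \<omega>\<bar> \<le> 29/10 * sqrt (ln (real n))" if "k \<in> I j" for k
    using \<omega> jm that unfolding bad_def large_def by fastforce
  show "\<bar>y \<omega> j k - d j k\<bar> \<le> 29/10 * sqrt (ln (real n) / real n)" if "k \<in> I j" for k
    using divide_right_mono[OF \<epsilon>[OF that], of "sqrt (real n)"] by (simp add: y_def real_sqrt_divide)
  fix p assume p: "p \<in> exponents n"
  have clip: "\<bar>\<epsilon> j k \<omega>\<bar> ^ p \<le> clip p" if "k \<in> I j" for k
  proof -
    have "\<bar>\<epsilon> j k \<omega>\<bar> ^ p \<le> (3 * sqrt (ln (real n))) ^ p"
      using \<epsilon>[OF that] log_n by (intro power_mono order_trans[OF \<epsilon>[OF that]] mult_right_mono) auto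
    also have "3 * sqrt (ln (real n)) = (9 * ln (real n)) powr (1/2)"
      using log_n by (simp add: powr_half_sqrt real_sqrt_mult)
    also have "\<dots> ^ p = clip p"
      using log_n by (simp add: clip_def powr_realpow[symmetric] powr_powr)
    finally show ?thesis .
  qed
  have "(\<Sum>k\<in>I j. \<bar>\<epsilon> j k \<omega>\<bar> ^ p) = (\<Sum>k\<in>I j. min (\<bar>\<epsilon> j k \<omega>\<bar> ^ p) (clip p))"
    using clip by (intro sum.cong refl) (simp add: min_absorb1)
  also have "\<dots> \<le> K_const p * N j"
    using \<omega> jm p unfolding bad_def heavy_def by fastforce
  finally have le: "(\<Sum>k\<in>I j. \<bar>\<epsilon> j k \<omega>\<bar> ^ p) \<le> K_const p * N j" .
  have "(\<Sum>k\<in>I j. \<bar>y \<omega> j k - d j k\<bar> ^ p) = real n powr (- (real p / 2)) * (\<Sum>k\<in>I j. \<bar>\<epsilon> j k \<omega>\<bar> ^ p)"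
    unfolding sqrt_n_power[symmetric] by (simp add: y_def power_divide sum_divide_distrib[symmetric])
  also have "\<dots> \<le> real n powr (- (real p / 2)) * (K_const p * N j)"
    using le by (intro mult_left_mono) auto
  finally show "(\<Sum>k\<in>I j. \<bar>y \<omega> j k - d j k\<bar> ^ p) \<le> noise_level I n j p"
    by (simp add: noise_level_def mult_ac)
qed

section \<open>Coefficient errors outside the exceptional event\<close>

abbreviation "e \<omega> \<equiv> error_coeff J n (y \<omega>) d"

text \<open>The 6 is a round bound for 2.9 from the noise plus 3 from truncation. The cutoff 1/10 =
  3 - 2.9 is where the signal is too weak to trigger the maximum test.\<close>

lemma good_error_sup:
  assumes \<omega>: "\<omega> \<in> space M - bad" and j: "J0 < j" "j \<le> J n" and k: "k \<in> I j"
  shows "\<bar>e \<omega> j k\<bar> \<le> (if B j > 1/10 * sqrt (ln (real n) / real n) then 6 * sqrt (ln (real n) / real n) else 5 * B j)"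
proof -
  have j': "-1 \<le> j" using j J0_lower by simp
  interpret resolution_level I n "y \<omega>" j using resolution_level[OF j'] .
  let ?s = "sqrt (ln (real n) / real n)"
  have e: "e \<omega> j k = truncated_coeff I n (y \<omega>) j k - d j k" using j by (simp add: error_coeff_def)
  note noise = good_noise[OF \<omega> j]
  show ?thesis
  proof (cases "B j > 1/10 * ?s")
    case True
    have "0 \<le> ?s" using log_n n by simp
    then have "\<bar>e \<omega> j k\<bar> \<le> 6 * ?s"
      using truncation_error_sup[OF k, of "d j"] noise(1)[OF k] unfolding e by linarith
    then show ?thesis using True by simp
  next
    case False
    have "\<bar>truncated_coeff I n (y \<omega>) j k - d j k\<bar> \<le> 5 * B j"
    proof (rule truncation_error_signal[OF noise(2) noise(1) _ d_bound[OF j'] _ k])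
      show "29/10 * ?s + B j \<le> 3 * ?s" using False by simp
      fix p assume p: "p \<in> exponents n"
      have p0: "p > 0" by (rule exponents_pos[OF p])
      \<comment> \<open>This crude bound equals (log n)^(p/2) n^(-p/2), and
        \<open>level_size_dominates\<close> puts (log n)^(p/2) below \<open>N j\<close>.\<close>
      have "B j ^ p \<le> ?s ^ p" using False B_pos[of j] by (intro power_mono) auto
      also have "\<dots> = sqrt (ln (real n)) ^ p * (1 / sqrt (real n)) ^ p"
        by (simp add: real_sqrt_divide power_divide)
      also have "\<dots> < N j * (1 / sqrt (real n)) ^ p"
        using level_size_dominates[OF p level_size[OF j(1)]] n by (intro mult_strict_right_mono) auto
      also have "\<dots> \<le> K_const p * (N j * (1 / sqrt (real n)) ^ p)"
      proof -
        have "1 * 1 \<le> (6 * sqrt 2 * exp 1 + 1) * real p powr (real p / 2)"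
          using p0 by (intro mult_mono ge_one_powr_ge_zero) auto
        then have "1 \<le> K_const p" by (simp add: K_const_def)
        then have "1 * (N j * (1 / sqrt (real n)) ^ p) \<le> K_const p * (N j * (1 / sqrt (real n)) ^ p)"
          by (intro mult_right_mono) auto
        then show ?thesis by simp
      qed
      also have "\<dots> = noise_level I n j p"
        unfolding sqrt_n_power noise_level_def by (simp add: mult_ac)
      finally show "B j ^ p < noise_level I n j p" .
    qed
    then show ?thesis using False by (simp add: e)
  qed
qed

text \<open>The \<open>q\<close>-th root of \<open>K_const q\<close> is at most a constant times
  sqrt q. This is the origin of the factor sqrt p in the rate.\<close>

lemma good_error_power_sum:
  assumes \<omega>: "\<omega> \<in> space M - bad" and j: "J0 < j" "j \<le> J n" and q: "q \<in> exponents n"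
  shows "(\<Sum>k\<in>I j. \<bar>e \<omega> j k\<bar> ^ q) \<le> N j * (4 * (6 * sqrt 2 * exp 1 + 1) * sqrt (real q) * (1 / sqrt (real n))) ^ q"
proof -
  have j': "-1 \<le> j" using j J0_lower by simp
  interpret resolution_level I n "y \<omega>" j using resolution_level[OF j'] .
  let ?c = "6 * sqrt 2 * exp 1 + 1 :: real"
  have q0: "q > 0" by (rule exponents_pos[OF q])
  have "(\<Sum>k\<in>I j. \<bar>e \<omega> j k\<bar> ^ q) \<le> 4 ^ q * noise_level I n j q"
    using truncation_error_power_sum[OF q good_noise(2)[OF \<omega> j q]] j by (simp add: error_coeff_def)
  also have "\<dots> = N j * (4 ^ q * K_const q * (1 / sqrt (real n)) ^ q)"
    unfolding sqrt_n_power noise_level_def by (simp add: mult_ac)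
  also have "\<dots> \<le> N j * (4 ^ q * (?c ^ q * sqrt (real q) ^ q) * (1 / sqrt (real n)) ^ q)"
  proof (intro mult_left_mono mult_right_mono)
    have "?c \<le> ?c ^ q" using q0 by (intro self_le_power) auto
    moreover have "real q powr (real q / 2) = sqrt (real q) ^ q"
      using q0 by (simp add: powr_half_sqrt[symmetric] powr_realpow[symmetric] powr_powr)
    ultimately show "K_const q \<le> ?c ^ q * sqrt (real q) ^ q"
      unfolding K_const_def by (simp only:) (intro mult_right_mono, auto)
  qed auto
  also have "\<dots> = N j * (4 * ?c * sqrt (real q) * (1 / sqrt (real n))) ^ q"
    by (simp only: power_mult_distrib mult.assoc)
  finally show ?thesis .
qed

section \<open>Expected contribution of the low levels and of the exceptional event\<close>

definition noise_sum :: "int \<Rightarrow> 'w \<Rightarrow> real" where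
  "noise_sum j \<omega> = (\<Sum>k\<in>I j. \<bar>\<epsilon> j k \<omega>\<bar>)"

text \<open>The random part of the error bound. Up to \<open>J0\<close> the error is pure noise; on
  \<open>bad\<close> truncation moves a coefficient by at most |y|, so the error is at most twice
  the noise plus the signal. The maximum of the noise is replaced by its sum, which is crude but
  easy to integrate.\<close>

definition remainder :: "int \<Rightarrow> 'w \<Rightarrow> real" where
  "remainder j \<omega> = (if j \<le> J0 then noise_sum j \<omega> / sqrt (real n) else 0) +
     (if J0 < j \<and> j \<le> J n then indicator bad \<omega> * (2 * noise_sum j \<omega> / sqrt (real n) + B j) else 0)"

definition remainder_bound :: "int \<Rightarrow> real" where
  "remainder_bound j = (if j \<le> J0 then N j / sqrt (real n) else 0) +
     (if J0 < j \<and> j \<le> J n then N j * (real n powr (3/2) * prob bad + real n powr (-3/2)) / sqrt (real n) + prob bad * B j else 0)"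

lemma integrable_indicator_bad: "integrable M (indicator bad :: _ \<Rightarrow> real)"
  by (intro integrable_real_indicator sets_bad) (simp add: emeasure_eq_measure)

lemma noise_sum_nonneg: "0 \<le> noise_sum j \<omega>"
  unfolding noise_sum_def by (intro sum_nonneg) auto

lemma remainder_nonneg: "0 \<le> remainder j \<omega>"
  unfolding remainder_def using noise_sum_nonneg[of j \<omega>] B_pos[of j]
  by (intro add_nonneg_nonneg) (auto intro!: mult_nonneg_nonneg add_nonneg_nonneg simp: less_imp_le)

lemma abs_noise_le: "k \<in> I j \<Longrightarrow> -1 \<le> j \<Longrightarrow> \<bar>\<epsilon> j k \<omega>\<bar> \<le> noise_sum j \<omega>"
  unfolding noise_sum_def using finite_index by (intro member_le_sum) auto

lemma noise_abs_moment:
  assumes "-1 \<le> j" "k \<in> I j"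
  shows "integrable M (\<lambda>\<omega>. \<bar>\<epsilon> j k \<omega>\<bar>)" "(\<integral>\<omega>. \<bar>\<epsilon> j k \<omega>\<bar> \<partial>M) \<le> 1"
  using std_normal_variable_abs_moment[OF prob_space_axioms noise_measurable[OF assms] normal[OF assms], of 1 0] by simp_all

lemma noise_sum_moment:
  assumes "-1 \<le> j"
  shows "integrable M (noise_sum j)" "(\<integral>\<omega>. noise_sum j \<omega> \<partial>M) \<le> N j"
proof -
  show "integrable M (noise_sum j)"
    unfolding noise_sum_def[abs_def] using noise_abs_moment[OF assms] by (intro Bochner_Integration.integrable_sum)
  have "(\<integral>\<omega>. noise_sum j \<omega> \<partial>M) = (\<Sum>k\<in>I j. \<integral>\<omega>. \<bar>\<epsilon> j k \<omega>\<bar> \<partial>M)"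
    unfolding noise_sum_def using noise_abs_moment[OF assms] by (intro Bochner_Integration.integral_sum)
  also have "\<dots> \<le> (\<Sum>k\<in>I j. 1)" using noise_abs_moment[OF assms] by (intro sum_mono)
  finally show "(\<integral>\<omega>. noise_sum j \<omega> \<partial>M) \<le> N j" by simp
qed

text \<open>By AM-GM, \<open>2 1\<^bsub>bad\<^esub> \<bar>\<epsilon>\<bar> \<le> n\<^bsup>3/2\<^esup> 1\<^bsub>bad\<^esub> + n\<^bsup>-3/2\<^esup> \<epsilon>\<^sup>2\<close>; the weights suit \<open>P(bad) \<le> n\<^bsup>-3\<^esup>\<close>.\<close>

lemma bad_noise_sum_moment:
  assumes j: "-1 \<le> j"
  shows "integrable M (\<lambda>\<omega>. indicator bad \<omega> * noise_sum j \<omega>)"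
    "2 * (\<integral>\<omega>. indicator bad \<omega> * noise_sum j \<omega> \<partial>M) \<le> N j * (real n powr (3/2) * prob bad + real n powr (-3/2))"
proof -
  note [measurable] = sets_bad
  let ?l = "real n powr (3/2)"
  have l: "?l > 0" "real n powr (-3/2) = 1 / ?l" using n by (auto simp: powr_minus_divide)
  have int1: "integrable M (\<lambda>\<omega>. indicator bad \<omega> * \<bar>\<epsilon> j k \<omega>\<bar>)" if k: "k \<in> I j" for k
    using noise_abs_moment[OF j k] noise_measurable[OF j k]
    by (intro Bochner_Integration.integrable_bound[OF noise_abs_moment(1)[OF j k]]) (auto simp: indicator_def)
  have le: "2 * (\<integral>\<omega>. indicator bad \<omega> * \<bar>\<epsilon> j k \<omega>\<bar> \<partial>M) \<le> ?l * prob bad + 1 / ?l" if k: "k \<in> I j" for k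
  proof -
    note sq = std_normal_variable_square[OF prob_space_axioms noise_measurable[OF j k] normal[OF j k]]
    have bi: "integrable M (\<lambda>\<omega>. ?l * indicator bad \<omega>)"
      by (intro integrable_mult_right integrable_indicator_bad)
    have "(\<integral>\<omega>. 2 * (indicator bad \<omega> * \<bar>\<epsilon> j k \<omega>\<bar>) \<partial>M) \<le> (\<integral>\<omega>. ?l * indicator bad \<omega> + (1 / ?l) * (\<epsilon> j k \<omega>)\<^sup>2 \<partial>M)"
    proof (rule integral_mono)
      show "integrable M (\<lambda>\<omega>. 2 * (indicator bad \<omega> * \<bar>\<epsilon> j k \<omega>\<bar>))" using int1[OF k] by simp
      show "integrable M (\<lambda>\<omega>. ?l * indicator bad \<omega> + (1 / ?l) * (\<epsilon> j k \<omega>)\<^sup>2)"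
        by (intro Bochner_Integration.integrable_add bi integrable_mult_right sq)
      fix \<omega>
      have "0 \<le> (?l - \<bar>\<epsilon> j k \<omega>\<bar>)\<^sup>2 / ?l" using l by simp
      also have "\<dots> = ?l + (1 / ?l) * (\<epsilon> j k \<omega>)\<^sup>2 - 2 * \<bar>\<epsilon> j k \<omega>\<bar>"
        using l by (simp add: power2_eq_square field_simps)
      finally show "2 * (indicator bad \<omega> * \<bar>\<epsilon> j k \<omega>\<bar>) \<le> ?l * indicator bad \<omega> + (1 / ?l) * (\<epsilon> j k \<omega>)\<^sup>2"
        using l by (auto simp: indicator_def)
    qed
    also have "\<dots> = ?l * prob bad + 1 / ?l"
      using bi sq sets_bad by (subst Bochner_Integration.integral_add) auto
    finally show ?thesis by simp
  qed
  have eq: "(\<lambda>\<omega>. indicator bad \<omega> * noise_sum j \<omega>) = (\<lambda>\<omega>. \<Sum>k\<in>I j. indicator bad \<omega> * \<bar>\<epsilon> j k \<omega>\<bar>)"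
    by (simp add: noise_sum_def sum_distrib_left)
  show "integrable M (\<lambda>\<omega>. indicator bad \<omega> * noise_sum j \<omega>)"
    unfolding eq by (intro Bochner_Integration.integrable_sum int1)
  have "2 * (\<integral>\<omega>. indicator bad \<omega> * noise_sum j \<omega> \<partial>M) = (\<Sum>k\<in>I j. 2 * (\<integral>\<omega>. indicator bad \<omega> * \<bar>\<epsilon> j k \<omega>\<bar> \<partial>M))"
    unfolding eq by (subst Bochner_Integration.integral_sum) (auto intro!: int1 simp: sum_distrib_left)
  also have "\<dots> \<le> (\<Sum>k\<in>I j. ?l * prob bad + 1 / ?l)" by (intro sum_mono le)
  finally show "2 * (\<integral>\<omega>. indicator bad \<omega> * noise_sum j \<omega> \<partial>M) \<le> N j * (real n powr (3/2) * prob bad + real n powr (-3/2))"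
    unfolding l(2) by simp
qed

lemma remainder_moment:
  assumes j: "-1 \<le> j"
  shows "integrable M (remainder j)" "(\<integral>\<omega>. remainder j \<omega> \<partial>M) \<le> remainder_bound j"
proof -
  note m = noise_sum_moment[OF j] and bm = bad_noise_sum_moment[OF j]
  note ib = integrable_indicator_bad
  consider "j \<le> J0" | "J0 < j" "j \<le> J n" | "J0 < j" "J n < j" by linarith
  then have "integrable M (remainder j) \<and> (\<integral>\<omega>. remainder j \<omega> \<partial>M) \<le> remainder_bound j"
  proof cases
    case 1
    then have "remainder j = (\<lambda>\<omega>. noise_sum j \<omega> / sqrt (real n))" "remainder_bound j = N j / sqrt (real n)"
      by (auto simp: remainder_def remainder_bound_def)
    then show ?thesis using m by (auto intro: divide_right_mono)
  next
    case 2
    have r: "remainder j = (\<lambda>\<omega>. (2 / sqrt (real n)) * (indicator bad \<omega> * noise_sum j \<omega>) + B j * indicator bad \<omega>)"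
      using 2 by (auto simp: remainder_def algebra_simps)
    have "(\<integral>\<omega>. remainder j \<omega> \<partial>M) = (2 / sqrt (real n)) * (\<integral>\<omega>. indicator bad \<omega> * noise_sum j \<omega> \<partial>M) + B j * prob bad"
      unfolding r using bm(1) ib sets_bad by (subst Bochner_Integration.integral_add) auto
    also have "\<dots> \<le> remainder_bound j"
      using divide_right_mono[OF bm(2), of "sqrt (real n)"] 2 by (simp add: remainder_bound_def mult.commute)
    finally show ?thesis unfolding r using bm(1) ib by auto
  next
    case 3
    then have "remainder j = (\<lambda>\<omega>. 0)" "remainder_bound j = 0"
      by (auto simp: remainder_def remainder_bound_def)
    then show ?thesis by simp
  qed
  then show "integrable M (remainder j)" "(\<integral>\<omega>. remainder j \<omega> \<partial>M) \<le> remainder_bound j" by auto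
qed

text \<open>\<open>D\<close> covers the truncated levels outside \<open>bad\<close> and the bias of
  the levels beyond \<open>J n\<close>; \<open>remainder\<close> covers everything else.\<close>

lemma level_error_le:
  assumes p: "1 \<le> p" and j: "-1 \<le> j" and \<omega>: "\<omega> \<in> space M" and D: "0 \<le> D"
    and good: "\<omega> \<notin> bad \<Longrightarrow> J0 < j \<Longrightarrow> j \<le> J n \<Longrightarrow>
      level_weight p j * Lp_norm p (count_space (I j)) (e \<omega> j) \<le> ennreal (cu * 2 powr (of_int j / 2) * D)"
    and tail: "J0 < j \<Longrightarrow> J n < j \<Longrightarrow> B j \<le> D"
  shows "level_weight p j * Lp_norm p (count_space (I j)) (e \<omega> j) \<le> ennreal (cu * 2 powr (of_int j / 2) * (D + remainder j \<omega>))"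
proof -
  let ?m = "D + remainder j \<omega>"
  have m: "0 \<le> ?m" using D remainder_nonneg by simp
  have sup: ?thesis if "\<And>k. k \<in> I j \<Longrightarrow> \<bar>e \<omega> j k\<bar> \<le> ?m"
    using that by (intro level_norm_le_sup[OF finite_index[OF j] card_upper[OF j] cu p m]) auto
  have S: "\<bar>\<epsilon> j k \<omega>\<bar> / sqrt (real n) \<le> noise_sum j \<omega> / sqrt (real n)" if "k \<in> I j" for k
    using abs_noise_le[OF that j] by (intro divide_right_mono) auto
  consider "j \<le> J0" | "J0 < j" "j \<le> J n" "\<omega> \<notin> bad" | "J0 < j" "j \<le> J n" "\<omega> \<in> bad" | "J0 < j" "J n < j" by linarith
  then show ?thesis
  proof cases
    case 1
    show ?thesis
    proof (rule sup)
      fix k assume k: "k \<in> I j"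
      have "\<bar>e \<omega> j k\<bar> = \<bar>\<epsilon> j k \<omega>\<bar> / sqrt (real n)" using 1 by (simp add: error_coeff_def y_def)
      also have "\<dots> \<le> ?m" using S[OF k] D 1 by (simp add: remainder_def)
      finally show "\<bar>e \<omega> j k\<bar> \<le> ?m" .
    qed
  next
    case 2
    have "level_weight p j * Lp_norm p (count_space (I j)) (e \<omega> j) \<le> ennreal (cu * 2 powr (of_int j / 2) * D)"
      using 2 by (intro good)
    also have "\<dots> \<le> ennreal (cu * 2 powr (of_int j / 2) * ?m)"
      using cu remainder_nonneg by (intro ennreal_leI mult_left_mono) auto
    finally show ?thesis .
  next
    case 3
    interpret resolution_level I n "y \<omega>" j using resolution_level[OF j] .
    show ?thesis
    proof (rule sup)
      fix k assume k: "k \<in> I j"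
      have "\<bar>e \<omega> j k\<bar> \<le> \<bar>y \<omega> j k\<bar> + \<bar>y \<omega> j k - d j k\<bar>"
        using 3 truncated_coeff_diff_le[of k] by (simp add: error_coeff_def)
      also have "\<dots> \<le> B j + 2 * (\<bar>\<epsilon> j k \<omega>\<bar> / sqrt (real n))"
      proof -
        have "\<bar>y \<omega> j k - d j k\<bar> = \<bar>\<epsilon> j k \<omega>\<bar> / sqrt (real n)" by (simp add: y_def)
        then show ?thesis using d_bound[OF j k] by linarith
      qed
      also have "\<dots> \<le> B j + 2 * (noise_sum j \<omega> / sqrt (real n))" using S[OF k] by simp
      also have "\<dots> \<le> ?m" using D 3 by (simp add: remainder_def)
      finally show "\<bar>e \<omega> j k\<bar> \<le> ?m" .
    qed
  next
    case 4
    show ?thesis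
    proof (rule sup)
      fix k assume k: "k \<in> I j"
      have "\<bar>e \<omega> j k\<bar> = \<bar>d j k\<bar>" using 4 by (simp add: error_coeff_def)
      also have "\<dots> \<le> ?m" using d_bound[OF j k] tail[OF 4] remainder_nonneg[of j \<omega>] by linarith
      finally show "\<bar>e \<omega> j k\<bar> \<le> ?m" .
    qed
  qed
qed

text \<open>Monotone convergence moves the expectation into the series over levels, where
  \<open>D\<close> is deterministic and \<open>remainder\<close> has known mean. The series is the
  supremum of its partial sums, so bounds over finite sets of levels suffice.\<close>

lemma risk_le:
  assumes p: "1 \<le> p"
    and bound: "\<And>d f. has_expansion I b d f \<Longrightarrow> Lp_norm p unit_measure f \<le>
      ennreal C0 * (\<Sum>i. level_weight p (int i - 1) * Lp_norm p (count_space (I (int i - 1))) (d (int i - 1)))"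
    and f: "has_expansion I b d f" and D: "\<And>j. 0 \<le> D j"
    and good: "\<And>j \<omega>. \<omega> \<in> space M - bad \<Longrightarrow> J0 < j \<Longrightarrow> j \<le> J n \<Longrightarrow>
      level_weight p j * Lp_norm p (count_space (I j)) (e \<omega> j) \<le> ennreal (cu * 2 powr (of_int j / 2) * D j)"
    and tail: "\<And>j. J0 < j \<Longrightarrow> J n < j \<Longrightarrow> B j \<le> D j"
    and sum: "\<And>F. finite F \<Longrightarrow> (\<And>j. j \<in> F \<Longrightarrow> -1 \<le> j) \<Longrightarrow>
      (\<Sum>j\<in>F. 2 powr (of_int j / 2) * (D j + remainder_bound j)) \<le> R"
  shows "(\<integral>\<^sup>+\<omega>. Lp_norm p unit_measure (\<lambda>x. estimator I b J n (y \<omega>) x - f x) \<partial>M) \<le> ennreal C0 * ennreal (cu * R)"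
proof -
  let ?j = "\<lambda>i::nat. int i - 1"
  let ?w = "\<lambda>i. cu * 2 powr (of_int (?j i) / 2)"
  have w: "0 \<le> ?w i" for i using cu by simp
  have "(\<integral>\<^sup>+\<omega>. Lp_norm p unit_measure (\<lambda>x. estimator I b J n (y \<omega>) x - f x) \<partial>M) \<le>
     (\<integral>\<^sup>+\<omega>. ennreal C0 * (\<Sum>i. ennreal (?w i * (D (?j i) + remainder (?j i) \<omega>))) \<partial>M)"
  proof (rule nn_integral_mono)
    fix \<omega> assume \<omega>: "\<omega> \<in> space M"
    have "Lp_norm p unit_measure (\<lambda>x. estimator I b J n (y \<omega>) x - f x) \<le>
      ennreal C0 * (\<Sum>i. level_weight p (?j i) * Lp_norm p (count_space (I (?j i))) (e \<omega> (?j i)))"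
      by (rule bound[OF estimator_error_expansion[OF f J0_lower]])
    also have "\<dots> \<le> ennreal C0 * (\<Sum>i. ennreal (?w i * (D (?j i) + remainder (?j i) \<omega>)))"
    proof (intro mult_left_mono suminf_le)
      fix i
      show "level_weight p (?j i) * Lp_norm p (count_space (I (?j i))) (e \<omega> (?j i)) \<le>
          ennreal (?w i * (D (?j i) + remainder (?j i) \<omega>))"
        by (rule level_error_le[OF p _ \<omega> D]) (use good[of \<omega> "?j i"] tail[of "?j i"] \<omega> in auto)
    qed auto
    finally show "Lp_norm p unit_measure (\<lambda>x. estimator I b J n (y \<omega>) x - f x) \<le>
      ennreal C0 * (\<Sum>i. ennreal (?w i * (D (?j i) + remainder (?j i) \<omega>)))" .
  qed
  also have "\<dots> = ennreal C0 * (\<Sum>i. \<integral>\<^sup>+\<omega>. ennreal (?w i * (D (?j i) + remainder (?j i) \<omega>)) \<partial>M)"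
  proof -
    have m: "(\<lambda>\<omega>. ennreal (?w i * (D (?j i) + remainder (?j i) \<omega>))) \<in> borel_measurable M" for i
      by (rule measurable_compose[OF _ measurable_ennreal])
        (intro borel_measurable_times borel_measurable_add borel_measurable_const borel_measurable_integrable remainder_moment, simp)
    have "(\<integral>\<^sup>+\<omega>. ennreal C0 * (\<Sum>i. ennreal (?w i * (D (?j i) + remainder (?j i) \<omega>))) \<partial>M) =
        ennreal C0 * (\<integral>\<^sup>+\<omega>. (\<Sum>i. ennreal (?w i * (D (?j i) + remainder (?j i) \<omega>))) \<partial>M)"
      by (rule nn_integral_cmult[OF borel_measurable_suminf_order[OF m]])
    also have "(\<integral>\<^sup>+\<omega>. (\<Sum>i. ennreal (?w i * (D (?j i) + remainder (?j i) \<omega>))) \<partial>M) =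
        (\<Sum>i. \<integral>\<^sup>+\<omega>. ennreal (?w i * (D (?j i) + remainder (?j i) \<omega>)) \<partial>M)"
      by (rule nn_integral_suminf[OF m])
    finally show ?thesis .
  qed
  also have "(\<Sum>i. \<integral>\<^sup>+\<omega>. ennreal (?w i * (D (?j i) + remainder (?j i) \<omega>)) \<partial>M) \<le>
     (\<Sum>i. ennreal (?w i * (D (?j i) + remainder_bound (?j i))))"
  proof (rule suminf_le)
    fix i
    note r = remainder_moment[of "?j i"]
    have int: "integrable M (\<lambda>\<omega>. ?w i * (D (?j i) + remainder (?j i) \<omega>))" using r by simp
    have "(\<integral>\<^sup>+\<omega>. ennreal (?w i * (D (?j i) + remainder (?j i) \<omega>)) \<partial>M) = ennreal (\<integral>\<omega>. ?w i * (D (?j i) + remainder (?j i) \<omega>) \<partial>M)"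
      using cu D remainder_nonneg by (intro nn_integral_eq_integral int AE_I2 mult_nonneg_nonneg add_nonneg_nonneg) auto
    also have "(\<integral>\<omega>. ?w i * (D (?j i) + remainder (?j i) \<omega>) \<partial>M) = ?w i * (D (?j i) + (\<integral>\<omega>. remainder (?j i) \<omega> \<partial>M))"
      using r by (simp add: prob_space)
    also have "ennreal \<dots> \<le> ennreal (?w i * (D (?j i) + remainder_bound (?j i)))"
      using r w by (intro ennreal_leI mult_left_mono add_left_mono) auto
    finally show "(\<integral>\<^sup>+\<omega>. ennreal (?w i * (D (?j i) + remainder (?j i) \<omega>)) \<partial>M) \<le> ennreal (?w i * (D (?j i) + remainder_bound (?j i)))" .
  qed auto
  also have "\<dots> \<le> ennreal (cu * R)"
    unfolding suminf_eq_SUP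
  proof (rule SUP_least)
    fix m
    have rb: "0 \<le> remainder_bound (?j i)" for i
    proof -
      have "0 \<le> (\<integral>\<omega>. remainder (?j i) \<omega> \<partial>M)" by (simp add: integral_nonneg_AE remainder_nonneg)
      also have "\<dots> \<le> remainder_bound (?j i)" by (rule remainder_moment) simp
      finally show ?thesis .
    qed
    have "(\<Sum>i<m. ennreal (?w i * (D (?j i) + remainder_bound (?j i)))) = ennreal (\<Sum>i<m. ?w i * (D (?j i) + remainder_bound (?j i)))"
      using cu D rb by (intro sum_ennreal mult_nonneg_nonneg add_nonneg_nonneg) auto
    also have "(\<Sum>i<m. ?w i * (D (?j i) + remainder_bound (?j i))) =
        cu * (\<Sum>j\<in>?j ` {..<m}. 2 powr (of_int j / 2) * (D j + remainder_bound j))"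
      by (subst sum.reindex) (auto simp: inj_on_def sum_distrib_left mult.assoc)
    also have "\<dots> \<le> cu * R" using cu by (intro mult_left_mono sum) auto
    finally show "(\<Sum>i<m. ennreal (?w i * (D (?j i) + remainder_bound (?j i)))) \<le> ennreal (cu * R)"
      by (simp add: ennreal_leI)
  qed
  finally show ?thesis by (simp add: mult_left_mono)
qed

lemma sum_level_sizes_le:
  assumes F: "finite F" "\<And>j. j \<in> F \<Longrightarrow> -1 \<le> j" "\<And>j. j \<in> F \<Longrightarrow> 2 powr of_int j \<le> x" and x: "x > 0"
  shows "(\<Sum>j\<in>F. 2 powr (of_int j / 2) * N j) \<le> cu * (x powr (3/2) / (1 - 2 powr (-(3/2))))"
    and "(\<Sum>j\<in>F. N j) \<le> cu * (2 * x)"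
proof -
  have "(\<Sum>j\<in>F. 2 powr (of_int j / 2) * N j) \<le> (\<Sum>j\<in>F. cu * 2 powr (3/2 * of_int j))"
  proof (rule sum_mono)
    fix j assume "j \<in> F"
    then have "2 powr (of_int j / 2) * N j \<le> 2 powr (of_int j / 2) * (cu * 2 powr of_int j)"
      by (intro mult_left_mono card_upper F) auto
    also have "\<dots> = cu * (2 powr (of_int j / 2) * 2 powr of_int j)" by simp
    also have "2 powr (of_int j / 2) * 2 powr of_int j = (2::real) powr (3/2 * of_int j)"
      unfolding powr_add[symmetric] by (simp add: algebra_simps)
    finally show "2 powr (of_int j / 2) * N j \<le> cu * 2 powr (3/2 * of_int j)" .
  qed
  also have "\<dots> = cu * (\<Sum>j\<in>F. 2 powr (3/2 * of_int j))" by (simp add: sum_distrib_left)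
  also have "\<dots> \<le> cu * (x powr (3/2) / (1 - 2 powr (-(3/2))))"
    using cu F x by (intro mult_left_mono dyadic_sum_upper) auto
  finally show "(\<Sum>j\<in>F. 2 powr (of_int j / 2) * N j) \<le> cu * (x powr (3/2) / (1 - 2 powr (-(3/2))))" .
  have "(\<Sum>j\<in>F. N j) \<le> (\<Sum>j\<in>F. cu * 2 powr (1 * of_int j))"
    using card_upper F by (intro sum_mono) simp
  also have "\<dots> = cu * (\<Sum>j\<in>F. 2 powr (1 * of_int j))" by (simp only: sum_distrib_left)
  also have "\<dots> \<le> cu * (x powr 1 / (1 - 2 powr (-1)))"
    using cu F x by (intro mult_left_mono dyadic_sum_upper) auto
  finally show "(\<Sum>j\<in>F. N j) \<le> cu * (2 * x)" using x by (simp add: powr_minus)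
qed

lemma prob_bad_le:
  assumes J: "2 powr of_int (J n) \<le> cJ * real n" and cJ: "cJ > 0"
  shows "prob bad \<le> cu * (2 * (cJ * real n)) * (2 * real n powr (-4.2) + real n powr (-5))"
proof -
  have "prob bad \<le> (\<Sum>j\<in>{J0 + 1..J n}. N j) * (2 * real n powr (-4.2) + real n powr (-5))"
    using prob_bad by (simp add: sum_distrib_right)
  also have "\<dots> \<le> cu * (2 * (cJ * real n)) * (2 * real n powr (-4.2) + real n powr (-5))"
  proof (intro mult_right_mono sum_level_sizes_le)
    fix j assume j: "j \<in> {J0 + 1..J n}"
    then show "-1 \<le> j" using J0_lower by auto
    have "(2::real) powr of_int j \<le> 2 powr of_int (J n)" using j by (intro powr_mono) auto
    then show "2 powr of_int j \<le> cJ * real n" using J by linarith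
  qed (use cJ n in auto)
  finally show ?thesis .
qed

text \<open>The three terms come from the noise on the levels up to \<open>J0\<close>, from the
  noise on \<open>bad\<close> and from the signal on \<open>bad\<close>. Up to factors n^(o(1)) each
  is at most of order n^(-1/2), hence negligible against the rate.\<close>

lemma sum_remainder_bound_le:
  assumes J: "2 powr of_int (J n) \<le> cJ * real n" and cJ: "cJ > 0"
    and bad: "prob bad \<le> real n powr (-3)"
    and CB: "\<And>F. finite F \<Longrightarrow> (\<And>j. j \<in> F \<Longrightarrow> -1 \<le> j) \<Longrightarrow> (\<Sum>j\<in>F. 2 powr (of_int j / 2) * B j) \<le> CB"
    and F: "finite F" "\<And>j. j \<in> F \<Longrightarrow> -1 \<le> j"
  shows "(\<Sum>j\<in>F. 2 powr (of_int j / 2) * remainder_bound j) \<le>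
    cu * (((2 / cl + 1) * real n powr (1 / ln (ln (real n)))) powr (3/2) / (1 - 2 powr (-(3/2)))) * real n powr (-1/2)
    + cu * ((cJ * real n) powr (3/2) / (1 - 2 powr (-(3/2)))) * (2 * real n powr (-3/2) * real n powr (-1/2))
    + real n powr (-3) * CB"
proof -
  let ?A = "{j \<in> F. j \<le> J0}" and ?C = "{j \<in> F. J0 < j \<and> j \<le> J n}"
  let ?t = "2 * real n powr (-3/2) * real n powr (-1/2)"
  have q: "1 / sqrt (real n) = real n powr (-1/2)" using n by (simp add: powr_half_sqrt powr_minus_divide)
  have div: "x / sqrt (real n) = x * real n powr (-1/2)" for x unfolding q[symmetric] by simp
  have rb: "2 powr (of_int j / 2) * remainder_bound j \<le>
      (if j \<le> J0 then 2 powr (of_int j / 2) * N j * real n powr (-1/2) else 0) +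
      (if J0 < j \<and> j \<le> J n then 2 powr (of_int j / 2) * N j * ?t else 0) +
      real n powr (-3) * (2 powr (of_int j / 2) * B j)" for j
  proof -
    have "real n powr (3/2) * prob bad \<le> real n powr (3/2) * real n powr (-3)"
      using bad by (intro mult_left_mono) auto
    also have "\<dots> = real n powr (-3/2)" unfolding powr_add[symmetric] by simp
    finally have "real n powr (3/2) * prob bad + real n powr (-3/2) \<le> 2 * real n powr (-3/2)" by simp
    then have 1: "N j * (real n powr (3/2) * prob bad + real n powr (-3/2)) * real n powr (-1/2) \<le> N j * (2 * real n powr (-3/2)) * real n powr (-1/2)"
      by (intro mult_left_mono mult_right_mono) auto
    have 2: "prob bad * B j \<le> real n powr (-3) * B j"
      using bad B_pos[of j] by (intro mult_right_mono) auto
    have 3: "0 \<le> real n powr (-3) * B j" using B_pos[of j] by simp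
    have "remainder_bound j \<le> (if j \<le> J0 then N j * real n powr (-1/2) else 0) +
      (if J0 < j \<and> j \<le> J n then N j * ?t else 0) + real n powr (-3) * B j"
      unfolding remainder_bound_def div
      using 1 2 3 by (simp add: mult.assoc)
    then have "2 powr (of_int j / 2) * remainder_bound j \<le> 2 powr (of_int j / 2) *
      ((if j \<le> J0 then N j * real n powr (-1/2) else 0) +
      (if J0 < j \<and> j \<le> J n then N j * ?t else 0) + real n powr (-3) * B j)"
      by (rule mult_left_mono) simp
    then show ?thesis by (simp add: distrib_left mult.assoc mult.left_commute split: if_split_asm)
  qed
  have "(\<Sum>j\<in>F. 2 powr (of_int j / 2) * remainder_bound j) \<le>
      (\<Sum>j\<in>F. if j \<le> J0 then 2 powr (of_int j / 2) * N j * real n powr (-1/2) else 0) +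
      (\<Sum>j\<in>F. if J0 < j \<and> j \<le> J n then 2 powr (of_int j / 2) * N j * ?t else 0) +
      (\<Sum>j\<in>F. real n powr (-3) * (2 powr (of_int j / 2) * B j))"
    unfolding sum.distrib[symmetric] by (rule sum_mono) (rule rb)
  also have "(\<Sum>j\<in>F. if j \<le> J0 then 2 powr (of_int j / 2) * N j * real n powr (-1/2) else 0) =
      (\<Sum>j\<in>?A. 2 powr (of_int j / 2) * N j) * real n powr (-1/2)"
    unfolding sum_distrib_right by (rule sum.inter_filter[OF F(1), symmetric])
  also have "(\<Sum>j\<in>F. if J0 < j \<and> j \<le> J n then 2 powr (of_int j / 2) * N j * ?t else 0) =
      (\<Sum>j\<in>?C. 2 powr (of_int j / 2) * N j) * ?t"
    unfolding sum_distrib_right by (rule sum.inter_filter[OF F(1), symmetric])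
  also have "(\<Sum>j\<in>F. real n powr (-3) * (2 powr (of_int j / 2) * B j)) = real n powr (-3) * (\<Sum>j\<in>F. 2 powr (of_int j / 2) * B j)"
    by (simp only: sum_distrib_left)
  also have "(\<Sum>j\<in>?A. 2 powr (of_int j / 2) * N j) * real n powr (-1/2) \<le>
     cu * (((2 / cl + 1) * real n powr (1 / ln (ln (real n)))) powr (3/2) / (1 - 2 powr (-(3/2)))) * real n powr (-1/2)"
  proof (intro mult_right_mono sum_level_sizes_le)
    fix j assume j: "j \<in> ?A"
    then have "(2::real) powr of_int j \<le> 2 powr of_int J0" by (intro powr_mono) auto
    then show "2 powr of_int j \<le> (2 / cl + 1) * real n powr (1 / ln (ln (real n)))" using J0_upper by linarith
  qed (use F n cl in \<open>auto intro!: mult_pos_pos add_pos_pos\<close>)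
  also have "(\<Sum>j\<in>?C. 2 powr (of_int j / 2) * N j) * ?t \<le>
     cu * ((cJ * real n) powr (3/2) / (1 - 2 powr (-(3/2)))) * ?t"
  proof (intro mult_right_mono sum_level_sizes_le)
    fix j assume j: "j \<in> ?C"
    then have "(2::real) powr of_int j \<le> 2 powr of_int (J n)" by (intro powr_mono) auto
    then show "2 powr of_int j \<le> cJ * real n" using J by linarith
  qed (use F n cJ in auto)
  also have "real n powr (-3) * (\<Sum>j\<in>F. 2 powr (of_int j / 2) * B j) \<le> real n powr (-3) * CB"
    using CB[OF F] by (intro mult_left_mono) auto
  finally show ?thesis by simp
qed

section \<open>Risk with the cutoff between noise and bias at either noise scale\<close>

context
  fixes p :: ennreal and C0 CV E :: real and f :: "real \<Rightarrow> real"
  assumes p: "1 \<le> p"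
    and bound: "\<And>d f. has_expansion I b d f \<Longrightarrow> Lp_norm p unit_measure f \<le>
      ennreal C0 * (\<Sum>i. level_weight p (int i - 1) * Lp_norm p (count_space (I (int i - 1))) (d (int i - 1)))"
    and f: "has_expansion I b d f"
    and tail: "\<And>j. J n < j \<Longrightarrow> B j \<le> 1/10 * real n powr (-1/2)"
    and rem: "\<And>F. finite F \<Longrightarrow> (\<And>j. j \<in> F \<Longrightarrow> -1 \<le> j) \<Longrightarrow> (\<Sum>j\<in>F. 2 powr (of_int j / 2) * remainder_bound j) \<le> E"
    and CV: "\<And>s T F. s > 0 \<Longrightarrow> T \<ge> 0 \<Longrightarrow> finite F \<Longrightarrow>
      (\<Sum>j\<in>F. 2 powr (of_int j / 2) * (if B j > 1/10 * s then T * s else 5 * B j)) \<le> CV * (T + 1) * s powr (2 * \<beta> / (2 * \<beta> + 1))"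
begin

text \<open>\<open>a\<close> will be sqrt(log n / n) for the sup-norm rate and n^(-1/2) for the
  other. Since \<open>a\<close> is at least n^(-1/2), \<open>tail\<close> places all levels beyond
  \<open>J n\<close> in the bias regime, where 5B also covers the omitted coefficients.\<close>

lemma risk_le_of_threshold:
  assumes a: "a > 0" "real n powr (-1/2) \<le> a" and T: "T \<ge> 0"
    and good: "\<And>j \<omega>. \<omega> \<in> space M - bad \<Longrightarrow> J0 < j \<Longrightarrow> j \<le> J n \<Longrightarrow>
      level_weight p j * Lp_norm p (count_space (I j)) (e \<omega> j) \<le>
        ennreal (cu * 2 powr (of_int j / 2) * (if B j > 1/10 * a then T * a else 5 * B j))"
  shows "(\<integral>\<^sup>+\<omega>. Lp_norm p unit_measure (\<lambda>x. estimator I b J n (y \<omega>) x - f x) \<partial>M) \<le>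
    ennreal C0 * ennreal (cu * (CV * (T + 1) * a powr (2 * \<beta> / (2 * \<beta> + 1)) + E))"
proof (rule risk_le[OF p bound f _ good])
  show "0 \<le> (if B j > 1/10 * a then T * a else 5 * B j)" for j
    using a T B_pos[of j] by simp
  show "B j \<le> (if B j > 1/10 * a then T * a else 5 * B j)" if "J n < j" for j
    using tail[OF that] a B_pos[of j] by simp
  show "(\<Sum>j\<in>F. 2 powr (of_int j / 2) * ((if B j > 1/10 * a then T * a else 5 * B j) + remainder_bound j)) \<le>
      CV * (T + 1) * a powr (2 * \<beta> / (2 * \<beta> + 1)) + E"
    if "finite F" "\<And>j. j \<in> F \<Longrightarrow> -1 \<le> j" for F
    using add_mono[OF CV[OF a(1) T that(1)] rem[OF that]] by (simp only: distrib_left sum.distrib)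
qed

lemma sqrt_log_ratio: "real n powr (-1/2) \<le> sqrt (ln (real n) / real n)" "sqrt (ln (real n) / real n) > 0"
proof -
  have "real n powr (-1/2) = sqrt (1 / real n)"
    using n by (simp add: powr_minus_divide powr_half_sqrt real_sqrt_divide)
  also have "\<dots> \<le> sqrt (ln (real n) / real n)" using log_n n by (simp add: divide_right_mono)
  finally show "real n powr (-1/2) \<le> sqrt (ln (real n) / real n)" .
  have "0 < ln (real n)" using log_n by linarith
  then show "sqrt (ln (real n) / real n) > 0" using n by simp
qed

lemma risk_le_sup:
  "(\<integral>\<^sup>+\<omega>. Lp_norm p unit_measure (\<lambda>x. estimator I b J n (y \<omega>) x - f x) \<partial>M) \<le>
    ennreal C0 * ennreal (cu * (CV * 7 * sqrt (ln (real n) / real n) powr (2 * \<beta> / (2 * \<beta> + 1)) + E))"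
proof -
  let ?s = "sqrt (ln (real n) / real n)"
  have "(\<integral>\<^sup>+\<omega>. Lp_norm p unit_measure (\<lambda>x. estimator I b J n (y \<omega>) x - f x) \<partial>M) \<le>
    ennreal C0 * ennreal (cu * (CV * (6 + 1) * ?s powr (2 * \<beta> / (2 * \<beta> + 1)) + E))"
  proof (rule risk_le_of_threshold[OF sqrt_log_ratio(2,1)])
    fix j \<omega> assume \<omega>: "\<omega> \<in> space M - bad" and j: "J0 < j" "j \<le> J n"
    then have j': "-1 \<le> j" using J0_lower by simp
    show "level_weight p j * Lp_norm p (count_space (I j)) (e \<omega> j) \<le>
        ennreal (cu * 2 powr (of_int j / 2) * (if B j > 1/10 * ?s then 6 * ?s else 5 * B j))"
      using sqrt_log_ratio(2) B_pos[of j]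
      by (intro level_norm_le_sup[OF finite_index[OF j'] card_upper[OF j'] cu p] good_error_sup[OF \<omega> j]) auto
  qed simp
  then show ?thesis by simp
qed

text \<open>With the smaller cutoff n^(-1/2), a level above it is bounded by its power mean of order
  \<open>q\<close>, free of log n. A level below it is also below the cutoff with log n, so
  \<open>good_error_sup\<close> still gives 5B.\<close>

lemma risk_le_power:
  assumes q: "q \<in> exponents n" and pq: "p < \<top>" "enn2real p \<le> real q" "real q \<le> 2 * enn2real p"
  shows "(\<integral>\<^sup>+\<omega>. Lp_norm p unit_measure (\<lambda>x. estimator I b J n (y \<omega>) x - f x) \<partial>M) \<le>
    ennreal C0 * ennreal (cu * (CV * (16 * (6 * sqrt 2 * exp 1 + 1) * sqrt (enn2real p) + 1) *
      (real n powr (-1/2)) powr (2 * \<beta> / (2 * \<beta> + 1)) + E))"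
proof -
  let ?c = "6 * sqrt 2 * exp 1 + 1 :: real" and ?P = "enn2real p"
  let ?s = "real n powr (-1/2)" and ?T = "16 * ?c * sqrt (enn2real p)"
  have P: "1 \<le> ?P" using p pq(1) enn2real_mono[of 1 p] by simp
  have q1: "q > 0" using P pq(2) by simp
  have s: "?s > 0" using n by simp
  have q': "1 / sqrt (real n) = ?s" using n by (simp add: powr_half_sqrt powr_minus_divide)
  have c: "0 < ?c" by (intro add_nonneg_pos) auto
  show ?thesis
  proof (rule risk_le_of_threshold[OF s order_refl])
    show "0 \<le> ?T" using c P by simp
    fix j \<omega> assume \<omega>: "\<omega> \<in> space M - bad" and j: "J0 < j" "j \<le> J n"
    then have j': "-1 \<le> j" using J0_lower by simp
    show "level_weight p j * Lp_norm p (count_space (I j)) (e \<omega> j) \<le>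
        ennreal (cu * 2 powr (of_int j / 2) * (if B j > 1/10 * ?s then ?T * ?s else 5 * B j))"
    proof (cases "B j > 1/10 * ?s")
      case True
      let ?m = "4 * ?c * sqrt (real q) * ?s"
      have m: "?m > 0" using c q1 s by (intro mult_pos_pos) auto
      have sum: "(\<Sum>k\<in>I j. \<bar>e \<omega> j k\<bar> powr ?P) \<le> N j * (2 * ?m) powr ?P"
        using good_error_power_sum[OF \<omega> j q] unfolding q'
        by (rule power_sum_lower_exponent[OF finite_index[OF j'] m P pq(2) q1])
      have m0: "0 \<le> 2 * ?m" using m by linarith
      have "level_weight p j * Lp_norm p (count_space (I j)) (e \<omega> j) \<le> ennreal (cu * 2 powr (of_int j / 2) * (2 * ?m))"
        by (rule level_norm_le_power[OF finite_index[OF j'] card_upper[OF j'] cu p pq(1) m0 sum])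
      also have "\<dots> \<le> ennreal (cu * 2 powr (of_int j / 2) * (?T * ?s))"
      proof (intro ennreal_leI mult_left_mono)
        \<comment> \<open>From q \<le> 2p, loosened to 4p for a rational root. The constant 16 is 4
          from truncation, 2 from lowering the exponent and 2 from here.\<close>
        have "sqrt (real q) \<le> sqrt (4 * ?P)" using pq P by (intro real_sqrt_le_mono) auto
        then have "sqrt (real q) \<le> 2 * sqrt ?P" by (simp add: real_sqrt_mult)
        then have le: "8 * ?c * ?s * sqrt (real q) \<le> 8 * ?c * ?s * (2 * sqrt ?P)"
          using c s by (intro mult_left_mono) auto
        have "2 * (4 * c * u * v) \<le> 16 * c * w * v" if "8 * c * v * u \<le> 8 * c * v * (2 * w)" for c u v w :: real
          using that by (simp add: mult_ac)
        from this[OF le] show "2 * ?m \<le> ?T * ?s" .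
      qed (use cu in auto)
      finally show ?thesis using True by simp
    next
      case False
      then have small: "\<not> B j > 1/10 * sqrt (ln (real n) / real n)" using sqrt_log_ratio(1) by simp
      have "level_weight p j * Lp_norm p (count_space (I j)) (e \<omega> j) \<le> ennreal (cu * 2 powr (of_int j / 2) * (5 * B j))"
        using B_pos[of j] good_error_sup[OF \<omega> j] small
        by (intro level_norm_le_sup[OF finite_index[OF j'] card_upper[OF j'] cu p]) auto
      then show ?thesis using False by simp
    qed
  qed
qed

end

end

subsection \<open>Uniform risk bounds\<close>

context brownian_motion
begin

text \<open>Solving for the noise defines \<epsilon> for all pairs of indices, so the representation
  is an identity, with the version of the integral chosen by \<open>stoch_integral\<close>.
  Continuity and orthonormality of the basis enter only for the law of \<epsilon>.\<close>

lemma white_noise_coefficients: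
  assumes basis: "interval_wavelet_basis \<phi> \<psi> s I b" and f: "has_expansion I b d f" and n: "n > 0"
  obtains \<epsilon> where
    "\<And>j. -1 \<le> j \<Longrightarrow> indep_vars (\<lambda>_. borel) (\<epsilon> j) (I j)"
    "\<And>j k. -1 \<le> j \<Longrightarrow> k \<in> I j \<Longrightarrow> distr M borel (\<epsilon> j k) = std_normal_distribution"
    "\<And>j k \<omega>. stoch_integral M (white_noise W n f) (b j k) \<omega> = d j k + \<epsilon> j k \<omega> / sqrt (real n)"
proof -
  interpret interval_wavelet_basis \<phi> \<psi> s I b by (rule basis)
  define \<epsilon> where "\<epsilon> j k \<omega> = sqrt (real n) * (stoch_integral M (white_noise W n f) (b j k) \<omega> - d j k)" for j k \<omega>
  have \<epsilon>: "has_stoch_integral M W (b j k) (\<epsilon> j k)" if "-1 \<le> j" "k \<in> I j" for j k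
    using stoch_integral_white_noise[OF has_expansion_square_integrable[OF f] basis_continuous[OF that] n]
    unfolding has_expansion_coeff[OF f that] \<epsilon>_def[abs_def] .
  show ?thesis
  proof (rule that[of \<epsilon>])
    fix j :: int assume j: "-1 \<le> j"
    note orth = orthonormal_stoch_integrals[OF finite_index[OF j] basis_continuous[OF j] \<epsilon>[OF j]]
    have on: "(\<integral>x. b j k x * b j l x \<partial>unit_measure) = (if k = l then 1 else 0)" if "k \<in> I j" "l \<in> I j" for k l
      using basis_orthonormal[OF j that(1) j that(2)] by simp
    show "indep_vars (\<lambda>_. borel) (\<epsilon> j) (I j)" by (rule orth(1)) (auto simp: on)
    show "distr M borel (\<epsilon> j k) = std_normal_distribution" if "k \<in> I j" for k
      by (rule orth(2)) (auto simp: on that)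
  qed (use n in \<open>simp add: \<epsilon>_def\<close>)
qed

end

text \<open>The bias beyond \<open>J n\<close> is negligible because \<beta> + 1/2 > 1/2, the union
  bound gives n^(-3.2) up to a constant, and the remainder terms lie below n^(-r) because r < 1/2;
  each of the three gets a third of it.\<close>

lemma eventually_sample_size_conditions:
  fixes cu cl c g CB Q r \<beta> cJ :: real
  assumes pos: "cu > 0" "cl > 0" "c > 0" "g > 0" "CB > 0" "cJ > 0" "Q > 0" "\<beta> > 0" and r: "0 < r" "r < 1/2"
  shows "\<forall>\<^sub>F n::nat in sequentially. real n > 0 \<and> ln (real n) > 1 \<and> ln (ln (real n)) \<ge> 1 \<and>
    Q * (cJ * real n) powr (- (\<beta> + 1/2)) \<le> 1/10 * real n powr (-1/2) \<and>
    cu * (2 * (c * real n)) * (2 * real n powr (-4.2) + real n powr (-5)) \<le> real n powr (-3) \<and>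
    cu * (((2 / cl + 1) * real n powr (1 / ln (ln (real n)))) powr (3/2) / g) * real n powr (-1/2)
    + cu * ((c * real n) powr (3/2) / g) * (2 * real n powr (-3/2) * real n powr (-1/2))
    + real n powr (-3) * CB \<le> real n powr (-r)"
proof -
  define h where "h = 2 / cl + 1"
  have h: "h > 0" using pos by (simp add: h_def add_pos_pos)
  have 1: "\<forall>\<^sub>F n::nat in sequentially. real n > 0" "\<forall>\<^sub>F n::nat in sequentially. ln (real n) > 1"
    "\<forall>\<^sub>F n::nat in sequentially. ln (ln (real n)) \<ge> 1"
    by real_asymp+
  have 2: "\<forall>\<^sub>F n::nat in sequentially. Q * (cJ * real n) powr (- (\<beta> + 1/2)) \<le> 1/10 * real n powr (-1/2)"
    using pos by real_asymp
  have 3: "\<forall>\<^sub>F n::nat in sequentially. cu * (2 * (c * real n)) * (2 * real n powr (-4.2) + real n powr (-5)) \<le> real n powr (-3)"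
    using pos by real_asymp
  have 4: "\<forall>\<^sub>F n::nat in sequentially. cu * ((h * real n powr (1 / ln (ln (real n)))) powr (3/2) / g) * real n powr (-1/2)
    \<le> 1/3 * real n powr (-r)"
    using pos h r by real_asymp
  have 5: "\<forall>\<^sub>F n::nat in sequentially. cu * ((c * real n) powr (3/2) / g) * (2 * real n powr (-3/2) * real n powr (-1/2)) \<le> 1/3 * real n powr (-r)"
    using pos r by real_asymp
  have 6: "\<forall>\<^sub>F n::nat in sequentially. real n powr (-3) * CB \<le> 1/3 * real n powr (-r)"
    using pos r by real_asymp
  show ?thesis using 1 2 3 4 5 6 unfolding h_def
  proof eventually_elim
    case (elim n)
    show ?case by (intro conjI) (fact elim | (use elim(6-8) in linarith))+
  qed
qed

text \<open>The conditions on \<open>n\<close> involve neither the loss exponent nor the regression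
  function, so one constant and one minimal sample size serve all of them; only the noise variables
  are rebuilt for each \<open>f\<close>.\<close>

lemma uniform_risk_bound:
  fixes M :: "'w measure" and W :: "real \<Rightarrow> 'w \<Rightarrow> real"
  assumes BM: "brownian_motion M W" and basis: "interval_wavelet_basis \<phi> \<psi> s I b"
    and J: "comparable_on {1..} (\<lambda>n. 2 powr of_int (J n)) real"
    and \<beta>: "\<beta> > 0" and Q: "Q > 0"
  defines "r \<equiv> \<beta> / (2 * \<beta> + 1)"
  obtains C where "C > 0" "\<forall>\<^sub>F n in sequentially. \<forall>p\<ge>1. \<forall>f\<in>param_space I b \<beta> Q.
    risk M W I b J n p f \<le> ennreal (C * (real n / ln (real n)) powr (-r)) \<and>
    (p < \<top> \<longrightarrow> risk M W I b J n p f \<le> ennreal (C * sqrt (enn2real p) * real n powr (-r)))"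
proof -
  interpret brownian_motion M W by (rule BM)
  interpret interval_wavelet_basis \<phi> \<psi> s I b by (rule basis)
  have r: "0 < r" "r < 1/2" "2 * \<beta> / (2 * \<beta> + 1) = 2 * r"
    using \<beta> by (auto simp: r_def field_simps)
  obtain cl cu0 where cl: "cl > 0" "\<And>j. -1 \<le> j \<Longrightarrow> cl * 2 powr of_int j \<le> real (card (I j))"
    and cu0: "cu0 > 0" "\<And>j. -1 \<le> j \<Longrightarrow> real (card (I j)) \<le> cu0 * 2 powr of_int j"
    using card_index unfolding comparable_on_def by auto
  define cu where "cu = max 1 cu0"
  have cu: "cu \<ge> 1" "\<And>j. -1 \<le> j \<Longrightarrow> real (card (I j)) \<le> cu * 2 powr of_int j"
  proof -
    fix j :: int assume "-1 \<le> j"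
    note cu0(2)[OF this]
    also have "cu0 * 2 powr of_int j \<le> cu * 2 powr of_int j" by (intro mult_right_mono) (auto simp: cu_def)
    finally show "real (card (I j)) \<le> cu * 2 powr of_int j" .
  qed (simp add: cu_def)
  obtain cJ c where cJ: "cJ > 0" "\<And>n. 1 \<le> n \<Longrightarrow> cJ * real n \<le> 2 powr of_int (J n)"
    and c: "c > 0" "\<And>n. 1 \<le> n \<Longrightarrow> 2 powr of_int (J n) \<le> c * real n"
    using J unfolding comparable_on_def by auto
  obtain C0 :: real where C0: "\<And>p d f. 1 \<le> p \<Longrightarrow> has_expansion I b d f \<Longrightarrow> Lp_norm p unit_measure f \<le>
      ennreal C0 * (\<Sum>i. level_weight p (int i - 1) * Lp_norm p (count_space (I (int i - 1))) (d (int i - 1)))"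
    using norm_bound unfolding level_weight_def Let_def by blast
  obtain CB where CB: "CB > 0" "\<And>F. finite F \<Longrightarrow> (\<And>j. j \<in> F \<Longrightarrow> -1 \<le> j) \<Longrightarrow>
      (\<Sum>j\<in>F. 2 powr (of_int j / 2) * coeff_bound \<beta> Q j) \<le> CB"
    using sum_coeff_bound_le[OF \<beta> Q] by metis
  obtain CV where CV: "CV > 0" "\<And>s T F. s > 0 \<Longrightarrow> T \<ge> 0 \<Longrightarrow> finite F \<Longrightarrow>
    (\<Sum>j\<in>F. 2 powr (of_int j / 2) * (if coeff_bound \<beta> Q j > 1/10 * s then T * s else 5 * coeff_bound \<beta> Q j))
      \<le> CV * (T + 1) * s powr (2 * \<beta> / (2 * \<beta> + 1))"
    by (rule bias_variance_sum[OF \<beta> Q, of "1/10"]) auto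
  define k where "k = (6 * sqrt 2 * exp 1 + 1 :: real)"
  have k0: "k \<ge> 0" by (simp add: k_def)
  define C1 where "C1 = \<bar>C0\<bar> * (cu * (CV * 7 + 1))"
  define C2 where "C2 = \<bar>C0\<bar> * (cu * (CV * (16 * k + 1) + 1))"
  define C where "C = C1 + C2 + 1"
  have C12: "C1 \<ge> 0" "C2 \<ge> 0"
    unfolding C1_def C2_def using cu(1) CV(1) k0 by (auto intro!: mult_nonneg_nonneg add_nonneg_nonneg)
  \<comment> \<open>The norm bound does not say that \<open>C0\<close> is nonnegative, and
    \<open>ennreal\<close> sends negative reals to 0; the absolute value covers both signs.\<close>
  have lnat: "ennreal C0 * ennreal x \<le> ennreal (\<bar>C0\<bar> * x)" if "x \<ge> 0" for x
    using that by (subst ennreal_mult) (auto intro!: mult_right_mono ennreal_leI)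
  have g: "(1 - 2 powr (-(3/2)) :: real) > 0" by (simp add: powr_less_one)
  have cu_pos: "cu > 0" and ratio: "cl / cu > 0" using cu(1) cl(1) by auto
  show ?thesis
  proof (rule that[of C])
    show "C > 0" using C12 by (simp add: C_def)
    show "\<forall>\<^sub>F n in sequentially. \<forall>p\<ge>1. \<forall>f\<in>param_space I b \<beta> Q.
      risk M W I b J n p f \<le> ennreal (C * (real n / ln (real n)) powr (-r)) \<and>
      (p < \<top> \<longrightarrow> risk M W I b J n p f \<le> ennreal (C * sqrt (enn2real p) * real n powr (-r)))"
      using eventually_sample_size_conditions[OF cu_pos cl(1) c(1) g CB(1) cJ(1) Q \<beta> r(1,2)]
        eventually_level_size_dominates[OF ratio] eventually_hoeffding_exponent[OF ratio] eventually_exponent_exists[OF r(1,2)]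
    proof eventually_elim
      case (elim n)
      from elim(1) have n: "real n > 0" "ln (real n) > 1" "ln (ln (real n)) \<ge> 1"
        and tail_cond: "Q * (cJ * real n) powr (- (\<beta> + 1/2)) \<le> 1/10 * real n powr (-1/2)"
        and bad_cond: "cu * (2 * (c * real n)) * (2 * real n powr (-4.2) + real n powr (-5)) \<le> real n powr (-3)"
        and rem_cond: "cu * (((2 / cl + 1) * real n powr (1 / ln (ln (real n)))) powr (3/2) / (1 - 2 powr (-(3/2)))) * real n powr (-1/2)
          + cu * ((c * real n) powr (3/2) / (1 - 2 powr (-(3/2)))) * (2 * real n powr (-3/2) * real n powr (-1/2))
          + real n powr (-3) * CB \<le> real n powr (-r)"
        by blast+
      have n1: "1 \<le> n" using n by simp
      have tail: "coeff_bound \<beta> Q j \<le> 1/10 * real n powr (-1/2)" if "J n < j" for j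
      proof -
        have "coeff_bound \<beta> Q j = Q * (2 powr of_int j) powr (- (\<beta> + 1/2))"
          unfolding coeff_bound_def powr_powr by (simp add: algebra_simps)
        also have "\<dots> \<le> Q * (cJ * real n) powr (- (\<beta> + 1/2))"
        proof (intro mult_left_mono powr_mono2')
          have "cJ * real n \<le> 2 powr of_int (J n)" by (rule cJ(2)[OF n1])
          also have "\<dots> \<le> 2 powr of_int j" using that by (intro powr_mono) auto
          finally show "cJ * real n \<le> 2 powr of_int j" .
        qed (use \<beta> Q cJ(1) n in auto)
        finally show ?thesis using tail_cond by linarith
      qed
      have ratio_eq: "sqrt (ln (real n) / real n) powr (2 * r) = (real n / ln (real n)) powr (-r)"
      proof -
        have "sqrt (ln (real n) / real n) powr (2 * r) = (ln (real n) / real n) powr r"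
          using n by (simp add: powr_half_sqrt[symmetric] powr_powr)
        also have "\<dots> = (real n / ln (real n)) powr (-r)"
          using n by (simp add: powr_divide powr_minus field_simps)
        finally show ?thesis .
      qed
      have rate_eq: "(real n powr (-1/2)) powr (2 * r) = real n powr (-r)" by (simp add: powr_powr)
      have rate_log: "(real n / ln (real n)) powr (-r) = ln (real n) powr r * real n powr (-r)"
        using n by (simp add: powr_divide powr_minus field_simps)
      have rate_le: "real n powr (-r) \<le> (real n / ln (real n)) powr (-r)"
        unfolding rate_log using n r ge_one_powr_ge_zero[of "ln (real n)" r] by (simp add: mult_le_cancel_right1)
      show ?case
      proof (intro allI impI ballI)
        fix p :: ennreal and f assume p: "1 \<le> p" and f: "f \<in> param_space I b \<beta> Q"
        from f obtain d where d: "has_expansion I b d f" "\<And>j k. -1 \<le> j \<Longrightarrow> k \<in> I j \<Longrightarrow> \<bar>d j k\<bar> \<le> coeff_bound \<beta> Q j"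
          unfolding param_space_def coeff_bound_def by auto
        have n0: "n > 0" using n by simp
        obtain \<epsilon> where \<epsilon>: "\<And>j. -1 \<le> j \<Longrightarrow> indep_vars (\<lambda>_. borel) (\<epsilon> j) (I j)"
          "\<And>j k. -1 \<le> j \<Longrightarrow> k \<in> I j \<Longrightarrow> distr M borel (\<epsilon> j k) = std_normal_distribution"
          "\<And>j k \<omega>. stoch_integral M (white_noise W n f) (b j k) \<omega> = d j k + \<epsilon> j k \<omega> / sqrt (real n)"
          by (rule white_noise_coefficients[OF basis d(1) n0]) blast
        interpret N: noisy_coefficients \<phi> \<psi> s I b M n J d \<epsilon> \<beta> Q cl cu
          by unfold_locales (use n0 n \<epsilon>(1,2) Q d(2) cl cu elim(2,3) in auto)
        have risk: "risk M W I b J n p f = (\<integral>\<^sup>+\<omega>. Lp_norm p unit_measure (\<lambda>x. estimator I b J n (N.y \<omega>) x - f x) \<partial>M)"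
          unfolding risk_def N.y_def[abs_def] \<epsilon>(3) ..
        have bad: "prob N.bad \<le> real n powr (-3)"
          using N.prob_bad_le[OF c(2)[OF n1] c(1)] bad_cond by linarith
        have rem: "(\<Sum>j\<in>F. 2 powr (of_int j / 2) * N.remainder_bound j) \<le> real n powr (-r)"
          if "finite F" "\<And>j. j \<in> F \<Longrightarrow> -1 \<le> j" for F
          by (rule order_trans[OF N.sum_remainder_bound_le[OF c(2)[OF n1] c(1) bad CB(2) that] rem_cond])
        have sup: "risk M W I b J n p f \<le> ennreal (C1 * (real n / ln (real n)) powr (-r))"
        proof -
          have "risk M W I b J n p f \<le> ennreal C0 * ennreal (cu * (CV * 7 * (real n / ln (real n)) powr (-r) + real n powr (-r)))"
            using N.risk_le_sup[OF p C0[OF p] d(1) tail rem CV(2)] unfolding risk r(3) ratio_eq .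
          also have "\<dots> \<le> ennreal (\<bar>C0\<bar> * (cu * (CV * 7 * (real n / ln (real n)) powr (-r) + real n powr (-r))))"
            using cu(1) CV(1) by (intro lnat) auto
          also have "\<dots> \<le> ennreal (C1 * (real n / ln (real n)) powr (-r))"
          proof (rule ennreal_leI)
            have "\<bar>C0\<bar> * (cu * (CV * 7 * (real n / ln (real n)) powr (-r) + real n powr (-r))) \<le>
              \<bar>C0\<bar> * (cu * (CV * 7 * (real n / ln (real n)) powr (-r) + (real n / ln (real n)) powr (-r)))"
              using cu(1) rate_le by (intro mult_left_mono add_left_mono) auto
            then show "\<bar>C0\<bar> * (cu * (CV * 7 * (real n / ln (real n)) powr (-r) + real n powr (-r))) \<le> C1 * (real n / ln (real n)) powr (-r)"
              by (simp add: C1_def algebra_simps)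
          qed
          finally show ?thesis .
        qed
        have C1_le: "C1 * x \<le> C * x" "C2 * x \<le> C * x" if "x \<ge> 0" for x
          using that C12 by (auto intro!: mult_right_mono simp: C_def)
        have A: "risk M W I b J n p f \<le> ennreal (C * (real n / ln (real n)) powr (-r))"
          by (rule order_trans[OF sup]) (intro ennreal_leI C1_le, simp)
        have B: "risk M W I b J n p f \<le> ennreal (C * sqrt (enn2real p) * real n powr (-r))" if pt: "p < \<top>"
        proof -
          let ?P = "enn2real p"
          have P: "1 \<le> ?P" using p pt enn2real_mono[of 1 p] by simp
          have sP: "1 \<le> sqrt ?P" using P by simp
          show ?thesis
          proof (cases "?P \<le> ln (real n) powr (2 * r)")
            case True
            then obtain q where q: "q \<in> exponents n" "?P \<le> real q" "real q \<le> 2 * ?P"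
              using elim(4) P by blast
            have "risk M W I b J n p f \<le> ennreal C0 * ennreal (cu * (CV * (16 * k * sqrt ?P + 1) * real n powr (-r) + real n powr (-r)))"
              using N.risk_le_power[OF p C0[OF p] d(1) tail rem CV(2) q(1) pt q(2,3)]
              unfolding risk r(3) rate_eq k_def .
            also have "\<dots> \<le> ennreal (\<bar>C0\<bar> * (cu * (CV * (16 * k * sqrt ?P + 1) * real n powr (-r) + real n powr (-r))))"
              using cu(1) CV(1) k0 P by (intro lnat) (auto intro!: mult_nonneg_nonneg add_nonneg_nonneg)
            also have "\<dots> \<le> ennreal (C2 * (sqrt ?P * real n powr (-r)))"
            proof (rule ennreal_leI)
              have "CV * (16 * k * sqrt ?P + 1) + 1 \<le> CV * (16 * k * sqrt ?P + sqrt ?P) + sqrt ?P"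
                using sP CV(1) k0 by (intro add_mono mult_left_mono) auto
              then have "(CV * (16 * k * sqrt ?P + 1) + 1) * real n powr (-r) \<le> (CV * (16 * k * sqrt ?P + sqrt ?P) + sqrt ?P) * real n powr (-r)"
                by (rule mult_right_mono) simp
              then have "\<bar>C0\<bar> * (cu * ((CV * (16 * k * sqrt ?P + 1) + 1) * real n powr (-r))) \<le>
                \<bar>C0\<bar> * (cu * ((CV * (16 * k * sqrt ?P + sqrt ?P) + sqrt ?P) * real n powr (-r)))"
                using cu(1) by (intro mult_left_mono) auto
              then show "\<bar>C0\<bar> * (cu * (CV * (16 * k * sqrt ?P + 1) * real n powr (-r) + real n powr (-r))) \<le> C2 * (sqrt ?P * real n powr (-r))"
                by (simp add: C2_def algebra_simps)
            qed
            also have "\<dots> \<le> ennreal (C * (sqrt ?P * real n powr (-r)))" by (intro ennreal_leI C1_le) simp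
            finally show ?thesis by (simp add: mult.assoc)
          next
            case False
            have "(ln (real n) powr r)\<^sup>2 = ln (real n) powr (2 * r)"
              using n by (simp add: power2_eq_square flip: powr_add)
            then have "(ln (real n) powr r)\<^sup>2 \<le> ?P" using False by simp
            then have "ln (real n) powr r \<le> sqrt ?P" by (rule real_le_rsqrt)
            then have "(real n / ln (real n)) powr (-r) \<le> sqrt ?P * real n powr (-r)"
              unfolding rate_log by (rule mult_right_mono) simp
            then have "C * (real n / ln (real n)) powr (-r) \<le> C * (sqrt ?P * real n powr (-r))"
              using C12 by (intro mult_left_mono) (auto simp: C_def)
            then show ?thesis using A by (simp add: mult.assoc) (meson ennreal_leI order_trans)
          qed
        qed
        show "risk M W I b J n p f \<le> ennreal (C * (real n / ln (real n)) powr (-r)) \<and>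
          (p < \<top> \<longrightarrow> risk M W I b J n p f \<le> ennreal (C * sqrt (enn2real p) * real n powr (-r)))"
          using A B by blast
      qed
    qed
  qed
qed

theorem theorem3:
  fixes M :: "'w measure" and W :: "real \<Rightarrow> 'w \<Rightarrow> real"
    and \<phi> \<psi> :: "real \<Rightarrow> real" and s :: nat
    and I :: "int \<Rightarrow> int set" and b :: "int \<Rightarrow> int \<Rightarrow> real \<Rightarrow> real"
    and J :: "nat \<Rightarrow> int"
  assumes "brownian_motion M W"
    and "interval_wavelet_basis \<phi> \<psi> s I b"
    and "comparable_on {1..} (\<lambda>n. 2 powr of_int (J n)) real"
  shows "\<forall>\<beta>>0. \<forall>Q>0.
    (\<exists>C::real.
      limsup (\<lambda>n::nat. SUP p\<in>{1..}. SUP f\<in>param_space I b \<beta> Q.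
        ennreal (real n powr (\<beta> / (2 * \<beta> + 1)) * (if p = \<top> then 0 else 1 / sqrt (enn2real p))
                 + (real n / ln (real n)) powr (\<beta> / (2 * \<beta> + 1)))
        * risk M W I b J n p f) \<le> ennreal C) \<and>
    (\<forall>p. 1 \<le> p \<and> p < \<top> \<longrightarrow>
      (\<exists>C::real. \<forall>\<^sub>F n::nat in sequentially.
        (SUP f\<in>param_space I b \<beta> Q. risk M W I b J n p f)
          \<le> ennreal (C * real n powr (- (\<beta> / (2 * \<beta> + 1)))))) \<and>
    (\<exists>C::real. \<forall>\<^sub>F n::nat in sequentially.
      (SUP f\<in>param_space I b \<beta> Q. risk M W I b J n \<top> f)
        \<le> ennreal (C * (real n / ln (real n)) powr (- (\<beta> / (2 * \<beta> + 1)))))"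
proof (intro allI impI)
  fix \<beta> Q :: real assume \<beta>: "0 < \<beta>" and Q: "0 < Q"
  let ?r = "\<beta> / (2 * \<beta> + 1)"
  let ?\<Theta> = "param_space I b \<beta> Q" and ?R = "risk M W I b J"
  obtain C where C: "C > 0" and ev: "\<forall>\<^sub>F n in sequentially. \<forall>p\<ge>1. \<forall>f\<in>?\<Theta>.
    ?R n p f \<le> ennreal (C * (real n / ln (real n)) powr (-?r)) \<and>
    (p < \<top> \<longrightarrow> ?R n p f \<le> ennreal (C * sqrt (enn2real p) * real n powr (-?r)))"
    by (rule uniform_risk_bound[OF assms \<beta> Q])
  \<comment> \<open>Each of the two weights is the reciprocal of one of the two rates, so each
    contributes at most \<open>C\<close>.\<close>
  have "limsup (\<lambda>n::nat. SUP p\<in>{1..}. SUP f\<in>?\<Theta>.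
      ennreal (real n powr ?r * (if p = \<top> then 0 else 1 / sqrt (enn2real p)) + (real n / ln (real n)) powr ?r) * ?R n p f)
      \<le> ennreal (2 * C)"
  proof (rule Limsup_bounded)
    have ev2: "\<forall>\<^sub>F n::nat in sequentially. ln (real n) > 0" by real_asymp
    show "\<forall>\<^sub>F n in sequentially. (SUP p\<in>{1..}. SUP f\<in>?\<Theta>.
      ennreal (real n powr ?r * (if p = \<top> then 0 else 1 / sqrt (enn2real p)) + (real n / ln (real n)) powr ?r) * ?R n p f)
      \<le> ennreal (2 * C)"
      using ev ev2 eventually_gt_at_top[of 0]
    proof eventually_elim
      case (elim n)
      show ?case
      proof (intro SUP_least)
        fix p :: ennreal and f assume p: "p \<in> {1..}" and f: "f \<in> ?\<Theta>"
        have b1: "?R n p f \<le> ennreal (C * (real n / ln (real n)) powr (-?r))"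
          and b2: "p < \<top> \<Longrightarrow> ?R n p f \<le> ennreal (C * sqrt (enn2real p) * real n powr (-?r))"
          using elim(1) p f by auto
        have "ennreal (real n powr ?r * (if p = \<top> then 0 else 1 / sqrt (enn2real p))) * ?R n p f \<le> ennreal C"
        proof (cases "p = \<top>")
          case False
          then have pt: "p < \<top>" by (simp add: less_top)
          have P: "1 \<le> enn2real p" using p pt enn2real_mono[of 1 p] by simp
          have "ennreal (real n powr ?r * (1 / sqrt (enn2real p))) * ?R n p f \<le>
            ennreal (real n powr ?r * (1 / sqrt (enn2real p))) * ennreal (C * sqrt (enn2real p) * real n powr (-?r))"
            by (intro mult_left_mono b2 pt) simp
          also have "\<dots> = ennreal ((real n powr ?r * (1 / sqrt (enn2real p))) * (C * sqrt (enn2real p) * real n powr (-?r)))"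
            using C by (intro ennreal_mult[symmetric]) auto
          also have "(real n powr ?r * (1 / sqrt (enn2real p))) * (C * sqrt (enn2real p) * real n powr (-?r)) = C"
            using elim(3) P by (simp add: powr_minus)
          finally show ?thesis using False by simp
        qed simp
        moreover have "ennreal ((real n / ln (real n)) powr ?r) * ?R n p f \<le> ennreal C"
        proof -
          have "ennreal ((real n / ln (real n)) powr ?r) * ?R n p f \<le>
            ennreal ((real n / ln (real n)) powr ?r) * ennreal (C * (real n / ln (real n)) powr (-?r))"
            by (intro mult_left_mono b1) simp
          also have "\<dots> = ennreal ((real n / ln (real n)) powr ?r * (C * (real n / ln (real n)) powr (-?r)))"
            using C by (intro ennreal_mult[symmetric]) auto
          also have "(real n / ln (real n)) powr ?r * (C * (real n / ln (real n)) powr (-?r)) = C"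
            using elim(2,3) by (simp add: powr_minus)
          finally show ?thesis .
        qed
        ultimately have "ennreal (real n powr ?r * (if p = \<top> then 0 else 1 / sqrt (enn2real p))) * ?R n p f +
          ennreal ((real n / ln (real n)) powr ?r) * ?R n p f \<le> ennreal C + ennreal C"
          by (rule add_mono)
        also have "ennreal C + ennreal C = ennreal (2 * C)" using C by (simp flip: ennreal_plus)
        moreover have "ennreal (u + v) * R = ennreal u * R + ennreal v * R" if "0 \<le> u" "0 \<le> v" for u v R
          using that by (simp add: ennreal_plus distrib_right)
        ultimately show "ennreal (real n powr ?r * (if p = \<top> then 0 else 1 / sqrt (enn2real p)) + (real n / ln (real n)) powr ?r) * ?R n p f \<le> ennreal (2 * C)"
          by simp
      qed
    qed
  qed
  moreover have "\<exists>C::real. \<forall>\<^sub>F n::nat in sequentially. (SUP f\<in>?\<Theta>. ?R n p f) \<le> ennreal (C * real n powr (- ?r))"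
    if "1 \<le> p \<and> p < \<top>" for p
    using ev by (intro exI[of _ "C * sqrt (enn2real p)"], elim eventually_mono) (use that in \<open>auto intro!: SUP_least\<close>)
  moreover have "\<exists>C::real. \<forall>\<^sub>F n::nat in sequentially. (SUP f\<in>?\<Theta>. ?R n \<top> f) \<le> ennreal (C * (real n / ln (real n)) powr (- ?r))"
    using ev by (intro exI[of _ C], elim eventually_mono) (auto intro!: SUP_least)
  ultimately show "(\<exists>C::real.
      limsup (\<lambda>n::nat. SUP p\<in>{1..}. SUP f\<in>param_space I b \<beta> Q.
        ennreal (real n powr (\<beta> / (2 * \<beta> + 1)) * (if p = \<top> then 0 else 1 / sqrt (enn2real p))
                 + (real n / ln (real n)) powr (\<beta> / (2 * \<beta> + 1)))
        * risk M W I b J n p f) \<le> ennreal C) \<and>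
    (\<forall>p. 1 \<le> p \<and> p < \<top> \<longrightarrow>
      (\<exists>C::real. \<forall>\<^sub>F n::nat in sequentially.
        (SUP f\<in>param_space I b \<beta> Q. risk M W I b J n p f)
          \<le> ennreal (C * real n powr (- (\<beta> / (2 * \<beta> + 1)))))) \<and>
    (\<exists>C::real. \<forall>\<^sub>F n::nat in sequentially.
      (SUP f\<in>param_space I b \<beta> Q. risk M W I b J n \<top> f)
        \<le> ennreal (C * (real n / ln (real n)) powr (- (\<beta> / (2 * \<beta> + 1)))))"
    by blast
qed

end
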